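(* The average-case time complexity of the word problem in Thompson's group $F$ is linear.
   Context: Thompson's group $F$ is the group of orientation-preserving piecewise linear homeomorphisms of $[0,1]$ that have finitely many breakpoints, all at dyadic rationals, and all of whose slopes are integer powers of $2$; it is finitely generated (by two elements). Algorithms run on multitape Turing machines. A group $G$ is given with a fixed finite generating set $X$; inputs are arbitrary (not necessarily freely reduced) words in the alphabet $X\cup X^{-1}$, and $W_n$ denotes the set of all such words of length $n$. The word problem: given a word $w$, decide whether $w=1$ in $G$. For an algorithm, $T(w)$ is its running time on input $w$. The average-case time complexity of the word problem in $G$ is linear if there is an algorithm solving the word problem in $G$ for which $\frac{1}{|W_n|}\sum_{w\in W_n}T(w)=O(n)$. *)

theory Defs
  imports
    "HOL-Algebra.Bij"
    "HOL-Algebra.Generated_Groups"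
    "HOL-Analysis.Analysis"
    "HOL-Library.Landau_Symbols"
begin

section \<open>Thompson's group F\<close>

definition dyadic_rationals :: "real set" where
  "dyadic_rationals = {of_int m / 2 ^ k | (m :: int) (k :: nat). True}"

text \<open>
  The homeomorphisms are represented as functions on the reals that are undefined outside the
  unit interval (as in \<^const>\<open>BijGroup\<close>). In the last condition \<open>B\<close> is a finite set of dyadic
  rationals containing all breakpoints: on each subinterval whose interior avoids \<open>B\<close>, the map is
  affine with slope an integer power of 2.
\<close>

definition thompson_maps :: "(real \<Rightarrow> real) set" where
  "thompson_maps = {f \<in> extensional {0..1}.
     (\<exists>g. homeomorphism {0..1} {0..1} f g) \<and>
     strict_mono_on {0..1} f \<and>
     (\<exists>B. finite B \<and> B \<subseteq> dyadic_rationals \<and>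
       (\<forall>a b. 0 \<le> a \<and> a < b \<and> b \<le> 1 \<and> {a<..<b} \<inter> B = {} \<longrightarrow>
         (\<exists>(k :: int) c. \<forall>x\<in>{a..b}. f x = 2 powi k * x + c)))}"

text \<open>The product of \<open>f\<close> and \<open>g\<close> is the composition \<open>f \<circ> g\<close>, restricted to the unit interval.\<close>

definition thompson_F :: "(real \<Rightarrow> real) monoid" where
  "thompson_F = (BijGroup {0..1})\<lparr>carrier := thompson_maps\<rparr>"


section \<open>Words over a generating set\<close>

text \<open>
  The letter \<open>(x, True)\<close> stands for the generator \<open>x\<close> and \<open>(x, False)\<close> for its formal inverse, so
  that \<open>X \<union> X\<^sup>-\<^sup>1\<close> has \<open>2 * card X\<close> letters.
\<close>

type_synonym 'a letter = "'a \<times> bool"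

definition letters :: "'a set \<Rightarrow> 'a letter set" where
  "letters X = X \<times> UNIV"

definition words_of_length :: "'a set \<Rightarrow> nat \<Rightarrow> 'a letter list set" where
  "words_of_length X n = {w \<in> lists (letters X). length w = n}"

fun letter_value :: "('a, 'b) monoid_scheme \<Rightarrow> 'a letter \<Rightarrow> 'a" where
  "letter_value G (x, e) = (if e then x else inv\<^bsub>G\<^esub> x)"

definition word_value :: "('a, 'b) monoid_scheme \<Rightarrow> 'a letter list \<Rightarrow> 'a" where
  "word_value G w = foldr (\<lambda>l g. letter_value G l \<otimes>\<^bsub>G\<^esub> g) w \<one>\<^bsub>G\<^esub>"


section \<open>Deterministic multitape Turing machines\<close>

datatype 's symbol = Blank | Input 's | Work nat

datatype move = MoveL | Stay | MoveR

record 's machine =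
  num_tapes :: nat
  states :: "nat set"
  symbols :: "'s symbol set"
  start :: nat
  accept :: nat
  reject :: nat
  delta :: "nat \<Rightarrow> 's symbol list \<Rightarrow> nat \<times> ('s symbol \<times> move) list"

text \<open>
  The transition function maps a state and the list of scanned symbols (one for each tape) to the
  new state and the list of symbols to be written together with the head movements.
\<close>

definition multitape_TM :: "'s set \<Rightarrow> 's machine \<Rightarrow> bool" where
  "multitape_TM \<Sigma> M \<longleftrightarrow>
     num_tapes M \<ge> 1 \<and>
     finite (states M) \<and> finite (symbols M) \<and>
     Blank \<in> symbols M \<and> Input ` \<Sigma> \<subseteq> symbols M \<and>
     start M \<in> states M \<and> accept M \<in> states M \<and> reject M \<in> states M \<and>
     accept M \<noteq> reject M \<and>
     (\<forall>q\<in>states M - {accept M, reject M}. \<forall>xs\<in>lists (symbols M). length xs = num_tapes M \<longrightarrow>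
        fst (delta M q xs) \<in> states M \<and>
        length (snd (delta M q xs)) = num_tapes M \<and>
        fst ` set (snd (delta M q xs)) \<subseteq> symbols M)"

text \<open>Tapes are infinite in both directions; a tape is given by its contents and head position.\<close>

type_synonym 's tape = "(int \<Rightarrow> 's symbol) \<times> int"
type_synonym 's config = "nat \<times> 's tape list"

fun move_head :: "move \<Rightarrow> int \<Rightarrow> int" where
  "move_head MoveL p = p - 1"
| "move_head Stay p = p"
| "move_head MoveR p = p + 1"

fun scan :: "'s tape \<Rightarrow> 's symbol" where
  "scan (t, p) = t p"

fun act :: "'s symbol \<times> move \<Rightarrow> 's tape \<Rightarrow> 's tape" where
  "act (s, m) (t, p) = (t(p := s), move_head m p)"

definition halted :: "'s machine \<Rightarrow> 's config \<Rightarrow> bool" where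
  "halted M c \<longleftrightarrow> fst c \<in> {accept M, reject M}"

definition step :: "'s machine \<Rightarrow> 's config \<Rightarrow> 's config" where
  "step M c = (if halted M c then c
     else (case delta M (fst c) (map scan (snd c)) of
             (q, as) \<Rightarrow> (q, map2 act as (snd c))))"

definition blank_tape :: "'s tape" where
  "blank_tape = (\<lambda>_. Blank, 0)"

text \<open>The input occupies the cells 0, 1, \<open>\<dots>\<close> of the first tape; all other cells are blank.\<close>

definition input_tape :: "'s list \<Rightarrow> 's tape" where
  "input_tape w =
     (\<lambda>i. if 0 \<le> i \<and> i < int (length w) then Input (w ! nat i) else Blank, 0)"

definition initial_config :: "'s machine \<Rightarrow> 's list \<Rightarrow> 's config" where
  "initial_config M w = (start M, input_tape w # replicate (num_tapes M - 1) blank_tape)"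

definition run :: "'s machine \<Rightarrow> 's list \<Rightarrow> nat \<Rightarrow> 's config" where
  "run M w t = (step M ^^ t) (initial_config M w)"

definition halts_on :: "'s machine \<Rightarrow> 's list \<Rightarrow> bool" where
  "halts_on M w \<longleftrightarrow> (\<exists>t. halted M (run M w t))"

text \<open>Only meaningful on inputs on which the machine halts.\<close>

definition running_time :: "'s machine \<Rightarrow> 's list \<Rightarrow> nat" where
  "running_time M w = (LEAST t. halted M (run M w t))"

definition accepts :: "'s machine \<Rightarrow> 's list \<Rightarrow> bool" where
  "accepts M w \<longleftrightarrow> (\<exists>t. fst (run M w t) = accept M)"


section \<open>Average-case complexity of the word problem\<close>

definition solves_word_problem ::
    "('a, 'b) monoid_scheme \<Rightarrow> 'a set \<Rightarrow> 'a letter machine \<Rightarrow> bool" where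
  "solves_word_problem G X M \<longleftrightarrow>
     multitape_TM (letters X) M \<and>
     (\<forall>w\<in>lists (letters X). halts_on M w \<and> (accepts M w \<longleftrightarrow> word_value G w = \<one>\<^bsub>G\<^esub>))"

definition average_running_time :: "'a set \<Rightarrow> 'a letter machine \<Rightarrow> nat \<Rightarrow> real" where
  "average_running_time X M n =
     (\<Sum>w\<in>words_of_length X n. real (running_time M w)) / real (card (words_of_length X n))"

definition word_problem_average_case_linear :: "('a, 'b) monoid_scheme \<Rightarrow> 'a set \<Rightarrow> bool" where
  "word_problem_average_case_linear G X \<longleftrightarrow>
     (\<exists>M. solves_word_problem G X M \<and> average_running_time X M \<in> O(\<lambda>n. real n))"

end

theory Submission
  imports Defs
begin

text \<open>
  The logarithms of the slopes at 0 and 1 map \<open>F\<close> onto \<open>\<int>\<^sup>2\<close>, and a word whose image is nonzero is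
  rejected after one scan with two counters. A random word of length \<open>n\<close> has image zero with
  probability \<open>O(1/n)\<close>: choose generators \<open>x\<close>, \<open>y\<close> with independent images and fix everything except
  the exponents of the letters over \<open>x\<close> and \<open>y\<close>. Hence quadratic time is affordable for the remaining
  words.

  For large \<open>K\<close> every letter is affine on the cells \<open>[m/2^K, (m+1)/2^K]\<close>, so a breakpoint of a word is
  the preimage of a grid point under a suffix of the word. The word is trivial iff it fixes all these
  preimages (it is affine in between), that is, iff each of its cyclic rotations fixes each grid point.
  A letter changes a bounded number of leading binary digits of a point, so the digits can be kept on a
  stack and one rotation is tested at one grid point in linear time. There are \<open>n 2^K\<close> such tests.
\<close>

section \<open>Dyadic rationals and Thompson maps\<close>

text \<open>The time budget forces the use of two independent weights: a word that survives the
  counters costs order n^2 steps, so survival must have probability O(1/n), whereas the vanishing of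
  a single weight can have probability of order n^(-1/2). Once the positions of \<open>x\<close> and
  \<open>y\<close> are fixed, two independent sums of signs remain. The largest binomial coefficient
  bounds their point probabilities by 1/sqrt(p) and 1/sqrt(q), where p - 1 and q - 1 count the
  occurrences of \<open>x\<close> and \<open>y\<close>. By AM-GM it suffices to average 1/p and 1/q
  separately, which can be done in closed form; no concentration inequality enters. The breakpoints
  of a word can have binary expansions of linear length, but they are never computed. If W is the
  whole word and a part A, applied first, sends p to a grid point, then A W A^-1 is a rotation of
  the word, and W fixes p iff this rotation fixes the grid point A p, which has only K
  digits.\<close>

lemma dyadicE:
  assumes "x \<in> dyadic_rationals"
  obtains m :: int and k :: nat where "x = of_int m / 2 ^ k"
  using assms unfolding dyadic_rationals_def by blast

lemma dyadicI: "of_int m / 2 ^ k \<in> dyadic_rationals"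
  unfolding dyadic_rationals_def by blast

lemma dyadic_add:
  assumes "x \<in> dyadic_rationals" "y \<in> dyadic_rationals"
  shows "x + y \<in> dyadic_rationals"
proof -
  obtain m k n l where "x = of_int m / 2 ^ k" "y = of_int n / 2 ^ l"
    using assms by (metis dyadicE)
  then have "x + y = of_int (m * 2 ^ l + n * 2 ^ k) / 2 ^ (k + l)"
    by (simp add: add_frac_eq power_add)
  then show ?thesis using dyadicI by metis
qed

lemma dyadic_mult:
  assumes "x \<in> dyadic_rationals" "y \<in> dyadic_rationals"
  shows "x * y \<in> dyadic_rationals"
proof -
  obtain m k n l where "x = of_int m / 2 ^ k" "y = of_int n / 2 ^ l"
    using assms by (metis dyadicE)
  then have "x * y = of_int (m * n) / 2 ^ (k + l)"
    by (simp add: power_add)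
  then show ?thesis using dyadicI by metis
qed

lemma dyadic_of_int: "of_int m \<in> dyadic_rationals"
  using dyadicI[of m 0] by simp

lemma dyadic_powi: "2 powi k \<in> dyadic_rationals"
proof (cases "k \<ge> 0")
  case True
  then have "2 powi k = (of_int (2 ^ nat k) :: real)"
    by (simp add: power_int_def)
  then show ?thesis using dyadic_of_int by metis
next
  case False
  then have "2 powi k = of_int 1 / (2 :: real) ^ nat (- k)"
    by (simp add: power_int_def field_simps)
  then show ?thesis using dyadicI by metis
qed

lemma dyadic_uminus:
  assumes "x \<in> dyadic_rationals"
  shows "- x \<in> dyadic_rationals"
  using dyadic_mult[OF dyadic_of_int[of "-1"] assms] by simp

lemma dyadic_diff:
  assumes "x \<in> dyadic_rationals" "y \<in> dyadic_rationals"
  shows "x - y \<in> dyadic_rationals"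
  using dyadic_add[OF assms(1) dyadic_uminus[OF assms(2)]] by simp

text \<open>The exceptional set is a parameter so that the sets belonging to an inverse, a composite
  or a reflection can be written down explicitly. It may contain points outside [0,1].\<close>

definition pl_off :: "real set \<Rightarrow> (real \<Rightarrow> real) \<Rightarrow> bool" where
  "pl_off B f \<longleftrightarrow> (\<forall>a b. 0 \<le> a \<and> a < b \<and> b \<le> 1 \<and> {a<..<b} \<inter> B = {} \<longrightarrow>
     (\<exists>(k :: int) c. \<forall>x\<in>{a..b}. f x = 2 powi k * x + c))"

lemma pl_offD:
  assumes "pl_off B f" "0 \<le> a" "a < b" "b \<le> 1" "{a<..<b} \<inter> B = {}"
  obtains k :: int and c where "\<And>x. a \<le> x \<Longrightarrow> x \<le> b \<Longrightarrow> f x = 2 powi k * x + c"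
proof -
  obtain k :: int and c where "\<forall>x\<in>{a..b}. f x = 2 powi k * x + c"
    using assms(1)[unfolded pl_off_def, rule_format, of a b] assms(2-5) by blast
  then show thesis by (intro that[of k c]) simp
qed

text \<open>An increasing map onto [0,1] has no choice at the ends. The statement is about bare
  functions because it is also applied to folds of letters, which are not extensional.\<close>

lemma strict_mono_homeo_ends:
  fixes f :: "real \<Rightarrow> real"
  assumes "f ` {0..1} = {0..1}" "strict_mono_on {0..1} f"
  shows "f 0 = 0" "f 1 = 1"
proof -
  have r: "f x \<in> {0..1}" if "x \<in> {0..1}" for x
    using assms(1) that by blast
  have mono: "f x \<le> f y" if "x \<in> {0..1}" "y \<in> {0..1}" "x \<le> y" for x y
    using strict_mono_onD[OF assms(2)] that by (metis le_less order_less_imp_le)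
  obtain z where "z \<in> {0..1}" "f z = 0"
    using assms(1) by (metis atLeastAtMost_iff imageE order_refl zero_le_one)
  then show "f 0 = 0" using mono[of 0 z] r[of 0] by auto
  obtain z where "z \<in> {0..1}" "f z = 1"
    using assms(1) by (metis atLeastAtMost_iff imageE order_refl zero_le_one)
  then show "f 1 = 1" using mono[of z 1] r[of 1] by auto
qed

text \<open>The intermediate value theorem makes \<open>f\<close> onto and compactness makes its
  inverse continuous, so the closure proofs need not exhibit an inverse homeomorphism each
  time.\<close>

lemma thompson_mapsI:
  assumes "f \<in> extensional {0..1}" "continuous_on {0..1} f" "strict_mono_on {0..1} f"
    and "f 0 = 0" "f 1 = 1" "finite B" "B \<subseteq> dyadic_rationals" "pl_off B f"
  shows "f \<in> thompson_maps"
proof -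
  have mono: "f x \<le> f y" if "x \<in> {0..1}" "y \<in> {0..1}" "x \<le> y" for x y
    using strict_mono_onD[OF assms(3)] that by (metis le_less order_less_imp_le)
  have "f ` {0..1} = {0..1}"
  proof
    show "f ` {0..1} \<subseteq> {0..1}"
      using mono[of 0] mono[of _ 1] assms(4,5) by force
    show "{0..1} \<subseteq> f ` {0..1}"
    proof
      fix y :: real assume "y \<in> {0..1}"
      then have "\<exists>x. 0 \<le> x \<and> x \<le> 1 \<and> f x = y"
        using assms by (intro IVT') auto
      then show "y \<in> f ` {0..1}" by force
    qed
  qed
  then have "\<exists>g. homeomorphism {0..1} {0..1} f g"
    using assms(2,3) by (intro homeomorphism_compact[of "{0..1}" f "{0..1}", simplified]) (auto intro: strict_mono_on_imp_inj_on)
  then show ?thesis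
    using assms unfolding thompson_maps_def pl_off_def by blast
qed

lemma thompson_mapsD:
  assumes "f \<in> thompson_maps"
  shows "f \<in> extensional {0..1}" "continuous_on {0..1} f" "strict_mono_on {0..1} f"
    "f 0 = 0" "f 1 = 1" "bij_betw f {0..1} {0..1}" "f ` {0..1} = {0..1}"
    "\<exists>B. finite B \<and> B \<subseteq> dyadic_rationals \<and> pl_off B f"
proof -
  obtain g where g: "homeomorphism {0..1} {0..1} f g"
    using assms unfolding thompson_maps_def by blast
  show s: "strict_mono_on {0..1} f"
    using assms unfolding thompson_maps_def by blast
  show i: "f ` {0..1} = {0..1}"
    using g unfolding homeomorphism_def by blast
  show "f \<in> extensional {0..1}"
    using assms unfolding thompson_maps_def by blast
  show "continuous_on {0..1} f"
    using g unfolding homeomorphism_def by blast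
  show "f 0 = 0" "f 1 = 1"
    using strict_mono_homeo_ends[OF i s] by auto
  show "bij_betw f {0..1} {0..1}"
    using i s unfolding bij_betw_def by (auto intro: strict_mono_on_imp_inj_on)
  show "\<exists>B. finite B \<and> B \<subseteq> dyadic_rationals \<and> pl_off B f"
    using assms unfolding thompson_maps_def pl_off_def by blast
qed

lemma thompson_maps_range:
  assumes "f \<in> thompson_maps" "x \<in> {0..1}"
  shows "f x \<in> {0..1}"
  using thompson_mapsD(7)[OF assms(1)] assms(2) by blast

section \<open>Action on dyadic cells\<close>

lemma dyadic_common_level:
  assumes "finite B" "B \<subseteq> dyadic_rationals"
  shows "\<exists>K. \<forall>b\<in>B. \<exists>m :: int. b = of_int m / 2 ^ K"
  using assms
proof (induction B)
  case (insert b B)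
  then obtain K where K: "\<forall>b\<in>B. \<exists>m :: int. b = of_int m / 2 ^ K" by auto
  obtain m k where b: "b = of_int m / 2 ^ k" using insert by (auto elim: dyadicE)
  have "\<exists>j :: int. x = of_int j / 2 ^ (K + k)" if "x \<in> insert b B" for x
  proof (cases "x = b")
    case True
    then have "x = of_int (m * 2 ^ K) / 2 ^ (K + k)" using b by (simp add: power_add)
    then show ?thesis by blast
  next
    case False
    then have "x \<in> B" using that by simp
    then obtain j :: int where "x = of_int j / 2 ^ K" using K by blast
    then have "x = of_int (j * 2 ^ k) / 2 ^ (K + k)" by (simp add: power_add)
    then show ?thesis by blast
  qed
  then show ?case by blast
qed simp

text \<open>In binary: on numbers that begin with the K digits of \<open>m\<close>, the map replaces
  this prefix by the l digits of \<open>m'\<close> and keeps the remaining digits \<open>y\<close>.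
  The bound on \<open>m'\<close> says that l digits suffice for the new prefix.\<close>

definition grid_affine :: "nat \<Rightarrow> (real \<Rightarrow> real) \<Rightarrow> bool" where
  "grid_affine K f \<longleftrightarrow> (\<forall>m < 2 ^ K. \<exists>m' l. m' < 2 ^ l \<and>
     (\<forall>y\<in>{0..1}. f ((real m + y) / 2 ^ K) = (real m' + y) / 2 ^ l))"

text \<open>At a level containing all breakpoints, \<open>f\<close> is 2^k x + c on each cell, with
  \<open>c\<close> dyadic. A cell of a finer level K has an image of length 2^-l for l = K - k, and
  once l reaches the exponent in the denominator of \<open>c\<close>, the left end of the image is a
  multiple of 2^-l. All large K are covered so that finitely many letters can share a level.\<close>

lemma thompson_grid_affine:
  assumes f: "f \<in> thompson_maps"
  shows "\<exists>K0. \<forall>K\<ge>K0. grid_affine K f"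
proof -
  obtain B where B: "finite B" "B \<subseteq> dyadic_rationals" "pl_off B f"
    using thompson_mapsD(8)[OF f] by blast
  obtain K1 where K1: "\<forall>b\<in>B. \<exists>m :: int. b = of_int m / 2 ^ K1"
    using dyadic_common_level[OF B(1,2)] by blast
  have "\<exists>k c. \<forall>x\<in>{real m / 2 ^ K1..(real m + 1) / 2 ^ K1}. f x = 2 powi k * x + c" if "m < 2 ^ K1" for m
  proof -
    have "{real m / 2 ^ K1<..<(real m + 1) / 2 ^ K1} \<inter> B = {}"
    proof (rule ccontr)
      assume "\<not> ?thesis"
      then obtain j :: int where "real m / 2 ^ K1 < of_int j / 2 ^ K1" "of_int j / 2 ^ K1 < (real m + 1) / 2 ^ K1"
        using K1 by fastforce
      then have "real_of_int (int m) < of_int j" "real_of_int j < of_int (int m + 1)"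
        by (auto simp: divide_less_cancel)
      then show False unfolding of_int_less_iff by linarith
    qed
    moreover have "real m + 1 \<le> 2 ^ K1"
      using that by (metis Suc_leI of_nat_Suc of_nat_le_iff of_nat_numeral of_nat_power add.commute)
    ultimately show ?thesis
      using B(3) unfolding pl_off_def by (simp add: divide_less_cancel)
  qed
  then obtain k c where kc: "\<And>m x. m < 2 ^ K1 \<Longrightarrow> x \<in> {real m / 2 ^ K1..(real m + 1) / 2 ^ K1} \<Longrightarrow> f x = 2 powi (k m) * x + c m"
    by metis
  \<comment> \<open>Walk along the grid from \<open>f 0 = 0\<close>: every cell adds a power of 2
    divided by 2^K1, so all grid values, and with them the constants \<open>c m\<close>, are
    dyadic.\<close>
  have dy: "f (real m / 2 ^ K1) \<in> dyadic_rationals" if "m \<le> 2 ^ K1" for m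
    using that
  proof (induction m)
    case 0
    then show ?case using thompson_mapsD(4)[OF f] dyadic_of_int[of 0] by simp
  next
    case (Suc m)
    have "f (real (Suc m) / 2 ^ K1) = f (real m / 2 ^ K1) + 2 powi (k m) * (of_int 1 / 2 ^ K1)"
      using kc[of m "real m / 2 ^ K1"] kc[of m "(real m + 1) / 2 ^ K1"] Suc.prems
      by (simp add: field_simps)
    then show ?case
      using Suc by (metis Suc_leD dyadic_add dyadic_mult dyadic_powi dyadicI)
  qed
  have "c m \<in> dyadic_rationals" if "m < 2 ^ K1" for m
  proof -
    have "c m = f (real m / 2 ^ K1) - 2 powi (k m) * (of_int (int m) / 2 ^ K1)"
      using kc[OF that, of "real m / 2 ^ K1"] by (simp add: field_simps)
    then show ?thesis
      using dy[of m] that by (metis dyadic_diff dyadic_mult dyadic_powi dyadicI less_imp_le)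
  qed
  then have "\<exists>d e. c m = of_int d / 2 ^ e" if "m < 2 ^ K1" for m
    using that by (metis dyadicE)
  then obtain d e where de: "\<And>m. m < 2 ^ K1 \<Longrightarrow> c m = of_int (d m) / 2 ^ e m"
    by metis
  \<comment> \<open>The sum bounds each summand. It ensures that l = K - k is nonnegative and at
    least the denominator exponent \<open>e\<close> on every cell.\<close>
  define K0 where "K0 = K1 + (\<Sum>m<2^K1. nat \<bar>k m\<bar> + e m)"
  have K0: "K1 \<le> K0" "nat \<bar>k m\<bar> + e m \<le> K0" if "m < 2 ^ K1" for m
  proof -
    have "nat \<bar>k m\<bar> + e m \<le> (\<Sum>m<2^K1. nat \<bar>k m\<bar> + e m)"
      using that by (intro member_le_sum) auto
    then show "nat \<bar>k m\<bar> + e m \<le> K0" unfolding K0_def by linarith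
  qed (simp add: K0_def)
  have "grid_affine K f" if "K \<ge> K0" for K
    unfolding grid_affine_def
  proof (intro allI impI)
    fix m :: nat assume m: "m < 2 ^ K"
    have "K1 \<le> K" using that K0(1)[of 0] by simp
    define D where "D = K - K1"
    have K: "K = K1 + D" using \<open>K1 \<le> K\<close> D_def by simp
    \<comment> \<open>The coarse cell of level \<open>K1\<close> that contains the fine cell
      \<open>m\<close>.\<close>
    define j where "j = m div 2 ^ D"
    have j: "j < 2 ^ K1" using m unfolding j_def K
      by (simp add: less_mult_imp_div_less power_add)
    define l where "l = nat (int K - k j)"
    have l: "int l = int K - k j" "l \<ge> e j"
      using K0(2)[OF j] that unfolding l_def by auto
    have jm: "real j * 2 ^ D \<le> real m" "real m + 1 \<le> (real j + 1) * 2 ^ D"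
    proof -
      have m_eq: "m = j * 2 ^ D + m mod 2 ^ D" unfolding j_def by (simp only: div_mult_mod_eq)
      then have "j * 2 ^ D \<le> m" by linarith
      then have "real (j * 2 ^ D) \<le> real m" using of_nat_le_iff by blast
      then show "real j * 2 ^ D \<le> real m" by simp
      have "m mod 2 ^ D < 2 ^ D" by simp
      moreover have "(j + 1) * 2 ^ D = j * 2 ^ D + 2 ^ D" by simp
      ultimately have "m + 1 \<le> (j + 1) * 2 ^ D" using m_eq by linarith
      then have "real (m + 1) \<le> real ((j + 1) * 2 ^ D)" using of_nat_le_iff by blast
      then show "real m + 1 \<le> (real j + 1) * 2 ^ D" by (simp add: algebra_simps)
    qed
    have p: "(2 :: real) powi k j = 2 ^ K / 2 ^ l"
    proof -
      have "(2 :: real) powi k j = 2 powi (int K - int l)" using l(1) by simp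
      then show ?thesis by (simp add: power_int_diff)
    qed
    define z where "z = int m + d j * 2 ^ (l - e j)"
    have cz: "real_of_int z = real m + c j * 2 ^ l"
    proof -
      have "(2 :: real) ^ l = 2 ^ (l - e j) * 2 ^ e j" using l(2) by (simp flip: power_add)
      then show ?thesis unfolding z_def de[OF j] by simp
    qed
    have fy: "f ((real m + y) / 2 ^ K) = (of_int z + y) / 2 ^ l" if y: "y \<in> {0..1}" for y
    proof -
      have "(real m + y) / 2 ^ K \<in> {real j / 2 ^ K1..(real j + 1) / 2 ^ K1}"
      proof -
        have "real j * 2 ^ D \<le> real m + y" "real m + y \<le> (real j + 1) * 2 ^ D"
          using y jm by auto
        then show ?thesis unfolding K power_add
          by (simp add: pos_le_divide_eq pos_divide_le_eq mult.commute mult.left_commute)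
      qed
      then have "f ((real m + y) / 2 ^ K) = 2 ^ K / 2 ^ l * ((real m + y) / 2 ^ K) + c j"
        using kc[OF j] p by metis
      also have "\<dots> = (of_int z + y) / 2 ^ l"
        unfolding cz by (simp add: field_simps)
      finally show ?thesis .
    qed
    \<comment> \<open>Since the image stays in [0,1], the integer \<open>z\<close> is a natural
      number below 2^l.\<close>
    have "f ((real m + 1) / 2 ^ K) \<le> 1" "f (real m / 2 ^ K) \<ge> 0"
    proof -
      have "real m + 1 \<le> 2 ^ K"
        using m by (metis Suc_leI of_nat_Suc of_nat_le_iff of_nat_numeral of_nat_power add.commute)
      then show "f ((real m + 1) / 2 ^ K) \<le> 1" "f (real m / 2 ^ K) \<ge> 0"
        using thompson_maps_range[OF f, of "(real m + 1) / 2 ^ K"] thompson_maps_range[OF f, of "real m / 2 ^ K"]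
        using m by (auto simp: less_imp_le)
    qed
    then have "real_of_int z / 2 ^ l \<ge> 0" "(real_of_int z + 1) / 2 ^ l \<le> 1"
      using fy[of 0] fy[of 1] by auto
    then have "real_of_int z \<ge> 0" "real_of_int z + 1 \<le> 2 ^ l"
      by (simp_all only: pos_divide_le_eq pos_le_divide_eq zero_less_power zero_less_numeral mult_zero_left mult_1)
    then have "real_of_int z \<ge> of_int 0" "real_of_int (z + 1) \<le> of_int (2 ^ l)" by auto
    then have z: "z \<ge> 0" "z + 1 \<le> 2 ^ l" unfolding of_int_le_iff by auto
    show "\<exists>m' l. m' < 2 ^ l \<and> (\<forall>y\<in>{0..1}. f ((real m + y) / 2 ^ K) = (real m' + y) / 2 ^ l)"
    proof (intro exI conjI ballI)
      show "nat z < 2 ^ l" using z by (simp add: nat_less_iff)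
      show "f ((real m + y) / 2 ^ K) = (real (nat z) + y) / 2 ^ l" if "y \<in> {0..1}" for y
        using fy[OF that] z by simp
    qed
  qed
  then show ?thesis by blast
qed

lemma thompson_preserves_dyadic:
  assumes f: "f \<in> thompson_maps" and x: "x \<in> dyadic_rationals" "x \<in> {0..1}"
  shows "f x \<in> dyadic_rationals"
\<comment> \<open>Every other dyadic point of [0,1] is the left end (y = 0) of a cell of a
  sufficiently fine level; 1 is not.\<close>
proof (cases "x = 1")
  case True
  then show ?thesis using thompson_mapsD(5)[OF f] dyadic_of_int[of 1] by simp
next
  case False
  obtain K0 where K0: "\<forall>K\<ge>K0. grid_affine K f" using thompson_grid_affine[OF f] by blast
  obtain m k where mk: "x = of_int m / 2 ^ k" using x(1) by (auto elim: dyadicE)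
  define K where "K = K0 + k"
  define j where "j = nat (m * 2 ^ K0)"
  have "m \<ge> 0" using mk x(2) by (simp add: pos_le_divide_eq)
  then have xj: "x = (real j + 0) / 2 ^ K" unfolding mk j_def K_def by (simp add: power_add)
  moreover have "x < 1" using x(2) False by simp
  ultimately have "real j < 2 ^ K" by (simp add: divide_less_eq)
  then have "real j < real (2 ^ K)" by simp
  then have "j < 2 ^ K" using of_nat_less_iff by blast
  moreover have "grid_affine K f" using K0 unfolding K_def by simp
  ultimately obtain m' l where "\<forall>y\<in>{0..1}. f ((real j + y) / 2 ^ K) = (real m' + y) / 2 ^ l"
    unfolding grid_affine_def by blast
  then have "f ((real j + 0) / 2 ^ K) = (real m' + 0) / 2 ^ l" by (rule bspec) simp
  then have "f x = of_int (int m') / 2 ^ l" using xj by simp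
  then show ?thesis using dyadicI by metis
qed

section \<open>Closure under inversion, composition and reflection\<close>

lemma thompson_inverse:
  assumes f: "f \<in> thompson_maps"
  shows "restrict (inv_into {0..1} f) {0..1} \<in> thompson_maps"
proof -
  define h where "h = restrict (inv_into {0..1} f) {0..1}"
  have bij: "bij_betw f {0..1} {0..1}" using thompson_mapsD(6)[OF f] .
  have h: "h x \<in> {0..1}" "f (h x) = x" if "x \<in> {0..1}" for x
    using that bij unfolding h_def
    by (simp_all add: bij_betw_inv_into_right) (metis atLeastAtMost_iff bij_betw_def inv_into_into)
  have hf: "h (f x) = x" if "x \<in> {0..1}" for x
    using that bij thompson_maps_range[OF f that] unfolding h_def by (simp add: bij_betw_inv_into_left)
  have sm: "strict_mono_on {0..1} f" using thompson_mapsD(3)[OF f] .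
  have smh: "strict_mono_on {0..1} h"
  proof (rule strict_mono_onI)
    fix x y :: real assume xy: "x \<in> {0..1}" "y \<in> {0..1}" "x < y"
    then have "f (h x) < f (h y)" using h by simp
    then show "h x < h y" using strict_mono_on_less[OF sm h(1)[OF xy(1)] h(1)[OF xy(2)]] by simp
  qed
  have cont: "continuous_on {0..1} h"
    using continuous_on_inv[OF thompson_mapsD(2)[OF f], of h] hf thompson_mapsD(7)[OF f] by auto
  obtain B where B: "finite B" "B \<subseteq> dyadic_rationals" "pl_off B f"
    using thompson_mapsD(8)[OF f] by blast
  have ends: "h 0 = 0" "h 1 = 1"
    using hf[of 0] hf[of 1] thompson_mapsD(4,5)[OF f] by simp_all
  \<comment> \<open>The inverse can break only at images of breakpoints. Points of \<open>B\<close>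
    outside [0,1] are discarded first, since \<open>f\<close> carries no information there.\<close>
  have "pl_off (f ` (B \<inter> {0..1})) h"
    unfolding pl_off_def
  proof (intro allI impI)
    fix a b :: real assume ab: "0 \<le> a \<and> a < b \<and> b \<le> 1 \<and> {a<..<b} \<inter> f ` (B \<inter> {0..1}) = {}"
    then have ab01: "a \<in> {0..1}" "b \<in> {0..1}" by auto
    have "z \<notin> B" if z: "z \<in> {h a<..<h b}" for z
    proof
      assume "z \<in> B"
      have z01: "z \<in> {0..1}" using z h(1)[OF ab01(1)] h(1)[OF ab01(2)] by auto
      have "f (h a) < f z" "f z < f (h b)"
        using z strict_mono_onD[OF sm] z01 h(1)[OF ab01(1)] h(1)[OF ab01(2)] by auto
      then have "f z \<in> {a<..<b}" using h(2) ab01 by auto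
      then show False using ab \<open>z \<in> B\<close> z01 by blast
    qed
    then have "{h a<..<h b} \<inter> B = {}" by blast
    moreover have "0 \<le> h a" "h a < h b" "h b \<le> 1"
      using h(1)[OF ab01(1)] h(1)[OF ab01(2)] strict_mono_onD[OF smh ab01] ab by auto
    ultimately obtain k c where kc: "\<And>x. h a \<le> x \<Longrightarrow> x \<le> h b \<Longrightarrow> f x = 2 powi k * x + c"
      using pl_offD[OF B(3)] by metis
    have "h y = 2 powi (- k) * y + (- c * 2 powi (- k))" if y: "y \<in> {a..b}" for y
    proof -
      have y01: "y \<in> {0..1}" using y ab by auto
      have "h a \<le> h y" "h y \<le> h b"
        using y strict_mono_on_less_eq[OF smh] y01 ab01 by auto
      then have "y = 2 powi k * h y + c" using kc h(2)[OF y01] by metis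
      then have "y - c = 2 powi k * h y" by simp
      then have "2 powi (- k) * (y - c) = h y" by (simp add: power_int_minus)
      then show ?thesis by (simp add: algebra_simps)
    qed
    then show "\<exists>(k :: int) c. \<forall>x\<in>{a..b}. h x = 2 powi k * x + c" by blast
  qed
  moreover have "f ` (B \<inter> {0..1}) \<subseteq> dyadic_rationals"
    using thompson_preserves_dyadic[OF f] B(2) by auto
  moreover have "h \<in> extensional {0..1}" unfolding h_def by (rule restrict_extensional)
  ultimately have "h \<in> thompson_maps"
    using thompson_mapsI[OF _ cont smh ends, of "f ` (B \<inter> {0..1})"] B(1) by blast
  then show ?thesis unfolding h_def .
qed

text \<open>A composite can break only where \<open>g\<close> breaks or where \<open>g\<close>
  reaches a breakpoint of \<open>f\<close>. The inverse \<open>i\<close> of \<open>g\<close>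
  produces the latter points and shows that they are dyadic.\<close>

lemma thompson_compose:
  assumes f: "f \<in> thompson_maps" and g: "g \<in> thompson_maps"
  shows "compose {0..1} f g \<in> thompson_maps"
proof -
  define h where "h = compose {0..1} f g"
  have h: "h x = f (g x)" if "x \<in> {0..1}" for x using that unfolding h_def by (simp add: compose_def)
  define i where "i = restrict (inv_into {0..1} g) {0..1}"
  have i: "i \<in> thompson_maps" unfolding i_def using thompson_inverse[OF g] .
  have ig: "i (g x) = x" if "x \<in> {0..1}" for x
    using that thompson_mapsD(6)[OF g] thompson_maps_range[OF g that] unfolding i_def
    by (simp add: bij_betw_inv_into_left)
  have gi: "g (i x) = x" if "x \<in> {0..1}" for x
    using that thompson_mapsD(6)[OF g] unfolding i_def by (simp add: bij_betw_inv_into_right)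
  have smg: "strict_mono_on {0..1} g" using thompson_mapsD(3)[OF g] .
  have smh: "strict_mono_on {0..1} h"
    using h strict_mono_onD[OF smg] strict_mono_onD[OF thompson_mapsD(3)[OF f]] thompson_maps_range[OF g]
    by (intro strict_mono_onI) simp
  have "continuous_on {0..1} (\<lambda>x. f (g x))"
    using continuous_on_compose2[OF thompson_mapsD(2)[OF f] thompson_mapsD(2)[OF g]] thompson_mapsD(7)[OF g] by simp
  then have cont: "continuous_on {0..1} h"
    using continuous_on_cong[of "{0..1}" "{0..1}" h "\<lambda>x. f (g x)"] h by simp
  have ends: "h 0 = 0" "h 1 = 1" using h thompson_mapsD(4,5)[OF f] thompson_mapsD(4,5)[OF g] by simp_all
  obtain Bf where Bf: "finite Bf" "Bf \<subseteq> dyadic_rationals" "pl_off Bf f"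
    using thompson_mapsD(8)[OF f] by blast
  obtain Bg where Bg: "finite Bg" "Bg \<subseteq> dyadic_rationals" "pl_off Bg g"
    using thompson_mapsD(8)[OF g] by blast
  define B where "B = Bg \<union> i ` (Bf \<inter> {0..1})"
  have "pl_off B h"
    unfolding pl_off_def
  proof (intro allI impI)
    fix a b :: real assume ab: "0 \<le> a \<and> a < b \<and> b \<le> 1 \<and> {a<..<b} \<inter> B = {}"
    then have ab01: "a \<in> {0..1}" "b \<in> {0..1}" by auto
    have "{a<..<b} \<inter> Bg = {}" using ab unfolding B_def by blast
    then obtain k1 c1 where kc1: "\<And>x. a \<le> x \<Longrightarrow> x \<le> b \<Longrightarrow> g x = 2 powi k1 * x + c1"
      using pl_offD[OF Bg(3)] ab by metis
    have "z \<notin> Bf" if z: "z \<in> {g a<..<g b}" for z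
    proof
      assume "z \<in> Bf"
      have z01: "z \<in> {0..1}" using z thompson_maps_range[OF g ab01(1)] thompson_maps_range[OF g ab01(2)] by auto
      have "i (g a) < i z" "i z < i (g b)"
        using z strict_mono_onD[OF thompson_mapsD(3)[OF i]] z01
          thompson_maps_range[OF g ab01(1)] thompson_maps_range[OF g ab01(2)] by auto
      then have "i z \<in> {a<..<b}" using ig ab01 by auto
      then show False using ab \<open>z \<in> Bf\<close> z01 unfolding B_def by blast
    qed
    then have "{g a<..<g b} \<inter> Bf = {}" by blast
    moreover have "0 \<le> g a" "g a < g b" "g b \<le> 1"
      using thompson_maps_range[OF g ab01(1)] thompson_maps_range[OF g ab01(2)] strict_mono_onD[OF smg ab01] ab by auto
    ultimately obtain k2 c2 where kc2: "\<And>x. g a \<le> x \<Longrightarrow> x \<le> g b \<Longrightarrow> f x = 2 powi k2 * x + c2"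
      using pl_offD[OF Bf(3)] by metis
    have "h y = 2 powi (k2 + k1) * y + (2 powi k2 * c1 + c2)" if y: "y \<in> {a..b}" for y
    proof -
      have y01: "y \<in> {0..1}" using y ab by auto
      have "g a \<le> g y" "g y \<le> g b"
        using y strict_mono_on_less_eq[OF smg] y01 ab01 by auto
      then have "h y = 2 powi k2 * (2 powi k1 * y + c1) + c2" using kc1[of y] kc2[of "g y"] h[OF y01] y by simp
      then show ?thesis by (simp add: algebra_simps power_int_add)
    qed
    then show "\<exists>(k :: int) c. \<forall>x\<in>{a..b}. h x = 2 powi k * x + c" by blast
  qed
  moreover have "B \<subseteq> dyadic_rationals"
    using thompson_preserves_dyadic[OF i] Bf(2) Bg(2) unfolding B_def by auto
  moreover have "finite B" using Bf(1) Bg(1) unfolding B_def by simp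
  moreover have "h \<in> extensional {0..1}" unfolding h_def by simp
  ultimately have "h \<in> thompson_maps" using thompson_mapsI[OF _ cont smh ends] by blast
  then show ?thesis unfolding h_def .
qed

text \<open>Conjugation by x -> 1 - x. It exchanges the ends of [0,1], so the germ at 1 is treated
  as a germ at 0.\<close>

definition flip :: "(real \<Rightarrow> real) \<Rightarrow> real \<Rightarrow> real" where
  "flip f = (\<lambda>x\<in>{0..1}. 1 - f (1 - x))"

lemma thompson_flip:
  assumes f: "f \<in> thompson_maps"
  shows "flip f \<in> thompson_maps"
proof -
  have fl: "flip f x = 1 - f (1 - x)" if "x \<in> {0..1}" for x using that by (simp add: flip_def)
  have "continuous_on {0..1} (\<lambda>x. 1 - f (1 - x))"
    by (intro continuous_intros continuous_on_compose2[OF thompson_mapsD(2)[OF f]]) auto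
  then have cont: "continuous_on {0..1} (flip f)"
    using continuous_on_cong[of "{0..1}" "{0..1}" "flip f" "\<lambda>x. 1 - f (1 - x)"] fl by simp
  have sm: "strict_mono_on {0..1} (flip f)"
    using fl strict_mono_onD[OF thompson_mapsD(3)[OF f]] by (intro strict_mono_onI) simp
  obtain B where B: "finite B" "B \<subseteq> dyadic_rationals" "pl_off B f"
    using thompson_mapsD(8)[OF f] by blast
  have pl: "pl_off ((\<lambda>x. 1 - x) ` B) (flip f)"
    unfolding pl_off_def
  proof (intro allI impI)
    fix a b :: real assume ab: "0 \<le> a \<and> a < b \<and> b \<le> 1 \<and> {a<..<b} \<inter> (\<lambda>x. 1 - x) ` B = {}"
    have "z \<notin> B" if "z \<in> {1 - b<..<1 - a}" for z
      using ab that by (force simp: disjoint_iff)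
    then have "{1 - b<..<1 - a} \<inter> B = {}" by blast
    then obtain k c where kc: "\<And>x. 1 - b \<le> x \<Longrightarrow> x \<le> 1 - a \<Longrightarrow> f x = 2 powi k * x + c"
      using pl_offD[OF B(3), of "1 - b" "1 - a"] ab by auto
    have "flip f y = 2 powi k * y + (1 - 2 powi k - c)" if y: "y \<in> {a..b}" for y
      using fl[of y] kc[of "1 - y"] y ab by (simp add: algebra_simps)
    then show "\<exists>(k :: int) c. \<forall>x\<in>{a..b}. flip f x = 2 powi k * x + c" by blast
  qed
  have dy: "(\<lambda>x. 1 - x) ` B \<subseteq> dyadic_rationals"
    using B(2) dyadic_diff[OF dyadic_of_int[of 1]] by auto
  show ?thesis
    by (rule thompson_mapsI[OF _ cont sm _ _ _ dy pl])
      (use B(1) thompson_mapsD(4,5)[OF f] in \<open>simp_all add: flip_def\<close>)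
qed

lemma flip_compose:
  assumes "g \<in> thompson_maps"
  shows "flip (compose {0..1} f g) = compose {0..1} (flip f) (flip g)"
proof
  fix x
  show "flip (compose {0..1} f g) x = compose {0..1} (flip f) (flip g) x"
    using thompson_maps_range[OF assms, of "1 - x"] by (auto simp: flip_def compose_def)
qed

lemma flip_flip:
  assumes "f \<in> extensional {0..1}"
  shows "flip (flip f) = f"
  using assms by (auto simp: flip_def extensional_def fun_eq_iff)

section \<open>Germs at the endpoints\<close>

definition slope0 :: "(real \<Rightarrow> real) \<Rightarrow> int" where
  "slope0 f = (THE k. \<exists>e>0. \<forall>x\<in>{0..e}. f x = 2 powi k * x)"

lemma slope0_eqI:
  assumes "e > 0" "\<And>x. 0 \<le> x \<Longrightarrow> x \<le> e \<Longrightarrow> f x = 2 powi k * x"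
  shows "slope0 f = k"
  unfolding slope0_def
proof (rule the_equality)
  show "\<exists>e>0. \<forall>x\<in>{0..e}. f x = 2 powi k * x" using assms by auto
  fix j assume "\<exists>e>0. \<forall>x\<in>{0..e}. f x = 2 powi j * x"
  then obtain d where d: "d > 0" "\<forall>x\<in>{0..d}. f x = 2 powi j * x" by blast
  define m where "m = min d e"
  have "m > 0" "m \<le> d" "m \<le> e" using assms(1) d(1) by (auto simp: m_def)
  then have "(2 :: real) powi j = 2 powi k" using assms(2)[of m] d(2) by auto
  then show "j = k"
    using power_int_strict_increasing[of j k "2 :: real"] power_int_strict_increasing[of k j "2 :: real"]
    by (cases j k rule: linorder_cases) auto
qed

lemma slope0_germ:
  assumes f: "f \<in> thompson_maps"
  obtains e where "0 < e" "e \<le> 1" "\<And>x. 0 \<le> x \<Longrightarrow> x \<le> e \<Longrightarrow> f x = 2 powi slope0 f * x"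
proof -
  obtain B where B: "finite B" "pl_off B f"
    using thompson_mapsD(8)[OF f] by blast
  define e where "e = Min (insert 1 (B \<inter> {0<..}))"
  have e: "e > 0" "e \<le> 1" using B(1) unfolding e_def by (auto simp: Min_gr_iff)
  have "e \<le> z" if "z \<in> B" "z > 0" for z using that B(1) unfolding e_def by (intro Min_le) auto
  then have "{0<..<e} \<inter> B = {}" by force
  then obtain k c where kc: "\<And>x. 0 \<le> x \<Longrightarrow> x \<le> e \<Longrightarrow> f x = 2 powi k * x + c"
    using pl_offD[OF B(2), of 0 e] e by auto
  moreover have "c = 0" using kc[of 0] thompson_mapsD(4)[OF f] e by simp
  ultimately have k: "\<And>x. 0 \<le> x \<Longrightarrow> x \<le> e \<Longrightarrow> f x = 2 powi k * x" by simp
  show thesis using that[OF e] k slope0_eqI[OF e(1), of f k] by blast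
qed

lemma slope0_compose:
  assumes f: "f \<in> thompson_maps" and g: "g \<in> thompson_maps"
  shows "slope0 (compose {0..1} f g) = slope0 f + slope0 g"
proof -
  obtain d where d: "0 < d" "d \<le> 1" "\<And>x. 0 \<le> x \<Longrightarrow> x \<le> d \<Longrightarrow> f x = 2 powi slope0 f * x"
    using slope0_germ[OF f] by metis
  obtain e where e: "0 < e" "e \<le> 1" "\<And>x. 0 \<le> x \<Longrightarrow> x \<le> e \<Longrightarrow> g x = 2 powi slope0 g * x"
    using slope0_germ[OF g] by metis
  \<comment> \<open>The radius is small enough for \<open>g\<close> to map [0,m] into the interval
    on which \<open>f\<close> is linear.\<close>
  define m where "m = min e (d / 2 powi slope0 g)"
  have m: "m > 0" "m \<le> e" "m \<le> d / 2 powi slope0 g" using d(1) e(1) by (auto simp: m_def)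
  show ?thesis
  proof (rule slope0_eqI[OF m(1)])
    fix x assume x: "0 \<le> x" "x \<le> m"
    have "g x = 2 powi slope0 g * x" using e(3) x m by simp
    moreover have "2 powi slope0 g * x \<le> d"
    proof -
      have "2 powi slope0 g * x \<le> 2 powi slope0 g * m" using x by (intro mult_left_mono) auto
      also have "\<dots> \<le> d" using m(3) by (simp add: pos_le_divide_eq mult.commute)
      finally show ?thesis .
    qed
    moreover have "0 \<le> 2 powi slope0 g * x" using x by simp
    moreover have "compose {0..1} f g x = f (g x)" using x m(2) e(2) by (simp add: compose_def)
    ultimately show "compose {0..1} f g x = 2 powi (slope0 f + slope0 g) * x"
      using d(3) by (simp add: power_int_add)
  qed
qed

text \<open>Slopes 2, 1 and 1/2 on the intervals cut out by 1/8, 1/4 and 1/2, and the identity from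
  1/2 on. The logarithmic slopes at the two ends are (1, 0), and (0, 1) for the reflection, so these
  two elements span the lattice of slope vectors. The max-min form makes continuity
  immediate.\<close>

definition bump :: "real \<Rightarrow> real" where
  "bump = (\<lambda>x\<in>{0..1}. max x (min (2 * x) (min (x + 1/8) (x / 2 + 1/4))))"

lemma bump_thompson: "bump \<in> thompson_maps"
proof -
  define p :: "real \<Rightarrow> real" where "p x = max x (min (2 * x) (min (x + 1/8) (x / 2 + 1/4)))" for x
  have b: "bump x = p x" if "x \<in> {0..1}" for x using that by (simp add: bump_def p_def)
  have "continuous_on {0..1} p" unfolding p_def by (intro continuous_intros) auto
  then have cont: "continuous_on {0..1} bump"
    using continuous_on_cong[of "{0..1}" "{0..1}" bump p] b by simp
  have sm: "strict_mono_on {0..1} bump"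
  proof (rule strict_mono_onI)
    fix x y :: real assume "x \<in> {0..1}" "y \<in> {0..1}" "x < y"
    then show "bump x < bump y" using b unfolding p_def by (auto simp: max_def min_def)
  qed
  have pl: "pl_off {1/8, 1/4, 1/2} bump"
    unfolding pl_off_def
  proof (intro allI impI)
    fix a b' :: real assume ab: "0 \<le> a \<and> a < b' \<and> b' \<le> 1 \<and> {a<..<b'} \<inter> {1/8, 1/4, 1/2} = {}"
    then consider "b' \<le> 1/8" | "a \<ge> 1/8" "b' \<le> 1/4" | "a \<ge> 1/4" "b' \<le> 1/2" | "a \<ge> 1/2"
      by fastforce
    then show "\<exists>(k :: int) c. \<forall>x\<in>{a..b'}. bump x = 2 powi k * x + c"
    proof cases
      case 1
      then have "\<forall>x\<in>{a..b'}. bump x = 2 powi 1 * x + 0" using ab b by (auto simp: p_def)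
      then show ?thesis by blast
    next
      case 2
      then have "\<forall>x\<in>{a..b'}. bump x = 2 powi 0 * x + 1/8" using ab b by (auto simp: p_def)
      then show ?thesis by blast
    next
      case 3
      then have "\<forall>x\<in>{a..b'}. bump x = 2 powi (- 1) * x + 1/4" using ab b by (auto simp: p_def power_int_minus)
      then show ?thesis by blast
    next
      case 4
      then have "\<forall>x\<in>{a..b'}. bump x = 2 powi 0 * x + 0" using ab b by (auto simp: p_def)
      then show ?thesis by blast
    qed
  qed
  have dy: "{1/8, 1/4, 1/2} \<subseteq> dyadic_rationals"
    using dyadicI[of 1 3] dyadicI[of 1 2] dyadicI[of 1 1] by simp
  show ?thesis
    by (rule thompson_mapsI[OF _ cont sm _ _ _ dy pl]) (simp_all add: bump_def)
qed

lemma slope0_bump: "slope0 bump = 1"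
  by (rule slope0_eqI[of "1/8"]) (auto simp: bump_def)

lemma slope0_flip_bump: "slope0 (flip bump) = 0"
  by (rule slope0_eqI[of "1/2"]) (auto simp: bump_def flip_def max_def min_def field_simps)

section \<open>A fixed-point criterion\<close>

text \<open>The first letter acts first. A fold need not be extensional (for the empty word it is
  the identity on all reals), so only its behaviour on [0,1] is recorded.\<close>

lemma fold_thompson:
  assumes "\<And>l. l \<in> set w \<Longrightarrow> a l \<in> thompson_maps"
  shows "bij_betw (fold a w) {0..1} {0..1} \<and> strict_mono_on {0..1} (fold a w)"
  using assms
proof (induction w)
  case Nil
  then show ?case by (auto simp: strict_mono_on_def id_def[symmetric] bij_betw_def)
next
  case (Cons l w)
  then have al: "a l \<in> thompson_maps"
    and w: "bij_betw (fold a w) {0..1} {0..1}" "strict_mono_on {0..1} (fold a w)" by auto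
  have "bij_betw (fold a w \<circ> a l) {0..1} {0..1}"
    using bij_betw_trans[OF thompson_mapsD(6)[OF al] w(1)] .
  moreover have "strict_mono_on {0..1} (fold a w \<circ> a l)"
    using strict_mono_onD[OF thompson_mapsD(3)[OF al]] strict_mono_onD[OF w(2)] thompson_maps_range[OF al]
    by (intro strict_mono_onI) simp
  ultimately show ?case by (simp add: comp_def)
qed

text \<open>Let W be the whole fold, A_j the fold of the first j letters and R_j the rotation by j.
  Then R_j A_j = A_j W, so if R_j fixes the grid point A_j p, injectivity of A_j shows that W fixes
  p. Between neighbouring points p of this kind no prefix image crosses a grid point, so every
  letter acts affinely there; W is affine on the gap and fixes both ends.\<close>

lemma fold_eq_id_if_rotations_fix_grid:
  fixes w :: "'l list"
  assumes a: "\<And>l. l \<in> set w \<Longrightarrow> a l \<in> thompson_maps"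
    and grid: "\<And>l. l \<in> set w \<Longrightarrow> grid_affine K (a l)"
    and rot: "\<And>j m. j < length w \<Longrightarrow> m < 2 ^ K \<Longrightarrow>
       fold a (drop j w @ take j w) (real m / 2 ^ K) = real m / 2 ^ K"
    and x: "x \<in> {0..1}"
  shows "fold a w x = x"
proof (cases "w = []")
  case False
  define A where "A j = fold a (take j w)" for j
  have A: "bij_betw (A j) {0..1} {0..1}" "strict_mono_on {0..1} (A j)" for j
    using fold_thompson[of "take j w" a] a in_set_takeD[of _ j w] unfolding A_def by blast+
  have W: "bij_betw (fold a w) {0..1} {0..1}" "strict_mono_on {0..1} (fold a w)"
    using fold_thompson[of w a] a by blast+
  have Ar: "A j p \<in> {0..1}" if "p \<in> {0..1}" for j p
    using A(1)[of j] that by (meson bij_betwE)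
  have Ai: "inj_on (A j) {0..1}" for j using A(1)[of j] by (simp add: bij_betw_def)
  have ends: "A j 0 = 0" "A j 1 = 1" for j
    using strict_mono_homeo_ends[of "A j"] A[of j] by (auto simp: bij_betw_def)
  have Wends: "fold a w 0 = 0" "fold a w 1 = 1"
    using strict_mono_homeo_ends[of "fold a w"] W by (auto simp: bij_betw_def)
  \<comment> \<open>The value \<open>m = 2 ^ K\<close> is included so that 1 belongs to
    \<open>P\<close>. The assumption \<open>rot\<close> does not cover it, but a point sent to 1 is
    1 itself.\<close>
  define P where "P = {p \<in> {0..1}. \<exists>j<length w. \<exists>m\<le>2 ^ K. A j p = real m / 2 ^ K}"
  have "P \<subseteq> (\<Union>j<length w. A j -` ((\<lambda>m. real m / 2 ^ K) ` {..2 ^ K}) \<inter> {0..1})"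
    unfolding P_def by auto
  moreover have "finite (\<Union>j<length w. A j -` ((\<lambda>m. real m / 2 ^ K) ` {..2 ^ K}) \<inter> {0..1})"
    using finite_vimage_IntI[OF _ Ai] by blast
  ultimately have finP: "finite P" by (rule finite_subset)
  have P01: "0 \<in> P" "1 \<in> P"
  proof -
    have "length w > 0" using False by simp
    moreover have "\<exists>m\<le>2 ^ K. A 0 0 = real m / 2 ^ K" by (rule exI[of _ 0]) (simp add: A_def)
    moreover have "\<exists>m\<le>2 ^ K. A 0 1 = real m / 2 ^ K" by (rule exI[of _ "2 ^ K"]) (simp add: A_def)
    ultimately show "0 \<in> P" "1 \<in> P" unfolding P_def by auto
  qed
  have fixP: "fold a w p = p" if "p \<in> P" for p
  proof -
    obtain j m where p: "p \<in> {0..1}" and jm: "j < length w" "m \<le> 2 ^ K" "A j p = real m / 2 ^ K"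
      using \<open>p \<in> P\<close> unfolding P_def by blast
    show ?thesis
    proof (cases "m = 2 ^ K")
      case True
      then have "A j p = A j 1" using jm(3) ends by simp
      then have "p = 1" using inj_onD[OF Ai] p by force
      then show ?thesis using Wends by simp
    next
      case False
      have split: "fold a w p = fold a (drop j w) (A j p)"
        unfolding A_def by (metis append_take_drop_id comp_apply fold_append)
      have "A j (fold a w p) = fold a (drop j w @ take j w) (A j p)"
        unfolding split by (simp add: A_def)
      also have "\<dots> = A j p" using rot[OF jm(1), of m] jm False by simp
      finally have "A j (fold a w p) = A j p" .
      moreover have "fold a w p \<in> {0..1}" using W(1) p by (meson bij_betwE)
      ultimately show ?thesis using inj_onD[OF Ai] p by blast
    qed
  qed
  show ?thesis
  proof (cases "x \<in> P")
    case False
    \<comment> \<open>The gap of \<open>P\<close> around \<open>x\<close>; it exists because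
      \<open>P\<close> is finite and contains 0 and 1.\<close>
    define lo where "lo = Max {p \<in> P. p < x}"
    define hi where "hi = Min {p \<in> P. x < p}"
    have "0 < x" "x < 1" using x False P01 by (metis atLeastAtMost_iff order_le_less)+
    then have "{p \<in> P. p < x} \<noteq> {}" "{p \<in> P. x < p} \<noteq> {}" using P01 by auto
    then have "lo \<in> {p \<in> P. p < x}" "hi \<in> {p \<in> P. x < p}"
      unfolding lo_def hi_def using finP by (intro Max_in Min_in; simp)+
    then have lohi: "lo \<in> P" "lo < x" "hi \<in> P" "x < hi" by auto
    have gap: False if "p \<in> P" "lo < p" "p < hi" for p
    proof (cases p x rule: linorder_cases)
      case less
      then have "p \<le> lo" unfolding lo_def using that finP by (intro Max_ge) auto
      then show False using that by simp
    next
      case greater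
      then have "hi \<le> p" unfolding hi_def using that finP by (intro Min_le) auto
      then show False using that by simp
    qed (use that False in simp)
    have lohi01: "lo \<in> {0..1}" "hi \<in> {0..1}" using lohi unfolding P_def by auto
    \<comment> \<open>Induction along the prefixes: the image of the gap lies in a single cell of
      level K, located by the image of \<open>x\<close>, and the next letter is affine on that
      cell.\<close>
    have aff: "\<exists>s d. \<forall>y\<in>{lo..hi}. A j y = s * y + d" if "j \<le> length w" for j
      using that
    proof (induction j)
      case 0
      have "\<forall>y\<in>{lo..hi}. A 0 y = 1 * y + 0" by (simp add: A_def)
      then show ?case by blast
    next
      case (Suc j)
      then obtain s d where sd: "\<forall>y\<in>{lo..hi}. A j y = s * y + d" by auto
      have j: "j < length w" using Suc.prems by simp
      define l where "l = w ! j"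
      have l: "l \<in> set w" using j by (simp add: l_def)
      have ASuc: "A (Suc j) y = a l (A j y)" for y
        unfolding A_def l_def using take_Suc_conv_app_nth[OF j] by simp
      define m where "m = nat \<lfloor>A j x * 2 ^ K\<rfloor>"
      have Ax: "0 \<le> A j x" "A j x < 1"
        using Ar[OF x, of j] strict_mono_onD[OF A(2)[of j] x, of 1] ends[of j] \<open>x < 1\<close> by auto
      have m: "real m \<le> A j x * 2 ^ K" "A j x * 2 ^ K < real m + 1"
        using Ax(1) unfolding m_def by (simp_all, linarith?)
      have "A j x * 2 ^ K < 1 * 2 ^ K" using Ax(2) by (intro mult_strict_right_mono) auto
      then have "real m < 2 ^ K" using m(1) by linarith
      then have mK: "m < 2 ^ K" by (metis of_nat_less_iff of_nat_numeral of_nat_power)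
      have nogrid: False if i: "i \<le> 2 ^ K" "A j lo < real i / 2 ^ K" "real i / 2 ^ K < A j hi" for i
      proof -
        have "real i \<le> real (2 ^ K)" using i(1) of_nat_le_iff by blast
        then have "real i / 2 ^ K \<in> {0..1}" by simp
        then obtain p where p: "p \<in> {0..1}" "A j p = real i / 2 ^ K"
          using A(1)[of j] unfolding bij_betw_def by (metis imageE)
        then have "p \<in> P" using j i(1) unfolding P_def by blast
        moreover have "lo < p" "p < hi"
          using strict_mono_on_less[OF A(2)[of j]] p i lohi01 by metis+
        ultimately show False using gap by blast
      qed
      have lo: "real m / 2 ^ K \<le> A j lo"
      proof (rule ccontr)
        assume "\<not> ?thesis"
        moreover have "real m / 2 ^ K \<le> A j x" using m(1) by (simp add: pos_divide_le_eq)
        moreover have "A j x < A j hi" using strict_mono_onD[OF A(2)[of j] x lohi01(2)] lohi by simp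
        ultimately show False using nogrid[of m] mK by simp
      qed
      have hi: "A j hi \<le> (real m + 1) / 2 ^ K"
      proof (rule ccontr)
        assume "\<not> ?thesis"
        moreover have "A j x < real (Suc m) / 2 ^ K" using m(2) by (simp add: pos_less_divide_eq)
        moreover have "A j lo < A j x" using strict_mono_onD[OF A(2)[of j] lohi01(1) x] lohi by simp
        ultimately show False using nogrid[of "Suc m"] mK by (simp add: add.commute)
      qed
      obtain m' l' where ml: "\<forall>y\<in>{0..1}. a l ((real m + y) / 2 ^ K) = (real m' + y) / 2 ^ l'"
        using grid[OF l] mK unfolding grid_affine_def by blast
      have "A (Suc j) y = (s * 2 ^ K / 2 ^ l') * y + (real m' + d * 2 ^ K - real m) / 2 ^ l'" if y: "y \<in> {lo..hi}" for y
      proof -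
        have y01: "y \<in> {0..1}" using y lohi01 by auto
        have "A j lo \<le> A j y" "A j y \<le> A j hi"
          using strict_mono_on_less_eq[OF A(2)[of j]] y y01 lohi01 by auto
        then have "real m / 2 ^ K \<le> A j y" "A j y \<le> (real m + 1) / 2 ^ K" using lo hi by auto
        then have "A j y * 2 ^ K - real m \<in> {0..1}" by (auto simp: pos_divide_le_eq pos_le_divide_eq)
        then have "a l ((real m + (A j y * 2 ^ K - real m)) / 2 ^ K) = (real m' + (A j y * 2 ^ K - real m)) / 2 ^ l'"
          using ml by blast
        then have "A (Suc j) y = (real m' + (A j y * 2 ^ K - real m)) / 2 ^ l'" using ASuc by simp
        also have "A j y = s * y + d" using sd y by blast
        finally show ?thesis by (simp add: algebra_simps add_divide_distrib diff_divide_distrib)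
      qed
      then show ?case by blast
    qed
    obtain s d where sd: "\<forall>y\<in>{lo..hi}. fold a w y = s * y + d"
      using aff[of "length w"] unfolding A_def by auto
    \<comment> \<open>An affine map with two distinct fixed points is the identity.\<close>
    have "s * lo + d = lo" "s * hi + d = hi" using sd fixP lohi by (metis atLeastAtMost_iff less_imp_le order_refl order_trans)+
    then have "s * (hi - lo) = 1 * (hi - lo)" by (simp add: algebra_simps)
    then have "s = 1" using lohi by (metis cancel_comm_monoid_add_class.diff_cancel diff_add_cancel less_trans mult_right_cancel order_less_irrefl add_0)
    then have "d = 0" using \<open>s * lo + d = lo\<close> by simp
    then show ?thesis using sd lohi \<open>s = 1\<close> by simp
  qed (use fixP in blast)
qed simp

section \<open>Thompson's group as a group\<close>

lemma thompson_subset_Bij: "thompson_maps \<subseteq> Bij {0..1}"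
  using thompson_mapsD(1,6) unfolding Bij_def by blast

lemma thompson_subgroup: "subgroup thompson_maps (BijGroup {0..1})"
proof (rule subgroup.intro)
  show "thompson_maps \<subseteq> carrier (BijGroup {0..1})"
    using thompson_subset_Bij by (simp add: BijGroup_def)
  show "f \<otimes>\<^bsub>BijGroup {0..1}\<^esub> g \<in> thompson_maps" if "f \<in> thompson_maps" "g \<in> thompson_maps" for f g
    using that thompson_compose subsetD[OF thompson_subset_Bij] by (simp add: BijGroup_def)
  have inv: "inv\<^bsub>BijGroup {0..1}\<^esub> f \<in> thompson_maps" if "f \<in> thompson_maps" for f
    using that thompson_inverse inv_BijGroup subsetD[OF thompson_subset_Bij] by (metis restrict_ext)
  then show "inv\<^bsub>BijGroup {0..1}\<^esub> f \<in> thompson_maps" if "f \<in> thompson_maps" for f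
    using that .
  \<comment> \<open>The identity is obtained as the product of an element and its inverse, which
    saves checking the conditions of \<open>thompson_maps\<close> for it directly.\<close>
  have "bump \<otimes>\<^bsub>BijGroup {0..1}\<^esub> inv\<^bsub>BijGroup {0..1}\<^esub> bump = \<one>\<^bsub>BijGroup {0..1}\<^esub>"
    by (rule group.r_inv[OF group_BijGroup])
      (use subsetD[OF thompson_subset_Bij bump_thompson] in \<open>simp add: BijGroup_def\<close>)
  moreover have "bump \<otimes>\<^bsub>BijGroup {0..1}\<^esub> inv\<^bsub>BijGroup {0..1}\<^esub> bump \<in> thompson_maps"
    using bump_thompson inv[OF bump_thompson] thompson_compose subsetD[OF thompson_subset_Bij]
    by (simp add: BijGroup_def)
  ultimately show "\<one>\<^bsub>BijGroup {0..1}\<^esub> \<in> thompson_maps" by simp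
qed

lemma group_thompson_F: "group thompson_F"
  unfolding thompson_F_def using subgroup.subgroup_is_group[OF thompson_subgroup group_BijGroup] .

lemma carrier_thompson_F: "carrier thompson_F = thompson_maps"
  by (simp add: thompson_F_def)

lemma one_thompson_F: "\<one>\<^bsub>thompson_F\<^esub> = (\<lambda>x\<in>{0..1}. x)"
  by (simp add: thompson_F_def BijGroup_def)

lemma mult_thompson_F:
  assumes "f \<in> thompson_maps" "g \<in> thompson_maps"
  shows "f \<otimes>\<^bsub>thompson_F\<^esub> g = compose {0..1} f g"
  using assms subsetD[OF thompson_subset_Bij] by (simp add: thompson_F_def BijGroup_def)

lemma letter_value_closed:
  assumes "group G" "X \<subseteq> carrier G" "l \<in> letters X"
  shows "letter_value G l \<in> carrier G"
  using assms by (cases l) (auto simp: letters_def group.inv_closed)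

lemma word_value_closed:
  assumes "group G" "X \<subseteq> carrier G" "w \<in> lists (letters X)"
  shows "word_value G w \<in> carrier G"
  using assms(3)
proof (induction w)
  case Nil
  then show ?case using assms(1) by (simp add: word_value_def group.is_monoid monoid.one_closed)
next
  case (Cons l w)
  then have "letter_value G l \<in> carrier G"
    using assms by (cases l) (auto simp: letters_def group.inv_closed)
  then show ?case using Cons assms(1) by (simp add: word_value_def group.is_monoid monoid.m_closed)
qed

lemma word_value_Cons: "word_value G (l # w) = letter_value G l \<otimes>\<^bsub>G\<^esub> word_value G w"
  by (simp add: word_value_def)

lemma word_value_append:
  assumes "group G" "X \<subseteq> carrier G" "u \<in> lists (letters X)" "v \<in> lists (letters X)"
  shows "word_value G (u @ v) = word_value G u \<otimes>\<^bsub>G\<^esub> word_value G v"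
  using assms(3)
proof (induction u)
  case Nil
  then show ?case using word_value_closed[OF assms(1,2,4)] assms(1)
    by (simp add: word_value_def group.is_monoid monoid.l_one)
next
  case (Cons l u)
  then show ?case
    using word_value_closed[OF assms(1,2)] assms letter_value_closed[OF assms(1,2)]
    by (simp add: word_value_Cons group.is_monoid monoid.m_assoc)
qed

text \<open>
  A machine scanning \<open>w = l\<^sub>1 \<dots> l\<^sub>n\<close> from left to right meets \<open>l\<^sub>1\<close> first, although \<open>l\<^sub>n\<close> acts first. Applying
  the inverse letters in reading order evaluates \<open>w\<^sup>-\<^sup>1\<close> instead, and \<open>w = 1\<close> iff \<open>w\<^sup>-\<^sup>1 = 1\<close>.
\<close>

definition inv_letter :: "(real \<Rightarrow> real) letter \<Rightarrow> real \<Rightarrow> real" where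
  "inv_letter l = inv\<^bsub>thompson_F\<^esub> (letter_value thompson_F l)"

lemma inv_letter_closed:
  assumes "X \<subseteq> carrier thompson_F" "l \<in> letters X"
  shows "inv_letter l \<in> thompson_maps"
  using group.inv_closed[OF group_thompson_F letter_value_closed[OF group_thompson_F assms]]
  by (simp add: inv_letter_def carrier_thompson_F)

lemma fold_inv_letter:
  assumes X: "X \<subseteq> carrier thompson_F" and w: "w \<in> lists (letters X)" and x: "x \<in> {0..1}"
  shows "fold inv_letter w x = (inv\<^bsub>thompson_F\<^esub> (word_value thompson_F w)) x"
  using w x
proof (induction w arbitrary: x)
  case Nil
  have "word_value thompson_F [] = \<one>\<^bsub>thompson_F\<^esub>" by (simp add: word_value_def)
  moreover have "inv\<^bsub>thompson_F\<^esub> \<one>\<^bsub>thompson_F\<^esub> = (\<lambda>x\<in>{0..1}. x)"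
    by (rule trans[OF monoid.inv_one[OF group.is_monoid[OF group_thompson_F]] one_thompson_F])
  ultimately show ?case using Nil.prems by simp
next
  case (Cons l w)
  interpret group thompson_F using group_thompson_F .
  have l: "letter_value thompson_F l \<in> carrier thompson_F"
    using letter_value_closed[OF group_thompson_F X] Cons.hyps by blast
  have w: "word_value thompson_F w \<in> carrier thompson_F"
    using word_value_closed[OF group_thompson_F X Cons.hyps(2)] .
  have il: "inv_letter l \<in> thompson_maps" using inv_letter_closed[OF X Cons.hyps(1)] .
  have "inv\<^bsub>thompson_F\<^esub> (word_value thompson_F (l # w)) =
      compose {0..1} (inv\<^bsub>thompson_F\<^esub> (word_value thompson_F w)) (inv_letter l)"
    unfolding word_value_Cons inv_mult_group[OF l w]
    using mult_thompson_F inv_closed[OF w] inv_closed[OF l] by (simp add: inv_letter_def carrier_thompson_F)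
  then have "(inv\<^bsub>thompson_F\<^esub> (word_value thompson_F (l # w))) x =
      (inv\<^bsub>thompson_F\<^esub> (word_value thompson_F w)) (inv_letter l x)"
    using Cons.prems by (simp add: compose_def)
  then show ?case using Cons.IH[OF thompson_maps_range[OF il Cons.prems]] by simp
qed

lemma word_value_one_iff:
  assumes X: "X \<subseteq> carrier thompson_F" and w: "w \<in> lists (letters X)"
  shows "word_value thompson_F w = \<one>\<^bsub>thompson_F\<^esub> \<longleftrightarrow> (\<forall>x\<in>{0..1}. fold inv_letter w x = x)"
proof -
  interpret group thompson_F using group_thompson_F .
  let ?v = "word_value thompson_F w"
  have v: "?v \<in> carrier thompson_F"
    using word_value_closed[OF group_thompson_F X w] .
  have iv: "inv\<^bsub>thompson_F\<^esub> ?v \<in> thompson_maps" using inv_closed[OF v] by (simp add: carrier_thompson_F)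
  have "?v = \<one>\<^bsub>thompson_F\<^esub> \<longleftrightarrow> inv\<^bsub>thompson_F\<^esub> ?v = \<one>\<^bsub>thompson_F\<^esub>"
    using v by (metis inv_inv inv_one)
  also have "\<dots> \<longleftrightarrow> (\<forall>x\<in>{0..1}. (inv\<^bsub>thompson_F\<^esub> ?v) x = x)"
    using thompson_mapsD(1)[OF iv] unfolding one_thompson_F
    by (auto simp: extensional_def fun_eq_iff)
  also have "\<dots> \<longleftrightarrow> (\<forall>x\<in>{0..1}. fold inv_letter w x = x)"
    using fold_inv_letter[OF X w] by simp
  finally show ?thesis .
qed

lemma word_value_rotate:
  assumes "group G" "X \<subseteq> carrier G" "u \<in> lists (letters X)" "v \<in> lists (letters X)"
    and "word_value G (u @ v) = \<one>\<^bsub>G\<^esub>"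
  shows "word_value G (v @ u) = \<one>\<^bsub>G\<^esub>"
proof -
  interpret group G by fact
  have "word_value G u \<otimes>\<^bsub>G\<^esub> word_value G v = \<one>\<^bsub>G\<^esub>"
    using assms(5) word_value_append[OF assms(1-4)] by simp
  then show ?thesis
    using word_value_append[OF assms(1,2,4,3)] inv_comm
      word_value_closed[OF assms(1-3)] word_value_closed[OF assms(1,2,4)] by simp
qed

text \<open>This replaces breakpoints, which depend on the word, by 2^K fixed starting points with K
  digits each. In the forward direction a rotation of a trivial word is trivial, being conjugate to
  it.\<close>

theorem word_value_one_iff_rotations_fix_grid:
  assumes X: "X \<subseteq> carrier thompson_F" and w: "w \<in> lists (letters X)"
    and grid: "\<And>l. l \<in> letters X \<Longrightarrow> grid_affine K (inv_letter l)"
  shows "word_value thompson_F w = \<one>\<^bsub>thompson_F\<^esub> \<longleftrightarrow>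
    (\<forall>j m. j < length w \<and> m < 2 ^ K \<longrightarrow>
       fold inv_letter (drop j w @ take j w) (real m / 2 ^ K) = real m / 2 ^ K)" (is "?L \<longleftrightarrow> ?R")
proof
  assume ?L
  show ?R
  proof (intro allI impI)
    fix j m :: nat assume jm: "j < length w \<and> m < 2 ^ K"
    have lists: "take j w \<in> lists (letters X)" "drop j w \<in> lists (letters X)"
      using w by (auto dest: in_set_takeD in_set_dropD)
    have "word_value thompson_F (drop j w @ take j w) = \<one>\<^bsub>thompson_F\<^esub>"
      using word_value_rotate[OF group_thompson_F X lists] \<open>?L\<close> by simp
    moreover have "real m \<le> real (2 ^ K)" using jm by (simp add: less_imp_le)
    then have "real m / 2 ^ K \<in> {0..1}" by simp
    moreover have "drop j w @ take j w \<in> lists (letters X)" using lists by simp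
    ultimately show "fold inv_letter (drop j w @ take j w) (real m / 2 ^ K) = real m / 2 ^ K"
      using word_value_one_iff[OF X] by blast
  qed
next
  assume ?R
  have "fold inv_letter w x = x" if "x \<in> {0..1}" for x
    by (rule fold_eq_id_if_rotations_fix_grid[where K = K])
      (use that w inv_letter_closed[OF X] grid \<open>?R\<close> in auto)
  then show ?L using word_value_one_iff[OF X w] by blast
qed

section \<open>The abelianization\<close>

definition slope1 :: "(real \<Rightarrow> real) \<Rightarrow> int" where
  "slope1 f = slope0 (flip f)"

lemma slopes_mult:
  assumes "f \<in> thompson_maps" "g \<in> thompson_maps"
  shows "slope0 (f \<otimes>\<^bsub>thompson_F\<^esub> g) = slope0 f + slope0 g"
    and "slope1 (f \<otimes>\<^bsub>thompson_F\<^esub> g) = slope1 f + slope1 g"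
  using assms slope0_compose thompson_flip flip_compose
  by (simp_all add: slope1_def mult_thompson_F)

lemma slopes_one: "slope0 \<one>\<^bsub>thompson_F\<^esub> = 0" "slope1 \<one>\<^bsub>thompson_F\<^esub> = 0"
proof -
  interpret group thompson_F using group_thompson_F .
  have "\<one>\<^bsub>thompson_F\<^esub> \<in> thompson_maps" using one_closed by (simp add: carrier_thompson_F)
  then show "slope0 \<one>\<^bsub>thompson_F\<^esub> = 0" "slope1 \<one>\<^bsub>thompson_F\<^esub> = 0"
    using slopes_mult[of "\<one>\<^bsub>thompson_F\<^esub>" "\<one>\<^bsub>thompson_F\<^esub>"] by simp_all
qed

lemma slopes_inv:
  assumes "f \<in> thompson_maps"
  shows "slope0 (inv\<^bsub>thompson_F\<^esub> f) = - slope0 f" "slope1 (inv\<^bsub>thompson_F\<^esub> f) = - slope1 f"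
proof -
  interpret group thompson_F using group_thompson_F .
  have "inv\<^bsub>thompson_F\<^esub> f \<in> thompson_maps" "f \<otimes>\<^bsub>thompson_F\<^esub> inv\<^bsub>thompson_F\<^esub> f = \<one>\<^bsub>thompson_F\<^esub>"
    using assms inv_closed r_inv by (simp_all add: carrier_thompson_F)
  then show "slope0 (inv\<^bsub>thompson_F\<^esub> f) = - slope0 f" "slope1 (inv\<^bsub>thompson_F\<^esub> f) = - slope1 f"
    using slopes_mult[OF assms, of "inv\<^bsub>thompson_F\<^esub> f"] slopes_one by simp_all
qed

lemma slopes_bump:
  "slope0 bump = 1" "slope1 bump = 0" "slope0 (flip bump) = 0" "slope1 (flip bump) = 1"
  using slope0_bump slope0_flip_bump flip_flip[OF thompson_mapsD(1)[OF bump_thompson]]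
  by (simp_all add: slope1_def)

text \<open>If all generators had proportional slope vectors, so would all elements of the group.\<close>

lemma generators_with_independent_slopes:
  assumes X: "X \<subseteq> carrier thompson_F" and gen: "generate thompson_F X = carrier thompson_F"
  obtains x y where "x \<in> X" "y \<in> X" "slope0 x * slope1 y \<noteq> slope1 x * slope0 y"
proof (rule ccontr)
  assume nothesis: "\<not> thesis"
  note obtained = that
  have par: "slope0 x * slope1 y = slope1 x * slope0 y" if "x \<in> X" "y \<in> X" for x y
    using that obtained nothesis by blast
  \<comment> \<open>Additivity carries a linear relation between the two slopes from the generators
    to the whole group.\<close>
  have proportional: "p * slope1 f = q * slope0 f"
    if pq: "\<And>y. y \<in> X \<Longrightarrow> p * slope1 y = q * slope0 y" and f: "f \<in> thompson_maps" for p q f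
  proof -
    have "f \<in> generate thompson_F X" using gen f by (simp add: carrier_thompson_F)
    then have "f \<in> thompson_maps \<and> p * slope1 f = q * slope0 f"
    proof (induction)
      case one
      show ?case
        using slopes_one group.is_monoid[OF group_thompson_F, THEN monoid.one_closed] by (simp add: carrier_thompson_F)
    next
      case (incl h)
      then show ?case using pq X by (auto simp: carrier_thompson_F)
    next
      case (inv h)
      then have "h \<in> thompson_maps" using X by (auto simp: carrier_thompson_F)
      then show ?case
        using slopes_inv pq[OF inv] group.inv_closed[OF group_thompson_F] by (simp add: carrier_thompson_F)
    next
      case (eng f g)
      then show ?case
        using slopes_mult thompson_compose by (simp add: mult_thompson_F distrib_left)
    qed
    then show ?thesis by simp
  qed
  \<comment> \<open>The vectors (1, 0) and (0, 1) of \<open>bump\<close> and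
    \<open>flip bump\<close> can both be proportional to the vector of \<open>x\<close> only if the
    latter is zero. Then \<open>slope0\<close> vanishes on all generators, hence on
    \<open>bump\<close>, which is absurd.\<close>
  have "slope0 x = 0 \<and> slope1 x = 0" if "x \<in> X" for x
    using proportional[of "slope0 x" "slope1 x" bump] proportional[of "slope0 x" "slope1 x" "flip bump"]
      par[OF that] bump_thompson thompson_flip[OF bump_thompson] slopes_bump by auto
  then show False
    using proportional[of 0 1 bump] bump_thompson slopes_bump by auto
qed

lemma slopes_word_value:
  assumes X: "X \<subseteq> carrier thompson_F" and w: "w \<in> lists (letters X)"
  shows "slope0 (word_value thompson_F w) = (\<Sum>l\<leftarrow>w. slope0 (letter_value thompson_F l))"
    and "slope1 (word_value thompson_F w) = (\<Sum>l\<leftarrow>w. slope1 (letter_value thompson_F l))"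
proof -
  have "slope0 (word_value thompson_F w) = (\<Sum>l\<leftarrow>w. slope0 (letter_value thompson_F l)) \<and>
      slope1 (word_value thompson_F w) = (\<Sum>l\<leftarrow>w. slope1 (letter_value thompson_F l))"
    using w
  proof (induction w)
    case Nil
    then show ?case using slopes_one by (simp add: word_value_def)
  next
    case (Cons l w)
    then show ?case
      using letter_value_closed[OF group_thompson_F X] word_value_closed[OF group_thompson_F X]
      by (simp add: word_value_Cons slopes_mult carrier_thompson_F)
  qed
  then show "slope0 (word_value thompson_F w) = (\<Sum>l\<leftarrow>w. slope0 (letter_value thompson_F l))"
    and "slope1 (word_value thompson_F w) = (\<Sum>l\<leftarrow>w. slope1 (letter_value thompson_F l))" by auto
qed

lemma slopes_letter_value:
  assumes "X \<subseteq> carrier thompson_F" "x \<in> X"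
  shows "slope0 (letter_value thompson_F (x, e)) = (if e then slope0 x else - slope0 x)"
    and "slope1 (letter_value thompson_F (x, e)) = (if e then slope1 x else - slope1 x)"
  using assms slopes_inv by (auto simp: carrier_thompson_F)

section \<open>Words\<close>

lemma finite_letters: "finite X \<Longrightarrow> finite (letters X)"
  by (simp add: letters_def)

lemma card_letters: "card (letters X) = 2 * card X"
  by (simp add: letters_def card_cartesian_product)

lemma words_of_length_0: "words_of_length X 0 = {[]}"
  by (auto simp: words_of_length_def)

lemma words_of_length_Suc:
  "words_of_length X (Suc n) = (\<lambda>(l, w). l # w) ` (letters X \<times> words_of_length X n)"
  by (auto simp: words_of_length_def length_Suc_conv image_iff)

lemma finite_words_of_length: "finite X \<Longrightarrow> finite (words_of_length X n)"
  by (induction n) (simp_all add: words_of_length_0 words_of_length_Suc finite_letters)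

lemma sum_words_Suc:
  "(\<Sum>w\<in>words_of_length X (Suc n). f w) = (\<Sum>l\<in>letters X. \<Sum>w\<in>words_of_length X n. f (l # w))"
proof -
  have "(\<Sum>w\<in>words_of_length X (Suc n). f w) = (\<Sum>(l, w)\<in>letters X \<times> words_of_length X n. f (l # w))"
    unfolding words_of_length_Suc by (subst sum.reindex) (auto simp: inj_on_def case_prod_unfold)
  then show ?thesis by (simp add: sum.cartesian_product)
qed

lemma card_words_of_length:
  assumes "finite X"
  shows "card (words_of_length X n) = (2 * card X) ^ n"
proof (induction n)
  case (Suc n)
  have "card (words_of_length X (Suc n)) = (\<Sum>w\<in>words_of_length X (Suc n). 1)" by simp
  also have "\<dots> = card (letters X) * card (words_of_length X n)"
    unfolding sum_words_Suc by simp
  finally show ?case using Suc card_letters[of X] by simp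
qed (simp add: words_of_length_0)

lemma sum_letters:
  assumes "finite X"
  shows "(\<Sum>l\<in>letters X. f l) = (\<Sum>z\<in>X. f (z, True) + f (z, False))"
proof -
  have "(\<Sum>l\<in>letters X. f l) = (\<Sum>z\<in>X. \<Sum>e\<in>UNIV. f (z, e))"
    unfolding letters_def by (simp add: sum.cartesian_product)
  then show ?thesis by (simp add: UNIV_bool add.commute)
qed

section \<open>Binomial coefficients\<close>

lemma central_binomial_step:
  "Suc m * ((2 * Suc m) choose Suc m) = 2 * (2 * m + 1) * ((2 * m) choose m)"
proof -
  define Y where "Y = (2 * m + 1) choose m"
  define Z where "Z = (2 * m) choose m"
  have a: "Suc m * ((2 * m + 2) choose Suc m) = (2 * m + 2) * Y"
    using Suc_times_binomial_eq[of "2 * m + 1" m] by (simp add: mult.commute Y_def)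
  have "Y = (2 * m + 1) choose Suc m"
    using binomial_symmetric[of m "2 * m + 1"] by (simp add: Y_def)
  then have b: "Suc m * Y = (2 * m + 1) * Z"
    using Suc_times_binomial_eq[of "2 * m" m] by (simp add: mult.commute Z_def)
  have "Suc m * (Suc m * ((2 * m + 2) choose Suc m)) = (2 * m + 2) * (Suc m * Y)"
    unfolding a by (rule mult.left_commute)
  also have "\<dots> = Suc m * (2 * (2 * m + 1) * Z)"
    unfolding b by (simp add: algebra_simps)
  finally have "Suc m * ((2 * m + 2) choose Suc m) = 2 * (2 * m + 1) * Z"
    by (metis mult_cancel1 nat.distinct(1))
  then show ?thesis by (simp add: Z_def)
qed

text \<open>One step multiplies the coefficient by 2(2m+1)/(m+1). Since (2m+1)(2m+3) = (2m+2)^2 - 1,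
  the left side grows by at most the factor 16. The squared form keeps square roots out of the
  induction.\<close>

lemma central_binomial_bound: "real ((2 * m) choose m) ^ 2 * (2 * real m + 1) \<le> 16 ^ m"
proof (induction m)
  case (Suc m)
  define c where "c = real ((2 * m) choose m)"
  define d where "d = real ((2 * Suc m) choose Suc m)"
  have "real (Suc m * ((2 * Suc m) choose Suc m)) = real (2 * (2 * m + 1) * ((2 * m) choose m))"
    using central_binomial_step by presburger
  then have eq: "(real m + 1) * d = 2 * (2 * real m + 1) * c" by (simp add: c_def d_def algebra_simps)
  have "(real m + 1)\<^sup>2 * (d\<^sup>2 * (2 * real m + 3)) = ((real m + 1) * d)\<^sup>2 * (2 * real m + 3)"
    by (simp add: power_mult_distrib)
  also have "\<dots> = (c\<^sup>2 * (2 * real m + 1)) * (4 * ((2 * real m + 1) * (2 * real m + 3)))"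
    unfolding eq by (simp add: power2_eq_square algebra_simps)
  also have "\<dots> \<le> (c\<^sup>2 * (2 * real m + 1)) * (16 * (real m + 1)\<^sup>2)"
  proof (rule mult_left_mono)
    show "4 * ((2 * real m + 1) * (2 * real m + 3)) \<le> 16 * (real m + 1)\<^sup>2"
      by (simp add: power2_eq_square algebra_simps)
    show "0 \<le> c\<^sup>2 * (2 * real m + 1)" by simp
  qed
  also have "\<dots> \<le> 16 ^ m * (16 * (real m + 1)\<^sup>2)"
    using Suc by (intro mult_right_mono) (auto simp: c_def)
  finally have "(real m + 1)\<^sup>2 * (d\<^sup>2 * (2 * real m + 3)) \<le> (real m + 1)\<^sup>2 * 16 ^ Suc m"
    by (simp add: algebra_simps)
  then have "d\<^sup>2 * (2 * real m + 3) \<le> 16 ^ Suc m"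
    by (subst (asm) mult_le_cancel_left_pos) auto
  then show ?case by (simp add: d_def algebra_simps)
qed simp

text \<open>Each row is largest in the middle. For odd k the middle entry is half of the central
  coefficient of row k + 1.\<close>

lemma binomial_sqrt_bound: "real (k choose i) \<le> 2 ^ k / sqrt (real k + 1)"
proof -
  define M where "M = real (k choose (k div 2))"
  have "k choose i \<le> k choose (k div 2)" by (rule binomial_maximum)
  then have iM: "real (k choose i) \<le> M" unfolding M_def by simp
  have "M\<^sup>2 * (real k + 1) \<le> (2 ^ k)\<^sup>2"
  proof (cases "even k")
    case True
    then obtain m where k: "k = 2 * m" by (blast elim: evenE)
    have "(2 :: real) ^ (2 * m) = 4 ^ m" by (simp add: power_mult)
    then have "((2 :: real) ^ k)\<^sup>2 = 16 ^ m" by (simp add: k power2_eq_square flip: power_mult_distrib)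
    then show ?thesis using central_binomial_bound[of m] by (simp add: k M_def)
  next
    case False
    then obtain m where k: "k = 2 * m + 1" by (blast elim: oddE)
    have sym: "(2 * m + 1) choose m = (2 * m + 1) choose Suc m"
      using binomial_symmetric[of m "2 * m + 1"] by simp
    have "(2 * Suc m) choose Suc m = 2 * ((2 * m + 1) choose m)"
      using sym binomial_Suc_Suc[of "2 * m + 1" m] by simp
    then have "real ((2 * Suc m) choose Suc m) = 2 * M"
      unfolding M_def k by simp
    then have "(2 * M)\<^sup>2 * (2 * real (Suc m) + 1) \<le> 16 ^ Suc m" using central_binomial_bound[of "Suc m"] by simp
    moreover have "M\<^sup>2 * (real k + 1) \<le> M\<^sup>2 * (2 * real (Suc m) + 1)"
      by (intro mult_left_mono) (auto simp: k)
    moreover have "((2 :: real) ^ k)\<^sup>2 = 4 * 16 ^ m"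
    proof -
      have "(2 :: real) ^ (2 * m) = 4 ^ m" by (simp add: power_mult)
      then show ?thesis by (simp add: k power2_eq_square flip: power_mult_distrib)
    qed
    ultimately show ?thesis by (simp add: power_mult_distrib)
  qed
  then have "(M * sqrt (real k + 1))\<^sup>2 \<le> (2 ^ k)\<^sup>2" by (simp add: power_mult_distrib)
  then have "M * sqrt (real k + 1) \<le> 2 ^ k" by (rule power2_le_imp_le) simp
  moreover have "real (k choose i) * sqrt (real k + 1) \<le> M * sqrt (real k + 1)"
    using iM by (intro mult_right_mono) auto
  ultimately have "real (k choose i) * sqrt (real k + 1) \<le> 2 ^ k" by linarith
  then show ?thesis by (simp add: pos_le_divide_eq)
qed

text \<open>The extension by 0 to negative lower indices makes Pascal's rule valid for all integers,
  so lattice coordinates need no case distinction.\<close>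

definition binom :: "nat \<Rightarrow> int \<Rightarrow> real" where
  "binom k i = (if i < 0 then 0 else real (k choose nat i))"

lemma binom_0: "binom 0 i = (if i = 0 then 1 else 0)"
  by (auto simp: binom_def binomial_eq_0)

lemma binom_Suc: "binom (Suc k) i = binom k (i - 1) + binom k i"
proof (cases "i \<le> 0")
  case False
  then obtain j where "nat i = Suc j" "nat (i - 1) = j"
    by (metis nat_diff_distrib' not_le int_one_le_iff_zero_less nat_1 diff_Suc_1 gr0_conv_Suc zero_less_nat_eq order_less_imp_le zero_le_one One_nat_def)
  then show ?thesis using False by (simp add: binom_def)
qed (auto simp: binom_def)

lemma binom_nonneg: "0 \<le> binom k i"
  by (simp add: binom_def)

lemma binom_bound: "binom k i \<le> 2 ^ k / sqrt (real k + 1)"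
  using binomial_sqrt_bound by (simp add: binom_def)

section \<open>Counting words with vanishing exponent vector\<close>

definition signed :: "('a \<Rightarrow> int) \<Rightarrow> 'a letter \<Rightarrow> int" where
  "signed \<alpha> l = (if snd l then \<alpha> (fst l) else - \<alpha> (fst l))"

abbreviation weight :: "('a \<Rightarrow> int) \<Rightarrow> 'a letter list \<Rightarrow> int" where
  "weight \<alpha> w \<equiv> (\<Sum>l\<leftarrow>w. signed \<alpha> l)"

abbreviation occurrences :: "'a \<Rightarrow> 'a letter list \<Rightarrow> nat" where
  "occurrences x w \<equiv> count_list (map fst w) x"

text \<open>
  The fraction of the words obtained from \<open>w\<close> by choosing the exponents of the letters over \<open>S\<close> anew
  whose weights are \<open>(u, v)\<close>.
\<close>

fun hit_fraction ::
    "('a \<Rightarrow> int) \<Rightarrow> ('a \<Rightarrow> int) \<Rightarrow> 'a set \<Rightarrow> 'a letter list \<Rightarrow> int \<Rightarrow> int \<Rightarrow> real" where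
  "hit_fraction \<alpha> \<beta> S [] u v = (if u = 0 \<and> v = 0 then 1 else 0)"
| "hit_fraction \<alpha> \<beta> S (l # w) u v =
    (if fst l \<in> S
     then (hit_fraction \<alpha> \<beta> S w (u - \<alpha> (fst l)) (v - \<beta> (fst l)) +
           hit_fraction \<alpha> \<beta> S w (u + \<alpha> (fst l)) (v + \<beta> (fst l))) / 2
     else hit_fraction \<alpha> \<beta> S w (u - signed \<alpha> l) (v - signed \<beta> l))"

text \<open>Redrawing the exponents over \<open>S\<close> preserves the uniform distribution on
  words, so summing the conditional fractions returns the exact count.\<close>

lemma card_hits_eq_sum_hit_fraction:
  assumes "finite X"
  shows "real (card {w \<in> words_of_length X n. weight \<alpha> w = u \<and> weight \<beta> w = v}) =
    (\<Sum>w\<in>words_of_length X n. hit_fraction \<alpha> \<beta> S w u v)"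
proof -
  have "(\<Sum>w\<in>words_of_length X n. if weight \<alpha> w = u \<and> weight \<beta> w = v then 1 else 0 :: real) =
    (\<Sum>w\<in>words_of_length X n. hit_fraction \<alpha> \<beta> S w u v)"
  proof (induction n arbitrary: u v)
    case 0
    then show ?case by (auto simp: words_of_length_0)
  next
    case (Suc n)
    define f where "f u v = (\<Sum>w\<in>words_of_length X n. hit_fraction \<alpha> \<beta> S w u v)" for u v
    have l: "(\<Sum>w\<in>words_of_length X n. if weight \<alpha> (l # w) = u \<and> weight \<beta> (l # w) = v then 1 else 0 :: real)
        = f (u - signed \<alpha> l) (v - signed \<beta> l)" for l
    proof -
      have "weight \<alpha> (l # w) = u \<and> weight \<beta> (l # w) = v \<longleftrightarrow>
          weight \<alpha> w = u - signed \<alpha> l \<and> weight \<beta> w = v - signed \<beta> l" for w by auto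
      then show ?thesis unfolding f_def Suc.IH[symmetric] by simp
    qed
    \<comment> \<open>The two letters of a generator are summed as a pair: over \<open>S\<close>
      each contributes half of both terms, otherwise each contributes one of them. The total is the
      same.\<close>
    have r: "(\<Sum>w\<in>words_of_length X n. hit_fraction \<alpha> \<beta> S ((z, True) # w) u v) +
        (\<Sum>w\<in>words_of_length X n. hit_fraction \<alpha> \<beta> S ((z, False) # w) u v) =
        f (u - \<alpha> z) (v - \<beta> z) + f (u + \<alpha> z) (v + \<beta> z)" for z
      by (cases "z \<in> S") (simp_all add: f_def signed_def sum.distrib flip: sum_divide_distrib)
    show ?case
      unfolding sum_words_Suc l sum_letters[OF assms] r by (simp add: signed_def)
  qed
  then show ?thesis using finite_words_of_length[OF assms, of n] by (simp add: sum.If_cases Int_def)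
qed

text \<open>
  The origin of the lattice of weights reached by varying the exponents over \<open>S\<close> has all of them
  negative; making \<open>i\<close> letters over \<open>x\<close> positive adds \<open>2 * i * \<alpha> x\<close>.
\<close>

fun base_weight :: "('a \<Rightarrow> int) \<Rightarrow> 'a set \<Rightarrow> 'a letter list \<Rightarrow> int" where
  "base_weight \<alpha> S [] = 0"
| "base_weight \<alpha> S (l # w) = base_weight \<alpha> S w + (if fst l \<in> S then - \<alpha> (fst l) else signed \<alpha> l)"

text \<open>By independence the weights determine the numbers \<open>i\<close> and \<open>j\<close>
  of positive letters over \<open>x\<close> and over \<open>y\<close>, so the favourable choices of
  exponents are counted by a product of two binomial coefficients. The induction step is Pascal's
  rule.\<close>

lemma hit_fraction_on_lattice:
  assumes indep: "\<alpha> x * \<beta> y \<noteq> \<beta> x * \<alpha> y"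
  shows "hit_fraction \<alpha> \<beta> {x, y} w
      (base_weight \<alpha> {x, y} w + 2 * i * \<alpha> x + 2 * j * \<alpha> y)
      (base_weight \<beta> {x, y} w + 2 * i * \<beta> x + 2 * j * \<beta> y) =
    binom (occurrences x w) i * binom (occurrences y w) j / 2 ^ (occurrences x w + occurrences y w)"
proof (induction w arbitrary: i j)
  case Nil
  have "i = 0 \<and> j = 0" if "2 * i * \<alpha> x + 2 * j * \<alpha> y = 0" "2 * i * \<beta> x + 2 * j * \<beta> y = 0"
  proof -
    have a: "i * \<alpha> x = - j * \<alpha> y" and b: "i * \<beta> x = - j * \<beta> y" using that by auto
    have "i * (\<alpha> x * \<beta> y - \<beta> x * \<alpha> y) = (i * \<alpha> x) * \<beta> y - (i * \<beta> x) * \<alpha> y" by (simp add: algebra_simps)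
    also have "\<dots> = 0" unfolding a b by simp
    finally have "i = 0" using indep by simp
    moreover have "j * (\<alpha> x * \<beta> y - \<beta> x * \<alpha> y) = \<alpha> x * (j * \<beta> y) - \<beta> x * (j * \<alpha> y)" by (simp add: algebra_simps)
    moreover have "j * \<beta> y = 0" "j * \<alpha> y = 0" using a b \<open>i = 0\<close> by auto
    ultimately show ?thesis using indep by simp
  qed
  then have "hit_fraction \<alpha> \<beta> {x, y} [] (2 * i * \<alpha> x + 2 * j * \<alpha> y) (2 * i * \<beta> x + 2 * j * \<beta> y) =
      (if i = 0 \<and> j = 0 then 1 else 0)"
    unfolding hit_fraction.simps by (intro if_cong) auto
  then show ?case by (auto simp: binom_0)
next
  case (Cons l w)
  define A where "A = base_weight \<alpha> {x, y} w + 2 * i * \<alpha> x + 2 * j * \<alpha> y"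
  define B where "B = base_weight \<beta> {x, y} w + 2 * i * \<beta> x + 2 * j * \<beta> y"
  have xy: "x \<noteq> y" using indep by auto
  have IH: "hit_fraction \<alpha> \<beta> {x, y} w A B =
      binom (occurrences x w) i * binom (occurrences y w) j / 2 ^ (occurrences x w + occurrences y w)"
    using Cons.IH unfolding A_def B_def .
  consider "fst l = x" | "fst l = y" | "fst l \<notin> {x, y}" by blast
  then show ?case
  proof cases
    case 1
    have "hit_fraction \<alpha> \<beta> {x, y} w (A - 2 * \<alpha> x) (B - 2 * \<beta> x) =
        binom (occurrences x w) (i - 1) * binom (occurrences y w) j / 2 ^ (occurrences x w + occurrences y w)"
      using Cons.IH[of "i - 1" j] by (simp add: A_def B_def algebra_simps)
    moreover have "base_weight \<alpha> {x, y} (l # w) + 2 * i * \<alpha> x + 2 * j * \<alpha> y = A - \<alpha> x"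
      "base_weight \<beta> {x, y} (l # w) + 2 * i * \<beta> x + 2 * j * \<beta> y = B - \<beta> x"
      using 1 by (simp_all add: A_def B_def)
    ultimately show ?thesis using 1 xy IH by (simp add: binom_Suc field_simps)
  next
    case 2
    have "hit_fraction \<alpha> \<beta> {x, y} w (A - 2 * \<alpha> y) (B - 2 * \<beta> y) =
        binom (occurrences x w) i * binom (occurrences y w) (j - 1) / 2 ^ (occurrences x w + occurrences y w)"
      using Cons.IH[of i "j - 1"] by (simp add: A_def B_def algebra_simps)
    moreover have "base_weight \<alpha> {x, y} (l # w) + 2 * i * \<alpha> x + 2 * j * \<alpha> y = A - \<alpha> y"
      "base_weight \<beta> {x, y} (l # w) + 2 * i * \<beta> x + 2 * j * \<beta> y = B - \<beta> y"
      using 2 by (simp_all add: A_def B_def)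
    ultimately show ?thesis using 2 xy IH by (simp add: binom_Suc field_simps)
  next
    case 3
    have "base_weight \<alpha> {x, y} (l # w) + 2 * i * \<alpha> x + 2 * j * \<alpha> y = A + signed \<alpha> l"
      "base_weight \<beta> {x, y} (l # w) + 2 * i * \<beta> x + 2 * j * \<beta> y = B + signed \<beta> l"
      using 3 by (simp_all add: A_def B_def)
    then show ?thesis using 3 IH by simp
  qed
qed

text \<open>Every choice of exponents leads to a point of the lattice, so no choice hits any other
  pair.\<close>

lemma hit_fraction_off_lattice:
  assumes "\<And>i j. u \<noteq> base_weight \<alpha> {x, y} w + 2 * i * \<alpha> x + 2 * j * \<alpha> y \<or>
      v \<noteq> base_weight \<beta> {x, y} w + 2 * i * \<beta> x + 2 * j * \<beta> y"
  shows "hit_fraction \<alpha> \<beta> {x, y} w u v = 0"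
  using assms
proof (induction w arbitrary: u v)
  case Nil
  then show ?case using Nil[of 0 0] by auto
next
  case (Cons l w)
  show ?case
  proof (cases "fst l \<in> {x, y}")
    case True
    have "hit_fraction \<alpha> \<beta> {x, y} w (u - \<alpha> (fst l)) (v - \<beta> (fst l)) = 0"
    proof (rule Cons.IH)
      fix i j
      show "u - \<alpha> (fst l) \<noteq> base_weight \<alpha> {x, y} w + 2 * i * \<alpha> x + 2 * j * \<alpha> y \<or>
          v - \<beta> (fst l) \<noteq> base_weight \<beta> {x, y} w + 2 * i * \<beta> x + 2 * j * \<beta> y"
        using True Cons.prems[of "i + 1" j] Cons.prems[of i "j + 1"] by (auto simp: algebra_simps)
    qed
    moreover have "hit_fraction \<alpha> \<beta> {x, y} w (u + \<alpha> (fst l)) (v + \<beta> (fst l)) = 0"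
    proof (rule Cons.IH)
      fix i j
      show "u + \<alpha> (fst l) \<noteq> base_weight \<alpha> {x, y} w + 2 * i * \<alpha> x + 2 * j * \<alpha> y \<or>
          v + \<beta> (fst l) \<noteq> base_weight \<beta> {x, y} w + 2 * i * \<beta> x + 2 * j * \<beta> y"
        using True Cons.prems[of i j] by (auto simp: algebra_simps)
    qed
    ultimately show ?thesis using True by auto
  next
    case False
    have "hit_fraction \<alpha> \<beta> {x, y} w (u - signed \<alpha> l) (v - signed \<beta> l) = 0"
    proof (rule Cons.IH)
      fix i j
      show "u - signed \<alpha> l \<noteq> base_weight \<alpha> {x, y} w + 2 * i * \<alpha> x + 2 * j * \<alpha> y \<or>
          v - signed \<beta> l \<noteq> base_weight \<beta> {x, y} w + 2 * i * \<beta> x + 2 * j * \<beta> y"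
        using False Cons.prems[of i j] by (auto simp: algebra_simps)
    qed
    then show ?thesis using False by simp
  qed
qed

text \<open>The two binomial estimates give 1/sqrt(p q). AM-GM then separates \<open>x\<close> from
  \<open>y\<close>, so that afterwards only one occurrence count has to be averaged at a
  time.\<close>

lemma hit_fraction_bound:
  assumes indep: "\<alpha> x * \<beta> y \<noteq> \<beta> x * \<alpha> y"
  shows "hit_fraction \<alpha> \<beta> {x, y} w u v \<le>
    (1 / (real (occurrences x w) + 1) + 1 / (real (occurrences y w) + 1)) / 2"
proof (cases "\<exists>i j. u = base_weight \<alpha> {x, y} w + 2 * i * \<alpha> x + 2 * j * \<alpha> y \<and>
      v = base_weight \<beta> {x, y} w + 2 * i * \<beta> x + 2 * j * \<beta> y")
  case True
  then obtain i j where ij: "u = base_weight \<alpha> {x, y} w + 2 * i * \<alpha> x + 2 * j * \<alpha> y"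
      "v = base_weight \<beta> {x, y} w + 2 * i * \<beta> x + 2 * j * \<beta> y" by blast
  define p where "p = real (occurrences x w) + 1"
  define q where "q = real (occurrences y w) + 1"
  have pq: "p > 0" "q > 0" by (simp_all add: p_def q_def)
  have "hit_fraction \<alpha> \<beta> {x, y} w u v =
      binom (occurrences x w) i * binom (occurrences y w) j / 2 ^ (occurrences x w + occurrences y w)"
    unfolding ij by (rule hit_fraction_on_lattice[OF indep])
  also have "\<dots> \<le> (2 ^ occurrences x w / sqrt p) * (2 ^ occurrences y w / sqrt q) / 2 ^ (occurrences x w + occurrences y w)"
    using pq unfolding p_def q_def by (intro divide_right_mono mult_mono binom_bound binom_nonneg) auto
  also have "\<dots> = (1 / sqrt p) * (1 / sqrt q)" by (simp add: power_add)
  also have "\<dots> \<le> ((1 / sqrt p)\<^sup>2 + (1 / sqrt q)\<^sup>2) / 2"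
    using sum_squares_bound[of "1 / sqrt p" "1 / sqrt q"] by simp
  also have "\<dots> = (1 / p + 1 / q) / 2" using pq by (simp add: power_divide)
  finally show ?thesis unfolding p_def q_def .
next
  case False
  then have "hit_fraction \<alpha> \<beta> {x, y} w u v = 0" by (intro hit_fraction_off_lattice) blast
  then show ?thesis by simp
qed

text \<open>The summand is multiplicative over positions, and each position contributes t for the
  two letters over \<open>x\<close> and 1 for each of the other letters.\<close>

lemma sum_power_occurrences:
  assumes "finite X" "x \<in> X"
  shows "(\<Sum>w\<in>words_of_length X n. t ^ occurrences x w) = (2 * (real (card X) - 1) + 2 * t) ^ n"
proof (induction n)
  case (Suc n)
  define s where "s = (\<Sum>w\<in>words_of_length X n. t ^ occurrences x w)"
  have "(\<Sum>w\<in>words_of_length X (Suc n). t ^ occurrences x w) = (\<Sum>z\<in>X. 2 * (if z = x then t else 1) * s)"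
    unfolding sum_words_Suc sum_letters[OF assms(1)]
    by (intro sum.cong) (auto simp: s_def sum_distrib_left mult_ac)
  also have "\<dots> = 2 * s * (\<Sum>z\<in>X. if z = x then t else 1)" by (simp add: sum_distrib_left mult_ac)
  also have "(\<Sum>z\<in>X. if z = x then t else 1) = t + (real (card X) - 1)"
  proof -
    have "(\<Sum>z\<in>X. if z = x then t else 1) = t + (\<Sum>z\<in>X - {x}. if z = x then t else 1)"
      using assms by (subst sum.remove[of _ x]) auto
    also have "(\<Sum>z\<in>X - {x}. if z = x then t else 1) = (\<Sum>z\<in>X - {x}. 1)" by (intro sum.cong) auto
    also have "\<dots> = real (card X) - 1"
    proof -
      have "card X \<ge> 1" using assms by (metis One_nat_def Suc_leI card_gt_0_iff empty_iff)
      then show ?thesis using assms by (simp add: card_Diff_singleton of_nat_diff)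
    qed
    finally show ?thesis .
  qed
  finally show ?case using Suc unfolding s_def by (simp add: algebra_simps)
qed (simp add: words_of_length_0)

text \<open>Both sides are integrals over \<open>[0, 1]\<close> of the generating function \<open>sum_power_occurrences\<close>.\<close>

lemma sum_inverse_occurrences:
  assumes "finite X" "x \<in> X"
  shows "(\<Sum>w\<in>words_of_length X n. 1 / (real (occurrences x w) + 1)) \<le>
    (2 * real (card X)) ^ Suc n / (2 * (real n + 1))"
proof -
  define q where "q = 2 * (real (card X) - 1)"
  have "card X \<ge> 1" using assms by (metis One_nat_def Suc_leI card_gt_0_iff empty_iff)
  then have q: "q \<ge> 0" by (simp add: q_def)
  define F where "F t = (\<Sum>w\<in>words_of_length X n. t ^ Suc (occurrences x w) / (real (occurrences x w) + 1)) -
      (q + 2 * t) ^ Suc n / (2 * (real n + 1))" for t :: real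
  have "(F has_real_derivative 0) (at t)" for t
  proof -
    have pow: "((\<lambda>t. t ^ Suc k / (real k + 1)) has_real_derivative t ^ k) (at t)" for k
    proof -
      have "((\<lambda>t. t ^ Suc k / (real k + 1)) has_real_derivative (real k + 1) * t ^ k / (real k + 1)) (at t)"
        by (rule DERIV_cdivide) (use DERIV_pow[of "Suc k" t] in \<open>simp add: add.commute\<close>)
      moreover have "real k + 1 \<noteq> 0" by linarith
      ultimately show ?thesis by simp
    qed
    have lin: "((\<lambda>t. (q + 2 * t) ^ Suc n / (2 * (real n + 1))) has_real_derivative (q + 2 * t) ^ n) (at t)"
    proof -
      have "((\<lambda>t. (q + 2 * t) ^ Suc n) has_real_derivative (2 * (real n + 1)) * (q + 2 * t) ^ n) (at t)"
        by (rule derivative_eq_intros refl | simp)+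
      then have "((\<lambda>t. (q + 2 * t) ^ Suc n / (2 * (real n + 1))) has_real_derivative
          (2 * (real n + 1)) * (q + 2 * t) ^ n / (2 * (real n + 1))) (at t)"
        by (rule DERIV_cdivide)
      moreover have "2 * (real n + 1) > 0" by simp
      ultimately show ?thesis by simp
    qed
    have "(F has_real_derivative (\<Sum>w\<in>words_of_length X n. t ^ occurrences x w) - (q + 2 * t) ^ n) (at t)"
      unfolding F_def by (intro DERIV_diff DERIV_sum pow lin)
    then show ?thesis using sum_power_occurrences[OF assms, of t n] by (simp add: q_def)
  qed
  \<comment> \<open>At 1 the sum in \<open>F\<close> is the one to be bounded, at 0 it vanishes
    because its exponents are positive. What remains is subtracted and nonnegative, so it is dropped
    below.\<close>
  then have "F 1 = F 0" using DERIV_isconst_all[of F 1 0] by blast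
  then have "(\<Sum>w\<in>words_of_length X n. 1 / (real (occurrences x w) + 1)) =
      (q + 2) ^ Suc n / (2 * (real n + 1)) - q ^ Suc n / (2 * (real n + 1))"
    by (simp add: F_def)
  also have "\<dots> \<le> (q + 2) ^ Suc n / (2 * (real n + 1))" using q by simp
  finally show ?thesis by (simp add: q_def)
qed

theorem card_zero_weight_words:
  assumes X: "finite X" "x \<in> X" "y \<in> X" and indep: "\<alpha> x * \<beta> y \<noteq> \<beta> x * \<alpha> y"
  shows "real (card {w \<in> words_of_length X n. weight \<alpha> w = 0 \<and> weight \<beta> w = 0}) \<le>
    real (card X) / (real n + 1) * real (card (words_of_length X n))"
proof -
  have "real (card {w \<in> words_of_length X n. weight \<alpha> w = 0 \<and> weight \<beta> w = 0}) =
      (\<Sum>w\<in>words_of_length X n. hit_fraction \<alpha> \<beta> {x, y} w 0 0)"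
    by (rule card_hits_eq_sum_hit_fraction[OF X(1)])
  also have "\<dots> \<le> (\<Sum>w\<in>words_of_length X n. (1 / (real (occurrences x w) + 1) + 1 / (real (occurrences y w) + 1)) / 2)"
    by (intro sum_mono hit_fraction_bound[where x = x and y = y and \<alpha> = \<alpha> and \<beta> = \<beta>, OF indep])
  also have "\<dots> = ((\<Sum>w\<in>words_of_length X n. 1 / (real (occurrences x w) + 1)) +
      (\<Sum>w\<in>words_of_length X n. 1 / (real (occurrences y w) + 1))) / 2"
    by (simp add: sum.distrib flip: sum_divide_distrib)
  also have "\<dots> \<le> ((2 * real (card X)) ^ Suc n / (2 * (real n + 1)) + (2 * real (card X)) ^ Suc n / (2 * (real n + 1))) / 2"
    by (intro divide_right_mono add_mono sum_inverse_occurrences X) simp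
  also have "\<dots> = real (card X) / (real n + 1) * real (card (words_of_length X n))"
  proof -
    have half: "(2 * c * p / (2 * m) + 2 * c * p / (2 * m)) / 2 = c / m * p" for c p m :: real
      by (cases "m = 0") (simp_all add: field_simps)
    show ?thesis
      unfolding card_words_of_length[OF X(1)] power_Suc of_nat_power of_nat_mult of_nat_numeral by (rule half)
  qed
  finally show ?thesis .
qed

section \<open>Runs of Turing machines\<close>

lemma halted_step: "halted M c \<Longrightarrow> step M c = c"
  by (simp add: step_def)

lemma halted_steps: "halted M c \<Longrightarrow> (step M ^^ t) c = c"
  by (induction t) (simp_all add: halted_step)

lemma run_after_halt:
  assumes "halted M (run M w s)" "halted M (run M w t)"
  shows "run M w s = run M w t"
proof -
  have "run M w (s + k) = run M w s" if "halted M (run M w s)" for s k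
    using halted_steps[OF that, of k] unfolding run_def by (simp add: add.commute[of s k] funpow_add)
  then show ?thesis using assms by (metis le_add_diff_inverse nat_le_linear)
qed

text \<open>An upper bound on the number of steps lets time bounds add and be relaxed; a predicate
  as target lets head positions that need no tracking stay existential.\<close>

definition reaches :: "'s machine \<Rightarrow> nat \<Rightarrow> 's config \<Rightarrow> ('s config \<Rightarrow> bool) \<Rightarrow> bool" where
  "reaches M t c P \<longleftrightarrow> (\<exists>s\<le>t. P ((step M ^^ s) c))"

lemma reaches_here: "P c \<Longrightarrow> reaches M t c P"
  unfolding reaches_def by (intro exI[of _ 0]) simp

lemma reaches_step:
  assumes "reaches M t (step M c) P"
  shows "reaches M (Suc t) c P"
proof -
  obtain s where "s \<le> t" "P ((step M ^^ s) (step M c))" using assms unfolding reaches_def by blast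
  then have "Suc s \<le> Suc t" "P ((step M ^^ Suc s) c)" by (simp_all only: funpow_Suc_right comp_apply Suc_le_mono)
  then show ?thesis unfolding reaches_def by blast
qed

lemma reaches_trans:
  assumes "reaches M s c P" "\<And>c'. P c' \<Longrightarrow> reaches M t c' Q"
  shows "reaches M (s + t) c Q"
proof -
  obtain a where a: "a \<le> s" "P ((step M ^^ a) c)" using assms(1) unfolding reaches_def by blast
  obtain b where b: "b \<le> t" "Q ((step M ^^ b) ((step M ^^ a) c))"
    using assms(2)[OF a(2)] unfolding reaches_def by blast
  have "Q ((step M ^^ (b + a)) c)" using b(2) by (simp add: funpow_add)
  moreover have "b + a \<le> s + t" using a b by simp
  ultimately show ?thesis unfolding reaches_def by blast
qed

lemma reaches_mono:
  assumes "reaches M s c P" "s \<le> t" "\<And>c'. P c' \<Longrightarrow> Q c'"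
  shows "reaches M t c Q"
  using assms unfolding reaches_def by (meson order_trans)

lemma reaches_halted:
  assumes "reaches M t (initial_config M w) (halted M)"
  shows "halts_on M w" "running_time M w \<le> t"
proof -
  obtain s where s: "s \<le> t" "halted M (run M w s)" using assms unfolding reaches_def run_def by blast
  then show "halts_on M w" unfolding halts_on_def by blast
  have "running_time M w \<le> s" unfolding running_time_def using s(2) by (rule Least_le)
  then show "running_time M w \<le> t" using s(1) by simp
qed

lemma reaches_accept:
  assumes "reaches M t (initial_config M w) (\<lambda>c. fst c = accept M)"
  shows "accepts M w"
  using assms unfolding reaches_def accepts_def run_def by blast

lemma reaches_reject:
  assumes "reaches M t (initial_config M w) (\<lambda>c. fst c = reject M)" "accept M \<noteq> reject M"
  shows "\<not> accepts M w"
proof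
  assume "accepts M w"
  then obtain a where a: "fst (run M w a) = accept M" unfolding accepts_def by blast
  obtain b where b: "fst (run M w b) = reject M" using assms(1) unfolding reaches_def run_def by blast
  have "run M w a = run M w b" using a b by (intro run_after_halt) (simp_all add: halted_def)
  then show False using a b assms(2) by simp
qed

text \<open>
  Invalid transitions are redirected to the rejecting state, so that the result is a Turing machine
  for every \<open>d\<close>, whatever \<open>d\<close> does on meaningless tape contents.
\<close>

definition encoded_machine ::
    "nat \<Rightarrow> 'q set \<Rightarrow> 's symbol set \<Rightarrow> 'q \<Rightarrow> 'q \<Rightarrow> 'q \<Rightarrow> ('q \<Rightarrow> nat) \<Rightarrow>
     ('q \<Rightarrow> 's symbol list \<Rightarrow> 'q \<times> ('s symbol \<times> move) list) \<Rightarrow> 's machine" where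
  "encoded_machine k Q S q0 qa qr e d =
     \<lparr>num_tapes = k, states = e ` Q, symbols = S, start = e q0, accept = e qa, reject = e qr,
      delta = (\<lambda>n xs. let (q, as) = d (inv_into Q e n) xs in
        if q \<in> Q \<and> length as = k \<and> fst ` set as \<subseteq> S \<union> set xs then (e q, as)
        else (e qr, replicate k (Blank, Stay)))\<rparr>"

lemma multitape_TM_encoded_machine:
  assumes "k \<ge> 1" "finite Q" "finite S" "Blank \<in> S" "Input ` \<Sigma> \<subseteq> S"
    and "q0 \<in> Q" "qa \<in> Q" "qr \<in> Q" "qa \<noteq> qr" "inj_on e Q"
  shows "multitape_TM \<Sigma> (encoded_machine k Q S q0 qa qr e d)"
proof -
  have "e qa \<noteq> e qr" using assms(7-10) by (simp add: inj_on_eq_iff)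
  moreover have "fst (delta (encoded_machine k Q S q0 qa qr e d) n xs) \<in> e ` Q \<and>
      length (snd (delta (encoded_machine k Q S q0 qa qr e d) n xs)) = k \<and>
      fst ` set (snd (delta (encoded_machine k Q S q0 qa qr e d) n xs)) \<subseteq> S"
    if "xs \<in> lists S" for n xs
  proof -
    have "S \<union> set xs = S" using that by auto
    then show ?thesis using assms(4,8)
      by (auto simp: encoded_machine_def Let_def split: prod.splits)
  qed
  ultimately show ?thesis using assms unfolding multitape_TM_def
    by (simp add: encoded_machine_def)
qed

text \<open>Writing back a scanned symbol always passes the validity test, so no invariant has to
  say that the tapes contain only symbols from \<open>S\<close>.\<close>

lemma step_encoded_machine:
  assumes "inj_on e Q" "q \<in> Q" "qa \<in> Q" "qr \<in> Q" "q \<noteq> qa" "q \<noteq> qr"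
    and "d q (map scan ts) = (q', as)" "q' \<in> Q" "length as = k"
    and "fst ` set as \<subseteq> S \<union> set (map scan ts)"
  shows "step (encoded_machine k Q S q0 qa qr e d) (e q, ts) = (e q', map2 act as ts)"
proof -
  have "e q \<noteq> e qa" "e q \<noteq> e qr" using assms(1-6) by (simp_all add: inj_on_eq_iff)
  then show ?thesis using assms by (simp add: step_def halted_def encoded_machine_def)
qed

section \<open>The machine\<close>

text \<open>
  The input tape is a queue of pairs \<open>(a, i)\<close>: the letter \<open>a\<close> has been moved to the end \<open>i\<close> times, and
  the pair at the front selects the grid point \<open>i / 2^K\<close> to be tested next. \<open>Count r s\<close> accumulates two
  integer weights of the input: each is \<open>D\<close> times the head position of a counter tape plus the
  remainder \<open>r\<close> (resp. \<open>s\<close>) in the control. \<open>Pass a i m l\<close> moves the dyadic point \<open>(m + y) / 2^l\<close>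
  along the word; the binary digits of \<open>y\<close> are on the stack tape, with the leading digit under the
  head, and \<open>(a, i)\<close> is the pair taken from the front of the queue.
\<close>

datatype 'l control =
    Start | Count int int | Rewind | Begin | Pass 'l nat nat nat | Push 'l nat nat nat bool | Acc | Rej

definition direction :: "int \<Rightarrow> move" where
  "direction z = (if z < 0 then MoveL else if z = 0 then Stay else MoveR)"

lemma move_head_direction: "z \<in> {-1, 0, 1} \<Longrightarrow> move_head (direction z) p = p + z"
  by (auto simp: direction_def)

section \<open>Binary digits on a stack tape\<close>

definition bit_symbol :: "bool \<Rightarrow> 's symbol" where
  "bit_symbol b = Work (if b then 1 else 0)"

text \<open>The stack grows to the right with its top at position \<open>p\<close>. All other cells
  are blank, so an exhausted stack can be recognized and supplies zeros when popped.\<close>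

definition stack_tape :: "int \<Rightarrow> bool list \<Rightarrow> int \<Rightarrow> 's symbol" where
  "stack_tape p st = (\<lambda>i. if i \<le> p \<and> p - i < int (length st) then bit_symbol (st ! nat (p - i)) else Blank)"

lemma stack_tape_Nil: "stack_tape p [] = (\<lambda>_. Blank)"
  by (auto simp: stack_tape_def fun_eq_iff)

lemma stack_tape_top: "stack_tape p st p = (case st of [] \<Rightarrow> Blank | b # _ \<Rightarrow> bit_symbol b)"
  by (auto simp: stack_tape_def split: list.splits)

lemma stack_tape_pop: "(stack_tape p st)(p := Blank) = stack_tape (p - 1) (tl st)"
proof
  fix i
  show "((stack_tape p st)(p := Blank)) i = stack_tape (p - 1) (tl st) i"
  proof (cases "i < p")
    case True
    then have "nat (p - i) = Suc (nat (p - 1 - i))" by simp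
    then show ?thesis using True by (cases st) (auto simp: stack_tape_def)
  qed (auto simp: stack_tape_def)
qed

lemma stack_tape_push: "(stack_tape p st)(p + 1 := bit_symbol b) = stack_tape (p + 1) (b # st)"
proof
  fix i
  show "((stack_tape p st)(p + 1 := bit_symbol b)) i = stack_tape (p + 1) (b # st) i"
  proof (cases "i \<le> p")
    case True
    then have "nat (p + 1 - i) = Suc (nat (p - i))" by simp
    then show ?thesis using True by (auto simp: stack_tape_def)
  qed (auto simp: stack_tape_def)
qed

fun digits_value :: "bool list \<Rightarrow> real" where
  "digits_value [] = 0"
| "digits_value (b # st) = ((if b then 1 else 0) + digits_value st) / 2"

lemma digits_value_range: "0 \<le> digits_value st \<and> digits_value st < 1"
  by (induction st) auto

text \<open>
  Without trailing zeros the stack is determined by its value; in particular it is empty iff the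
  value is zero.
\<close>

definition canonical :: "bool list \<Rightarrow> bool" where
  "canonical st \<longleftrightarrow> (st \<noteq> [] \<longrightarrow> last st)"

lemma digits_value_eq_0_iff: "canonical st \<Longrightarrow> digits_value st = 0 \<longleftrightarrow> st = []"
proof (induction st)
  case (Cons b st)
  have nonneg: "digits_value st \<ge> 0" using digits_value_range by blast
  have "digits_value (b # st) > 0"
  proof (cases "st = []")
    case True
    then show ?thesis using Cons.prems by (simp add: canonical_def)
  next
    case False
    then have "canonical st" using Cons.prems by (simp add: canonical_def)
    then have "digits_value st > 0" using Cons.IH False nonneg by simp
    then show ?thesis by simp
  qed
  then show ?case by simp
qed simp

definition point :: "nat \<Rightarrow> nat \<Rightarrow> bool list \<Rightarrow> real" where
  "point m l st = (real m + digits_value st) / 2 ^ l"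

lemma point_eq_grid_point_iff:
  assumes "canonical st"
  shows "point m l st = real i / 2 ^ l \<longleftrightarrow> m = i \<and> st = []"
proof -
  have "point m l st = real i / 2 ^ l \<longleftrightarrow> real m + digits_value st = real i"
    by (simp add: point_def)
  also have "\<dots> \<longleftrightarrow> m = i \<and> digits_value st = 0"
  proof
    assume eq: "real m + digits_value st = real i"
    then have "real m \<le> real i" "real i < real (Suc m)" using digits_value_range[of st] by auto
    then have "m = i" unfolding of_nat_le_iff of_nat_less_iff by simp
    then show "m = i \<and> digits_value st = 0" using eq by simp
  qed simp
  finally show ?thesis using digits_value_eq_0_iff[OF assms] by simp
qed

definition marked_tape :: "int \<Rightarrow> 's symbol" where
  "marked_tape = (\<lambda>_. Blank)(0 := Work 0)"

text \<open>The machine sees only finite data: \<open>table\<close> performs the prefix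
  replacements, \<open>B\<close> bounds the prefix lengths and \<open>D\<close> the weights of
  letters. The maps \<open>f\<close> are the specification of \<open>table\<close>.\<close>

locale rotation_machine =
  fixes L :: "'l set" and K B :: nat and D :: int and d1 d2 :: "'l \<Rightarrow> int"
    and table :: "'l \<Rightarrow> nat \<Rightarrow> nat \<times> nat" and f :: "'l \<Rightarrow> real \<Rightarrow> real"
  assumes finite_L: "finite L"
    and D_pos: "D > 0"
    and weights_le_D: "\<And>l. l \<in> L \<Longrightarrow> \<bar>d1 l\<bar> \<le> D \<and> \<bar>d2 l\<bar> \<le> D"
    and K_le_B: "K \<le> B"
    and table_bounds: "\<And>l m. l \<in> L \<Longrightarrow> m < 2 ^ K \<Longrightarrow> fst (table l m) < 2 ^ snd (table l m) \<and> snd (table l m) \<le> B"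
    and table_action: "\<And>l m y. l \<in> L \<Longrightarrow> m < 2 ^ K \<Longrightarrow> 0 \<le> y \<Longrightarrow> y \<le> 1 \<Longrightarrow>
      f l ((real m + y) / 2 ^ K) = (real (fst (table l m)) + y) / 2 ^ snd (table l m)"
begin

definition control_states :: "'l control set" where
  "control_states = {Start, Rewind, Begin, Acc, Rej} \<union>
     {Count r s | r s. 0 \<le> r \<and> r < D \<and> 0 \<le> s \<and> s < D} \<union>
     {Pass a i m l | a i m l. a \<in> L \<and> i < 2 ^ K \<and> m < 2 ^ l \<and> l \<le> B} \<union>
     {Push a i m l b | a i m l b. a \<in> L \<and> i < 2 ^ K \<and> m < 2 ^ l \<and> l \<le> B}"

text \<open>The index 2^K is included because an entry carrying it at the front signals that all
  tests have succeeded.\<close>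

definition entries :: "('l \<times> nat) set" where
  "entries = L \<times> {..2 ^ K}"

definition entry_code :: "'l \<times> nat \<Rightarrow> nat" where
  "entry_code = (SOME c. inj_on c entries)"

text \<open>Index 0 is encoded by the input letter itself, so the input tape already is the initial
  queue. Other codes may coincide with \<open>Work 0\<close> or \<open>Work 1\<close>; this is
  harmless, as digits and counter marks live on other tapes.\<close>

definition entry_symbol :: "'l \<times> nat \<Rightarrow> 'l symbol" where
  "entry_symbol x = (if snd x = 0 then Input (fst x) else Work (entry_code x))"

definition entry :: "'l symbol \<Rightarrow> 'l \<times> nat" where
  "entry = inv_into entries entry_symbol"

definition alphabet :: "'l symbol set" where
  "alphabet = {Blank, Work 0, Work 1} \<union> entry_symbol ` entries"

definition state_code :: "'l control \<Rightarrow> nat" where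
  "state_code = (SOME e. inj_on e control_states)"

text \<open>The tapes are the queue, the stack and two counters. \<open>Begin\<close> already
  applies the letter that it erases, and \<open>Pass\<close> remembers that letter and its index
  until they are appended again. For l < K a digit is popped, a blank counting as 0. For l > K the
  last digit of \<open>m\<close> is pushed, except for a zero on an empty stack, so no trailing
  zeros arise. A push takes two steps because the head must first move to the free cell.\<close>

fun transition :: "'l control \<Rightarrow> 'l symbol \<Rightarrow> 'l symbol \<Rightarrow> 'l symbol \<Rightarrow> 'l symbol \<Rightarrow>
    'l control \<times> ('l symbol \<times> move) list" where
  "transition Start s t u v = (Count 0 0, [(s, Stay), (t, Stay), (Work 0, Stay), (Work 0, Stay)])"
| "transition (Count r1 r2) s t u v =
    (if s = Blank then
       if r1 = 0 \<and> r2 = 0 \<and> u \<noteq> Blank \<and> v \<noteq> Blank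
       then (Rewind, [(s, MoveL), (t, Stay), (u, Stay), (v, Stay)])
       else (Rej, [(s, Stay), (t, Stay), (u, Stay), (v, Stay)])
     else let l = fst (entry s); z1 = r1 + d1 l; z2 = r2 + d2 l in
       (Count (z1 mod D) (z2 mod D),
        [(s, MoveR), (t, Stay), (u, direction (z1 div D)), (v, direction (z2 div D))]))"
| "transition Rewind s t u v =
    (if s = Blank then (Begin, [(s, MoveR), (t, Stay), (u, Stay), (v, Stay)])
     else (Rewind, [(s, MoveL), (t, Stay), (u, Stay), (v, Stay)]))"
| "transition Begin s t u v =
    (if s = Blank \<or> snd (entry s) = 2 ^ K then (Acc, [(s, Stay), (t, Stay), (u, Stay), (v, Stay)])
     else let (l, i) = entry s; (m', l') = table l i in
       (Pass l i m' l', [(Blank, MoveR), (t, Stay), (u, Stay), (v, Stay)]))"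
| "transition (Pass a i m l) s t u v =
    (if l < K then
       (Pass a i (2 * m + (if t = bit_symbol True then 1 else 0)) (Suc l),
        [(s, Stay), (Blank, MoveL), (u, Stay), (v, Stay)])
     else if K < l then
       if odd m \<or> t \<noteq> Blank
       then (Push a i (m div 2) (l - 1) (odd m), [(s, Stay), (t, MoveR), (u, Stay), (v, Stay)])
       else (Pass a i (m div 2) (l - 1), [(s, Stay), (t, Stay), (u, Stay), (v, Stay)])
     else if s = Blank then
       if m = i \<and> t = Blank
       then (Rewind, [(entry_symbol (a, Suc i), MoveL), (t, Stay), (u, Stay), (v, Stay)])
       else (Rej, [(s, Stay), (t, Stay), (u, Stay), (v, Stay)])
     else let (m', l') = table (fst (entry s)) m in
       (Pass a i m' l', [(s, MoveR), (t, Stay), (u, Stay), (v, Stay)]))"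
| "transition (Push a i m l b) s t u v =
    (Pass a i m l, [(s, Stay), (bit_symbol b, Stay), (u, Stay), (v, Stay)])"
| "transition q s t u v = (q, [(s, Stay), (t, Stay), (u, Stay), (v, Stay)])"

definition M :: "'l machine" where
  "M = encoded_machine 4 control_states alphabet Start Acc Rej state_code
     (\<lambda>q xs. transition q (xs ! 0) (xs ! 1) (xs ! 2) (xs ! 3))"

definition config :: "'l control \<Rightarrow> 'l tape \<Rightarrow> 'l tape \<Rightarrow> 'l tape \<Rightarrow> 'l tape \<Rightarrow> 'l config" where
  "config q a b x y = (state_code q, [a, b, x, y])"

section \<open>Finite encodings of the control and of the queue entries\<close>

lemma finite_entries: "finite entries"
  by (simp add: entries_def finite_L)

lemma inj_entry_code: "inj_on entry_code entries"
proof -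
  obtain c :: "'l \<times> nat \<Rightarrow> nat" where "inj_on c entries"
    using finite_imp_inj_to_nat_seg[OF finite_entries] by auto
  then show ?thesis unfolding entry_code_def by (rule someI[of "\<lambda>c. inj_on c entries"])
qed

lemma inj_entry_symbol: "inj_on entry_symbol entries"
proof (rule inj_onI)
  fix x y assume xy: "x \<in> entries" "y \<in> entries" "entry_symbol x = entry_symbol y"
  show "x = y"
  proof (cases "snd x = 0")
    case True
    then show ?thesis using xy(3) by (auto simp: entry_symbol_def prod_eq_iff split: if_splits)
  next
    case False
    then have "entry_code x = entry_code y" using xy(3) by (auto simp: entry_symbol_def split: if_splits)
    then show ?thesis using inj_onD[OF inj_entry_code] xy by blast
  qed
qed

lemma entry_entry_symbol: "x \<in> entries \<Longrightarrow> entry (entry_symbol x) = x"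
  unfolding entry_def by (rule inv_into_f_f[OF inj_entry_symbol])

lemma entry_symbol_not_Blank: "entry_symbol x \<noteq> Blank"
  by (simp add: entry_symbol_def)

lemma finite_control_states: "finite control_states"
proof -
  have m: "m \<in> {..2 ^ B}" if "m < 2 ^ l" "l \<le> B" for m l :: nat
  proof -
    have "2 ^ l \<le> (2 :: nat) ^ B" using that(2) by (intro power_increasing) auto
    then show ?thesis unfolding atMost_iff using that(1) by linarith
  qed
  have "{Count r s | r s. 0 \<le> r \<and> r < D \<and> 0 \<le> s \<and> s < D} \<subseteq> (\<lambda>(r, s). Count r s) ` ({0..<D} \<times> {0..<D})"
    by (auto simp: image_iff)
  moreover have "{Pass a i m l | a i m l. a \<in> L \<and> i < 2 ^ K \<and> m < 2 ^ l \<and> l \<le> B} \<subseteq>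
      (\<lambda>(a, i, m, l). Pass a i m l) ` (L \<times> {..2 ^ K} \<times> {..2 ^ B} \<times> {..B})"
    using m by (fastforce simp: image_iff)
  moreover have "{Push a i m l b | a i m l b. a \<in> L \<and> i < 2 ^ K \<and> m < 2 ^ l \<and> l \<le> B} \<subseteq>
      (\<lambda>(a, i, m, l, b). Push a i m l b) ` (L \<times> {..2 ^ K} \<times> {..2 ^ B} \<times> {..B} \<times> UNIV)"
    using m by (fastforce simp: image_iff)
  ultimately show ?thesis
    unfolding control_states_def using finite_L by (auto elim: finite_subset)
qed

lemma inj_state_code: "inj_on state_code control_states"
proof -
  obtain e :: "'l control \<Rightarrow> nat" where "inj_on e control_states"
    using finite_imp_inj_to_nat_seg[OF finite_control_states] by auto
  then show ?thesis unfolding state_code_def by (rule someI[of "\<lambda>e. inj_on e control_states"])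
qed

lemma control_states_iff:
  "Pass a i m l \<in> control_states \<longleftrightarrow> a \<in> L \<and> i < 2 ^ K \<and> m < 2 ^ l \<and> l \<le> B"
  "Push a i m l b \<in> control_states \<longleftrightarrow> a \<in> L \<and> i < 2 ^ K \<and> m < 2 ^ l \<and> l \<le> B"
  "Count r s \<in> control_states \<longleftrightarrow> 0 \<le> r \<and> r < D \<and> 0 \<le> s \<and> s < D"
  "Start \<in> control_states" "Rewind \<in> control_states" "Begin \<in> control_states"
  "Acc \<in> control_states" "Rej \<in> control_states"
  by (auto simp: control_states_def)

lemma multitape_TM_M: "multitape_TM L M"
proof -
  have "Input ` L \<subseteq> alphabet"
  proof
    fix s assume "s \<in> Input ` L"
    then obtain l where "l \<in> L" "s = entry_symbol (l, 0)" by (auto simp: entry_symbol_def)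
    then show "s \<in> alphabet" by (auto simp: alphabet_def entries_def)
  qed
  moreover have "finite alphabet" "Blank \<in> alphabet" using finite_entries by (simp_all add: alphabet_def)
  ultimately show ?thesis
    unfolding M_def using finite_control_states inj_state_code
    by (intro multitape_TM_encoded_machine) (simp_all add: control_states_iff)
qed

lemma step_config:
  assumes "q \<in> control_states" "q \<noteq> Acc" "q \<noteq> Rej"
    and "transition q (scan a) (scan b) (scan x) (scan y) = (q', [a', b', x', y'])"
    and "q' \<in> control_states"
    and "{fst a', fst b', fst x', fst y'} \<subseteq> alphabet \<union> {scan a, scan b, scan x, scan y}"
  shows "step M (config q a b x y) = config q' (act a' a) (act b' b) (act x' x) (act y' y)"
proof -
  have "step M (state_code q, [a, b, x, y]) = (state_code q', map2 act [a', b', x', y'] [a, b, x, y])"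
    unfolding M_def using assms
    by (intro step_encoded_machine[OF inj_state_code]) (auto simp: control_states_def)
  then show ?thesis by (simp add: config_def)
qed

lemma act_scan_Stay: "act (scan x, Stay) x = x"
  by (cases x) simp

definition queue_tape :: "int \<Rightarrow> ('l \<times> nat) list \<Rightarrow> int \<Rightarrow> 'l symbol" where
  "queue_tape p xs = (\<lambda>i. if p \<le> i \<and> i < p + int (length xs) then entry_symbol (xs ! nat (i - p)) else Blank)"

lemma queue_tape_nth: "j < length xs \<Longrightarrow> queue_tape p xs (p + int j) = entry_symbol (xs ! j)"
  by (simp add: queue_tape_def)

lemma queue_tape_left: "queue_tape p xs (p - 1) = Blank"
  by (simp add: queue_tape_def)

lemma queue_tape_right: "queue_tape p xs (p + int (length xs)) = Blank"
  by (simp add: queue_tape_def)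

lemma queue_tape_erase: "(queue_tape p (x # xs))(p := Blank) = queue_tape (p + 1) xs"
proof
  fix i
  show "((queue_tape p (x # xs))(p := Blank)) i = queue_tape (p + 1) xs i"
  proof (cases "p < i")
    case True
    then have "nat (i - p) = Suc (nat (i - (p + 1)))" by simp
    then show ?thesis using True by (auto simp: queue_tape_def)
  qed (auto simp: queue_tape_def)
qed

lemma queue_tape_append:
  "(queue_tape p xs)(p + int (length xs) := entry_symbol x) = queue_tape p (xs @ [x])"
proof
  fix i
  have "nat (i - p) < length xs" if "p \<le> i" "i < p + int (length xs)" using that by linarith
  moreover have "nat (i - p) = length xs" if "i = p + int (length xs)" using that by simp
  ultimately show "((queue_tape p xs)(p + int (length xs) := entry_symbol x)) i = queue_tape p (xs @ [x]) i"
    by (auto simp: queue_tape_def nth_append)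
qed

lemma input_tape_eq: "input_tape w = (queue_tape 0 (map (\<lambda>l. (l, 0)) w), 0)"
  by (auto simp: input_tape_def queue_tape_def entry_symbol_def fun_eq_iff)

section \<open>Restoring precision K\<close>

lemma step_pop:
  assumes "Pass a i m l \<in> control_states" "l < K"
  shows "step M (config (Pass a i m l) c (stack_tape p st, p) x y) =
    config (Pass a i (2 * m + (if st \<noteq> [] \<and> hd st then 1 else 0)) (Suc l)) c (stack_tape (p - 1) (tl st), p - 1) x y"
proof -
  have "(stack_tape p st p = (bit_symbol True :: 'l symbol)) \<longleftrightarrow> st \<noteq> [] \<and> hd st"
    by (auto simp: stack_tape_top bit_symbol_def split: list.splits)
  then have "step M (config (Pass a i m l) c (stack_tape p st, p) x y) =
      config (Pass a i (2 * m + (if st \<noteq> [] \<and> hd st then 1 else 0)) (Suc l))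
        (act (scan c, Stay) c) (act (Blank, MoveL) (stack_tape p st, p)) (act (scan x, Stay) x) (act (scan y, Stay) y)"
    using assms K_le_B
    by (intro step_config) (auto simp: control_states_iff alphabet_def)
  then show ?thesis by (simp only: act_scan_Stay act.simps move_head.simps stack_tape_pop)
qed

lemma step_push1:
  assumes "Pass a i m l \<in> control_states" "K < l" "odd m \<or> st \<noteq> []"
  shows "step M (config (Pass a i m l) c (stack_tape p st, p) x y) =
    config (Push a i (m div 2) (l - 1) (odd m)) c (stack_tape p st, p + 1) x y"
proof -
  have "m div 2 < 2 ^ (l - 1)" using assms(1,2)
    by (cases l) (auto simp: control_states_iff)
  moreover have "odd m \<or> stack_tape p st p \<noteq> (Blank :: 'l symbol)"
    using assms(3) by (auto simp: stack_tape_top bit_symbol_def split: list.splits)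
  ultimately have "step M (config (Pass a i m l) c (stack_tape p st, p) x y) =
      config (Push a i (m div 2) (l - 1) (odd m))
        (act (scan c, Stay) c) (act (scan (stack_tape p st, p), MoveR) (stack_tape p st, p)) (act (scan x, Stay) x) (act (scan y, Stay) y)"
    using assms
    by (intro step_config) (auto simp: control_states_iff alphabet_def)
  then show ?thesis by (simp add: act_scan_Stay)
qed

lemma step_push2:
  assumes "Push a i m l b \<in> control_states"
  shows "step M (config (Push a i m l b) c (stack_tape p st, p + 1) x y) =
    config (Pass a i m l) c (stack_tape (p + 1) (b # st), p + 1) x y"
proof -
  have "step M (config (Push a i m l b) c (stack_tape p st, p + 1) x y) =
      config (Pass a i m l)
        (act (scan c, Stay) c) (act (bit_symbol b, Stay) (stack_tape p st, p + 1)) (act (scan x, Stay) x) (act (scan y, Stay) y)"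
    using assms
    by (intro step_config) (auto simp: control_states_iff alphabet_def bit_symbol_def)
  then show ?thesis by (simp only: act_scan_Stay act.simps move_head.simps stack_tape_push)
qed

lemma step_drop_zero:
  assumes "Pass a i m l \<in> control_states" "K < l" "even m"
  shows "step M (config (Pass a i m l) c (stack_tape p [], p) x y) =
    config (Pass a i (m div 2) (l - 1)) c (stack_tape p [], p) x y"
proof -
  have "m div 2 < 2 ^ (l - 1)" using assms(1,2)
    by (cases l) (auto simp: control_states_iff)
  then have "step M (config (Pass a i m l) c (stack_tape p [], p) x y) =
      config (Pass a i (m div 2) (l - 1))
        (act (scan c, Stay) c) (act (scan (stack_tape p [], p), Stay) (stack_tape p [], p)) (act (scan x, Stay) x) (act (scan y, Stay) y)"
    using assms
    by (intro step_config) (auto simp: control_states_iff alphabet_def stack_tape_Nil)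
  then show ?thesis by (simp only: act_scan_Stay)
qed

lemma point_pop:
  "point (2 * m + (if st \<noteq> [] \<and> hd st then 1 else 0)) (Suc l) (tl st) = point m l st"
  by (cases st) (auto simp: point_def field_simps)

lemma canonical_tl: "canonical st \<Longrightarrow> canonical (tl st)"
  by (cases st) (auto simp: canonical_def split: if_splits)

lemma normalize_up:
  assumes "Pass a i m l \<in> control_states" "l \<le> K" "canonical st"
  shows "reaches M (K - l) (config (Pass a i m l) c (stack_tape p st, p) x y)
    (\<lambda>c'. \<exists>m' p' st'. c' = config (Pass a i m' K) c (stack_tape p' st', p') x y \<and>
       m' < 2 ^ K \<and> canonical st' \<and> point m' K st' = point m l st)"
  using assms
proof (induction "K - l" arbitrary: m l p st)
  case 0
  then have "l = K" by simp
  with 0 show ?case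
    by (intro reaches_here exI[of _ m] exI[of _ p] exI[of _ st]) (simp add: control_states_iff)
next
  case (Suc k)
  define m1 where "m1 = 2 * m + (if st \<noteq> [] \<and> hd st then 1 else 0)"
  have lK: "l < K" "k = K - Suc l" "K - l = Suc (K - Suc l)" using Suc.hyps(2) by auto
  have P: "Pass a i m1 (Suc l) \<in> control_states"
    using Suc.prems(1) lK(1) K_le_B by (auto simp: control_states_iff m1_def)
  have "reaches M (K - Suc l) (config (Pass a i m1 (Suc l)) c (stack_tape (p - 1) (tl st), p - 1) x y)
    (\<lambda>c'. \<exists>m' p' st'. c' = config (Pass a i m' K) c (stack_tape p' st', p') x y \<and>
       m' < 2 ^ K \<and> canonical st' \<and> point m' K st' = point m l st)"
    using Suc.hyps(1)[OF lK(2) P _ canonical_tl[OF Suc.prems(3)]] lK(1) point_pop[of m st l]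
    unfolding m1_def by simp
  then show ?case
    unfolding lK(3) m1_def by (intro reaches_step) (simp only: step_pop[OF Suc.prems(1) lK(1)])
qed

lemma point_push: "0 < l \<Longrightarrow> point (m div 2) (l - 1) (odd m # st) = point m l st"
proof -
  assume "0 < l"
  then obtain k where "l = Suc k" by (metis gr0_conv_Suc)
  moreover have "real m = 2 * real (m div 2) + (if odd m then 1 else 0)"
    by (cases "odd m") (auto elim!: oddE evenE)
  ultimately show ?thesis by (simp add: point_def field_simps)
qed

lemma normalize_down:
  assumes "Pass a i m l \<in> control_states" "K \<le> l" "canonical st"
  shows "reaches M (2 * (l - K)) (config (Pass a i m l) c (stack_tape p st, p) x y)
    (\<lambda>c'. \<exists>m' p' st'. c' = config (Pass a i m' K) c (stack_tape p' st', p') x y \<and>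
       m' < 2 ^ K \<and> canonical st' \<and> point m' K st' = point m l st)"
  using assms
proof (induction "l - K" arbitrary: m l p st)
  case 0
  then have "l = K" by simp
  with 0 show ?case
    by (intro reaches_here exI[of _ m] exI[of _ p] exI[of _ st]) (simp add: control_states_iff)
next
  case (Suc k)
  have lK: "K < l" "k = (l - 1) - K" "2 * (l - K) = Suc (Suc (2 * ((l - 1) - K)))" "0 < l"
    using Suc.hyps(2) by auto
  have "m div 2 < 2 ^ (l - 1)" using Suc.prems(1) lK(1)
    by (cases l) (auto simp: control_states_iff)
  then have P: "Pass a i (m div 2) (l - 1) \<in> control_states" "Push a i (m div 2) (l - 1) (odd m) \<in> control_states"
    using Suc.prems(1) by (auto simp: control_states_iff)
  have K: "K \<le> l - 1" using lK(1) by simp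
  show ?case
  proof (cases "odd m \<or> st \<noteq> []")
    case True
    have "canonical (odd m # st)" using Suc.prems(3) True by (auto simp: canonical_def)
    from Suc.hyps(1)[OF lK(2) P(1) K this, of "p + 1"] show ?thesis
      unfolding lK(3) point_push[OF lK(4)]
      by (intro reaches_step) (simp only: step_push1[OF Suc.prems(1) lK(1) True] step_push2[OF P(2)])
  next
    case False
    then have st: "st = []" "even m" by auto
    have "point (m div 2) (l - 1) [] = point m l []"
      using point_push[OF lK(4), of m "[]"] st(2) by (simp add: point_def)
    with Suc.hyps(1)[OF lK(2) P(1) K Suc.prems(3), of p]
    have "reaches M (2 * (l - 1 - K)) (config (Pass a i (m div 2) (l - 1)) c (stack_tape p st, p) x y)
      (\<lambda>c'. \<exists>m' p' st'. c' = config (Pass a i m' K) c (stack_tape p' st', p') x y \<and>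
         m' < 2 ^ K \<and> canonical st' \<and> point m' K st' = point m l st)"
      unfolding st(1) by simp
    then have "reaches M (Suc (2 * (l - 1 - K))) (config (Pass a i m l) c (stack_tape p st, p) x y)
      (\<lambda>c'. \<exists>m' p' st'. c' = config (Pass a i m' K) c (stack_tape p' st', p') x y \<and>
         m' < 2 ^ K \<and> canonical st' \<and> point m' K st' = point m l st)"
      unfolding st(1) by (intro reaches_step) (simp only: step_drop_zero[OF Suc.prems(1) lK(1) st(2)])
    then show ?thesis unfolding lK(3) by (rule reaches_mono) auto
  qed
qed

text \<open>The table applies only at precision \<open>K\<close>. At most \<open>B\<close> digits
  are moved, with at most two steps each, whatever the height of the stack; hence one letter costs a
  constant number of steps.\<close>

lemma normalize:
  assumes "Pass a i m l \<in> control_states" "canonical st"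
  shows "reaches M (2 * B) (config (Pass a i m l) c (stack_tape p st, p) x y)
    (\<lambda>c'. \<exists>m' p' st'. c' = config (Pass a i m' K) c (stack_tape p' st', p') x y \<and>
       m' < 2 ^ K \<and> canonical st' \<and> point m' K st' = point m l st)"
proof (cases "l \<le> K")
  case True
  then show ?thesis by (intro reaches_mono[OF normalize_up[OF assms(1) _ assms(2)]]) (use K_le_B in auto)
next
  case False
  then show ?thesis
    by (intro reaches_mono[OF normalize_down[OF assms(1) _ assms(2)]])
      (use assms(1) in \<open>auto simp: control_states_iff\<close>)
qed


section \<open>A single pass along the queue\<close>

lemma step_letter:
  assumes "a \<in> L" "i < 2 ^ K" "m < 2 ^ K" "j < length xs" "xs ! j \<in> entries"
  shows "step M (config (Pass a i m K) (queue_tape p xs, p + int j) b x y) =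
    config (Pass a i (fst (table (fst (xs ! j)) m)) (snd (table (fst (xs ! j)) m))) (queue_tape p xs, p + int (Suc j)) b x y"
proof -
  have l: "fst (xs ! j) \<in> L" using assms(5) by (auto simp: entries_def)
  have read: "scan (queue_tape p xs, p + int j) = entry_symbol (xs ! j)"
    using queue_tape_nth[OF assms(4)] by simp
  have "step M (config (Pass a i m K) (queue_tape p xs, p + int j) b x y) =
      config (Pass a i (fst (table (fst (xs ! j)) m)) (snd (table (fst (xs ! j)) m)))
        (act (scan (queue_tape p xs, p + int j), MoveR) (queue_tape p xs, p + int j))
        (act (scan b, Stay) b) (act (scan x, Stay) x) (act (scan y, Stay) y)"
  proof (rule step_config)
    show "transition (Pass a i m K) (scan (queue_tape p xs, p + int j)) (scan b) (scan x) (scan y) =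
        (Pass a i (fst (table (fst (xs ! j)) m)) (snd (table (fst (xs ! j)) m)),
         [(scan (queue_tape p xs, p + int j), MoveR), (scan b, Stay), (scan x, Stay), (scan y, Stay)])"
      unfolding read by (simp add: entry_symbol_not_Blank entry_entry_symbol[OF assms(5)] case_prod_unfold Let_def)
  qed (use assms K_le_B table_bounds[OF l assms(3)] in \<open>auto simp: control_states_iff\<close>)
  then show ?thesis unfolding act_scan_Stay by (simp add: algebra_simps)
qed

lemma point_table:
  assumes "l \<in> L" "m < 2 ^ K"
  shows "point (fst (table l m)) (snd (table l m)) st = f l (point m K st)"
  unfolding point_def using table_action[OF assms, of "digits_value st"] digits_value_range[of st] by simp

text \<open>\<open>pre\<close> is the part of the queue already read. Each letter costs a
  normalization and one reading step; the final \<open>2 * B\<close> steps restore precision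
  \<open>K\<close> for the comparison at the end of the pass.\<close>

lemma read_letters:
  assumes "Pass a i m l \<in> control_states" "canonical st" "set (pre @ ys) \<subseteq> entries"
  shows "reaches M ((2 * B + 1) * length ys + 2 * B)
    (config (Pass a i m l) (queue_tape p (pre @ ys), p + int (length pre)) (stack_tape q st, q) x y)
    (\<lambda>c'. \<exists>m' q' st'. c' = config (Pass a i m' K) (queue_tape p (pre @ ys), p + int (length (pre @ ys))) (stack_tape q' st', q') x y \<and>
       m' < 2 ^ K \<and> canonical st' \<and> point m' K st' = fold f (map fst ys) (point m l st))"
  using assms
proof (induction ys arbitrary: pre m l st q)
  case Nil
  then show ?case using normalize[OF Nil.prems(1,2)] by simp
next
  case (Cons e ys)
  have ai: "a \<in> L" "i < 2 ^ K" using Cons.prems(1) by (auto simp: control_states_iff)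
  have e: "e \<in> entries" "fst e \<in> L" using Cons.prems(3) by (auto simp: entries_def)
  have "reaches M (2 * B + Suc ((2 * B + 1) * length ys + 2 * B))
    (config (Pass a i m l) (queue_tape p (pre @ e # ys), p + int (length pre)) (stack_tape q st, q) x y)
    (\<lambda>c'. \<exists>m' q' st'. c' = config (Pass a i m' K) (queue_tape p (pre @ e # ys), p + int (length (pre @ e # ys))) (stack_tape q' st', q') x y \<and>
       m' < 2 ^ K \<and> canonical st' \<and> point m' K st' = fold f (map fst (e # ys)) (point m l st))"
  proof (rule reaches_trans[OF normalize[OF Cons.prems(1,2)]], elim exE conjE)
    fix c' m' q' st'
    assume c': "c' = config (Pass a i m' K) (queue_tape p (pre @ e # ys), p + int (length pre)) (stack_tape q' st', q') x y"
      and m': "m' < 2 ^ K" and st': "canonical st'" and pt: "point m' K st' = point m l st"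
    define t where "t = table (fst e) m'"
    have step: "step M c' = config (Pass a i (fst t) (snd t)) (queue_tape p ((pre @ [e]) @ ys), p + int (length (pre @ [e])))
        (stack_tape q' st', q') x y"
      using step_letter[OF ai m', of "length pre" "pre @ e # ys"] e(1) unfolding c' t_def by simp
    have P: "Pass a i (fst t) (snd t) \<in> control_states"
      using ai table_bounds[OF e(2) m'] by (simp add: control_states_iff t_def)
    have "point (fst t) (snd t) st' = f (fst e) (point m l st)"
      unfolding t_def point_table[OF e(2) m'] pt ..
    then show "reaches M (Suc ((2 * B + 1) * length ys + 2 * B)) c'
      (\<lambda>c'. \<exists>m' q' st'. c' = config (Pass a i m' K) (queue_tape p (pre @ e # ys), p + int (length (pre @ e # ys))) (stack_tape q' st', q') x y \<and>
         m' < 2 ^ K \<and> canonical st' \<and> point m' K st' = fold f (map fst (e # ys)) (point m l st))"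
      using Cons.IH[OF P st', of "pre @ [e]" q'] Cons.prems(3) by (intro reaches_step) (simp add: step)
  qed
  then show ?case by (rule reaches_mono) auto
qed

lemma rewind:
  assumes "j \<le> length xs"
  shows "reaches M (Suc j) (config Rewind (queue_tape p xs, p + int j - 1) b x y)
    (\<lambda>c'. c' = config Begin (queue_tape p xs, p) b x y)"
  using assms
proof (induction j)
  case 0
  have "step M (config Rewind (queue_tape p xs, p - 1) b x y) =
      config Begin (act (scan (queue_tape p xs, p - 1), MoveR) (queue_tape p xs, p - 1)) (act (scan b, Stay) b) (act (scan x, Stay) x) (act (scan y, Stay) y)"
    by (rule step_config) (simp_all add: control_states_iff queue_tape_left)
  then have "step M (config Rewind (queue_tape p xs, p - 1) b x y) = config Begin (queue_tape p xs, p) b x y"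
    unfolding act_scan_Stay by simp
  then show ?case by (intro reaches_step reaches_here) simp
next
  case (Suc j)
  have pos: "p + int (Suc j) - 1 = p + int j" by simp
  have read: "scan (queue_tape p xs, p + int j) = entry_symbol (xs ! j)"
    using queue_tape_nth[of j xs p] Suc.prems by simp
  have "step M (config Rewind (queue_tape p xs, p + int j) b x y) =
      config Rewind (act (scan (queue_tape p xs, p + int j), MoveL) (queue_tape p xs, p + int j)) (act (scan b, Stay) b) (act (scan x, Stay) x) (act (scan y, Stay) y)"
  proof (rule step_config)
    show "transition Rewind (scan (queue_tape p xs, p + int j)) (scan b) (scan x) (scan y) =
        (Rewind, [(scan (queue_tape p xs, p + int j), MoveL), (scan b, Stay), (scan x, Stay), (scan y, Stay)])"
      unfolding read by (simp add: entry_symbol_not_Blank)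
  qed (simp_all add: control_states_iff)
  then have step: "step M (config Rewind (queue_tape p xs, p + int j) b x y) = config Rewind (queue_tape p xs, p + int j - 1) b x y"
    unfolding act_scan_Stay by simp
  show ?case unfolding pos by (rule reaches_step) (use Suc step in simp)
qed

text \<open>Positions are existential because the queue drifts: a successful pass erases its first
  cell and appends one on the right. The stack is empty, but its head may be anywhere.\<close>

definition at_begin :: "('l \<times> nat) list \<Rightarrow> 'l config \<Rightarrow> bool" where
  "at_begin xs c \<longleftrightarrow> (\<exists>p q x y. c = config Begin (queue_tape p xs, p) (\<lambda>_. Blank, q) x y)"

lemma at_beginI: "at_begin xs (config Begin (queue_tape p xs, p) (\<lambda>_. Blank, q) x y)"
  unfolding at_begin_def by blast

abbreviation accepting :: "'l config \<Rightarrow> bool" where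
  "accepting c \<equiv> fst c = accept M"

abbreviation rejecting :: "'l config \<Rightarrow> bool" where
  "rejecting c \<equiv> fst c = reject M"

lemma accepting_config: "accepting (config Acc a b x y)"
  by (simp add: config_def M_def encoded_machine_def)

lemma rejecting_config: "rejecting (config Rej a b x y)"
  by (simp add: config_def M_def encoded_machine_def)

lemma accept_neq_reject: "accept M \<noteq> reject M"
  using multitape_TM_M by (simp add: multitape_TM_def)

lemma step_Begin:
  assumes "(a, i) \<in> entries" "i < 2 ^ K"
  shows "step M (config Begin (queue_tape p ((a, i) # ys), p) b x y) =
    config (Pass a i (fst (table a i)) (snd (table a i))) (queue_tape (p + 1) ys, p + 1) b x y"
proof -
  have a: "a \<in> L" using assms(1) by (simp add: entries_def)
  have read: "scan (queue_tape p ((a, i) # ys), p) = entry_symbol (a, i)"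
    using queue_tape_nth[of 0 "(a, i) # ys" p] by simp
  have "step M (config Begin (queue_tape p ((a, i) # ys), p) b x y) =
      config (Pass a i (fst (table a i)) (snd (table a i)))
        (act (Blank, MoveR) (queue_tape p ((a, i) # ys), p)) (act (scan b, Stay) b) (act (scan x, Stay) x) (act (scan y, Stay) y)"
  proof (rule step_config)
    show "transition Begin (scan (queue_tape p ((a, i) # ys), p)) (scan b) (scan x) (scan y) =
        (Pass a i (fst (table a i)) (snd (table a i)), [(Blank, MoveR), (scan b, Stay), (scan x, Stay), (scan y, Stay)])"
      unfolding read using assms(2)
      by (simp add: entry_symbol_not_Blank entry_entry_symbol[OF assms(1)] case_prod_unfold Let_def)
  qed (use a assms table_bounds[OF a assms(2)] in \<open>auto simp: control_states_iff alphabet_def\<close>)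
  then show ?thesis unfolding act_scan_Stay by (simp add: queue_tape_erase)
qed

lemma accept_at_begin:
  assumes "at_begin xs c" "xs = [] \<or> hd xs \<in> entries \<and> snd (hd xs) = 2 ^ K"
  shows "reaches M 1 c accepting"
proof -
  obtain p q x y where c: "c = config Begin (queue_tape p xs, p) (\<lambda>_. Blank, q) x y"
    using assms(1) unfolding at_begin_def by blast
  have "scan (queue_tape p xs, p) = Blank \<or> snd (entry (scan (queue_tape p xs, p))) = 2 ^ K"
  proof (cases xs)
    case Nil
    then show ?thesis by (simp add: queue_tape_def)
  next
    case (Cons e ys)
    then have "scan (queue_tape p xs, p) = entry_symbol e" using queue_tape_nth[of 0 xs p] by simp
    then show ?thesis using assms(2) Cons entry_entry_symbol by simp
  qed
  then have "step M c = config Acc (act (scan (queue_tape p xs, p), Stay) (queue_tape p xs, p))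
      (act (scan (\<lambda>_. Blank, q), Stay) (\<lambda>_. Blank, q)) (act (scan x, Stay) x) (act (scan y, Stay) y)"
    unfolding c by (intro step_config) (auto simp: control_states_iff)
  then have "accepting (step M c)" using accepting_config by simp
  then show ?thesis unfolding One_nat_def by (intro reaches_step reaches_here)
qed

text \<open>For a canonical stack, equality with the grid point is visible from the control and one
  stack cell. The queue head stands on the first blank to the right, where the pair with increased
  index has to be written.\<close>

lemma step_end_of_pass:
  assumes "a \<in> L" "i < 2 ^ K" "m < 2 ^ K" "canonical st"
  shows "point m K st = real i / 2 ^ K \<Longrightarrow>
      step M (config (Pass a i m K) (queue_tape p xs, p + int (length xs)) (stack_tape q st, q) x y) =
      config Rewind (queue_tape p (xs @ [(a, Suc i)]), p + int (length xs) - 1) (\<lambda>_. Blank, q) x y"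
    and "point m K st \<noteq> real i / 2 ^ K \<Longrightarrow>
      rejecting (step M (config (Pass a i m K) (queue_tape p xs, p + int (length xs)) (stack_tape q st, q) x y))"
proof -
  have P: "Pass a i m K \<in> control_states" using assms K_le_B by (simp add: control_states_iff)
  have read: "scan (queue_tape p xs, p + int (length xs)) = Blank" using queue_tape_right by simp
  have top: "scan (stack_tape q st, q) = (Blank :: 'l symbol) \<longleftrightarrow> st = []"
    by (simp add: stack_tape_top bit_symbol_def split: list.splits)
  {
    assume "point m K st = real i / 2 ^ K"
    then have mi: "m = i" "st = []" using point_eq_grid_point_iff[OF assms(4)] by auto
    have "(a, Suc i) \<in> entries" using assms by (simp add: entries_def)
    then have "step M (config (Pass a i m K) (queue_tape p xs, p + int (length xs)) (stack_tape q st, q) x y) =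
        config Rewind (act (entry_symbol (a, Suc i), MoveL) (queue_tape p xs, p + int (length xs)))
          (act (scan (stack_tape q st, q), Stay) (stack_tape q st, q)) (act (scan x, Stay) x) (act (scan y, Stay) y)"
      using mi top read P by (intro step_config) (auto simp: control_states_iff alphabet_def)
    then show "step M (config (Pass a i m K) (queue_tape p xs, p + int (length xs)) (stack_tape q st, q) x y) =
        config Rewind (queue_tape p (xs @ [(a, Suc i)]), p + int (length xs) - 1) (\<lambda>_. Blank, q) x y"
      unfolding act_scan_Stay mi(2) by (simp add: queue_tape_append stack_tape_Nil)
  next
    assume "point m K st \<noteq> real i / 2 ^ K"
    then have "\<not> (m = i \<and> scan (stack_tape q st, q) = (Blank :: 'l symbol))"
      using point_eq_grid_point_iff[OF assms(4)] top by blast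
    then have "step M (config (Pass a i m K) (queue_tape p xs, p + int (length xs)) (stack_tape q st, q) x y) =
        config Rej (act (scan (queue_tape p xs, p + int (length xs)), Stay) (queue_tape p xs, p + int (length xs)))
          (act (scan (stack_tape q st, q), Stay) (stack_tape q st, q)) (act (scan x, Stay) x) (act (scan y, Stay) y)"
      using read P by (intro step_config) (auto simp: control_states_iff)
    then show "rejecting (step M (config (Pass a i m K) (queue_tape p xs, p + int (length xs)) (stack_tape q st, q) x y))"
      using rejecting_config by simp
  }
qed

text \<open>Per entry at most \<open>2 * B + 1\<close> steps for reading and one for rewinding;
  \<open>Suc\<close> leaves room for the constant overhead.\<close>

definition pass_time :: "nat \<Rightarrow> nat" where
  "pass_time n = (2 * B + 2) * Suc n"

lemma pass:
  assumes "at_begin ((a, i) # ys) c" "(a, i) \<in> entries" "i < 2 ^ K" "set ys \<subseteq> entries"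
  shows "reaches M (pass_time (Suc (length ys))) c
    (if fold f (a # map fst ys) (real i / 2 ^ K) = real i / 2 ^ K
     then at_begin (ys @ [(a, Suc i)]) else rejecting)" (is "reaches M _ c ?P")
proof -
  obtain p q x y where c: "c = config Begin (queue_tape p ((a, i) # ys), p) (\<lambda>_. Blank, q) x y"
    using assms(1) unfolding at_begin_def by blast
  have a: "a \<in> L" using assms(2) by (simp add: entries_def)
  have i: "point i K [] = real i / 2 ^ K" by (simp add: point_def)
  have P: "Pass a i (fst (table a i)) (snd (table a i)) \<in> control_states"
    using a assms(3) table_bounds[OF a assms(3)] by (simp add: control_states_iff)
  have canon: "canonical []" by (simp add: canonical_def)
  have "reaches M (((2 * B + 1) * length ys + 2 * B) + Suc (Suc (length ys))) (step M c) ?P"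
  proof (rule reaches_trans)
    show "reaches M ((2 * B + 1) * length ys + 2 * B) (step M c)
      (\<lambda>c'. \<exists>m' q' st'. c' = config (Pass a i m' K) (queue_tape (p + 1) ys, p + 1 + int (length ys)) (stack_tape q' st', q') x y \<and>
         m' < 2 ^ K \<and> canonical st' \<and> point m' K st' = fold f (a # map fst ys) (real i / 2 ^ K))"
      using read_letters[OF P canon, of "[]" ys "p + 1" q x y] assms(4)
      unfolding c step_Begin[OF assms(2,3)] point_table[OF a assms(3)] i by (simp add: stack_tape_Nil)
  next
    fix c'
    assume "\<exists>m' q' st'. c' = config (Pass a i m' K) (queue_tape (p + 1) ys, p + 1 + int (length ys)) (stack_tape q' st', q') x y \<and>
         m' < 2 ^ K \<and> canonical st' \<and> point m' K st' = fold f (a # map fst ys) (real i / 2 ^ K)"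
    then obtain m' q' st' where c': "c' = config (Pass a i m' K) (queue_tape (p + 1) ys, p + 1 + int (length ys)) (stack_tape q' st', q') x y"
      and m': "m' < 2 ^ K" and st': "canonical st'" and pt: "point m' K st' = fold f (a # map fst ys) (real i / 2 ^ K)"
      by blast
    show "reaches M (Suc (Suc (length ys))) c' ?P"
    proof (cases "point m' K st' = real i / 2 ^ K")
      case True
      have "reaches M (Suc (length ys)) (step M c') (at_begin (ys @ [(a, Suc i)]))"
        unfolding c' step_end_of_pass(1)[OF a assms(3) m' st' True]
        by (rule reaches_mono[OF rewind]) (simp_all add: at_beginI)
      from reaches_step[OF this] show ?thesis using True pt by simp
    next
      case False
      have "rejecting (step M c')"
        unfolding c' by (rule step_end_of_pass(2)[OF a assms(3) m' st' False])
      then have "?P (step M c')" using False pt by simp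
      then show ?thesis by (rule reaches_step[OF reaches_here])
    qed
  qed
  then have "reaches M (Suc (((2 * B + 1) * length ys + 2 * B) + Suc (Suc (length ys)))) c ?P"
    by (rule reaches_step)
  then show ?thesis by (rule reaches_mono) (auto simp: pass_time_def algebra_simps)
qed

text \<open>The queue after \<open>i * length w + j\<close> successful passes.\<close>

definition queue :: "'l list \<Rightarrow> nat \<Rightarrow> nat \<Rightarrow> ('l \<times> nat) list" where
  "queue w i j = map (\<lambda>l. (l, i)) (drop j w) @ map (\<lambda>l. (l, Suc i)) (take j w)"

lemma queue_wrap: "queue w i (length w) = queue w (Suc i) 0"
  by (simp add: queue_def)

abbreviation rotation_fixes :: "'l list \<Rightarrow> nat \<Rightarrow> nat \<Rightarrow> bool" where
  "rotation_fixes w i j \<equiv> fold f (drop j w @ take j w) (real i / 2 ^ K) = real i / 2 ^ K"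

lemma pass_queue:
  assumes w: "set w \<subseteq> L" and ij: "i < 2 ^ K" "j < length w" and c: "at_begin (queue w i j) c"
  shows "reaches M (pass_time (length w)) c
    (if rotation_fixes w i j then at_begin (queue w i (Suc j)) else rejecting)"
proof -
  define ys where "ys = map (\<lambda>l. (l, i)) (drop (Suc j) w) @ map (\<lambda>l. (l, Suc i)) (take j w)"
  have d: "drop j w = w ! j # drop (Suc j) w" using ij(2) by (simp add: Cons_nth_drop_Suc)
  have q: "queue w i j = (w ! j, i) # ys" by (simp add: queue_def ys_def d)
  have wj: "w ! j \<in> L" using w ij(2) by (meson nth_mem subsetD)
  have ys: "set ys \<subseteq> entries"
    using w ij(1) unfolding ys_def entries_def by (auto dest: in_set_dropD in_set_takeD)
  have e: "(w ! j, i) \<in> entries" using wj ij(1) by (simp add: entries_def)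
  have len: "Suc (length ys) = length w" using ij(2) by (simp add: ys_def)
  have rot: "w ! j # map fst ys = drop j w @ take j w" by (simp add: ys_def d comp_def)
  have app: "ys @ [(w ! j, Suc i)] = queue w i (Suc j)"
    using ij(2) by (simp add: ys_def queue_def take_Suc_conv_app_nth)
  show ?thesis
    using pass[OF c[unfolded q] e ij(1) ys] unfolding len rot app .
qed

lemma pass_queue_round:
  assumes w: "set w \<subseteq> L" and i: "i < 2 ^ K" and "j \<le> length w" and "at_begin (queue w i j) c"
  shows "reaches M ((length w - j) * pass_time (length w)) c
    (if \<forall>k. j \<le> k \<and> k < length w \<longrightarrow> rotation_fixes w i k then at_begin (queue w (Suc i) 0) else rejecting)"
  using assms(3,4)
proof (induction "length w - j" arbitrary: j c)
  case 0
  then have "j = length w" by simp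
  then show ?case using 0 queue_wrap by (intro reaches_here) auto
next
  case (Suc n)
  have j: "j < length w" "n = length w - Suc j" "Suc j \<le> length w" using Suc.hyps(2) by auto
  have time: "(length w - j) * pass_time (length w) = pass_time (length w) + (length w - Suc j) * pass_time (length w)"
    using Suc.hyps(2) j(2) by (metis mult_Suc)
  have all: "(\<forall>k. j \<le> k \<and> k < length w \<longrightarrow> rotation_fixes w i k) \<longleftrightarrow>
      rotation_fixes w i j \<and> (\<forall>k. Suc j \<le> k \<and> k < length w \<longrightarrow> rotation_fixes w i k)"
    using j(1) by (metis Suc_leI le_neq_implies_less order_refl Suc_leD)
  show ?case
    unfolding time
  proof (rule reaches_trans[OF pass_queue[OF w i j(1) Suc.prems(2)]])
    fix c' assume c': "(if rotation_fixes w i j then at_begin (queue w i (Suc j)) else rejecting) c'"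
    show "reaches M ((length w - Suc j) * pass_time (length w)) c'
      (if \<forall>k. j \<le> k \<and> k < length w \<longrightarrow> rotation_fixes w i k then at_begin (queue w (Suc i) 0) else rejecting)"
    proof (cases "rotation_fixes w i j")
      case True
      then show ?thesis using Suc.hyps(1)[OF j(2,3)] c' unfolding all by simp
    next
      case False
      then show ?thesis using c' unfolding all by (intro reaches_here) simp
    qed
  qed
qed

text \<open>Induction on the number of grid points left. The additional step leads from
  \<open>Begin\<close> to \<open>Acc\<close>; the empty queue of the empty word is accepted in the
  same way.\<close>

lemma all_rounds:
  assumes w: "set w \<subseteq> L" and "i \<le> 2 ^ K" and "at_begin (queue w i 0) c"
  shows "reaches M ((2 ^ K - i) * (length w * pass_time (length w)) + 1) c
    (if \<forall>m k. i \<le> m \<and> m < 2 ^ K \<and> k < length w \<longrightarrow> rotation_fixes w m k then accepting else rejecting)"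
  using assms(2,3)
proof (induction "2 ^ K - i" arbitrary: i c)
  case 0
  then have i: "i = 2 ^ K" by simp
  have "queue w i 0 = [] \<or> hd (queue w i 0) \<in> entries \<and> snd (hd (queue w i 0)) = 2 ^ K"
    using w i by (cases w) (auto simp: queue_def entries_def)
  then have "reaches M 1 c accepting" using accept_at_begin 0 by blast
  then show ?case by (rule reaches_mono) (use i in auto)
next
  case (Suc n)
  have i: "i < 2 ^ K" "n = 2 ^ K - Suc i" "Suc i \<le> 2 ^ K" using Suc.hyps(2) by auto
  have "2 ^ K - i = Suc (2 ^ K - Suc i)" using i(1) by simp
  then have time: "(2 ^ K - i) * (length w * pass_time (length w)) + 1 =
      (length w - 0) * pass_time (length w) + ((2 ^ K - Suc i) * (length w * pass_time (length w)) + 1)" by simp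
  have all: "(\<forall>m k. i \<le> m \<and> m < 2 ^ K \<and> k < length w \<longrightarrow> rotation_fixes w m k) \<longleftrightarrow>
      (\<forall>k. 0 \<le> k \<and> k < length w \<longrightarrow> rotation_fixes w i k) \<and>
      (\<forall>m k. Suc i \<le> m \<and> m < 2 ^ K \<and> k < length w \<longrightarrow> rotation_fixes w m k)" (is "?A \<longleftrightarrow> ?H \<and> ?T")
    using i(1) by (metis Suc_leI le_neq_implies_less order_refl Suc_leD le0)
  show ?case
    unfolding time
  proof (rule reaches_trans[OF pass_queue_round[OF w i(1) le0 Suc.prems(2)]])
    fix c' assume c': "(if ?H then at_begin (queue w (Suc i) 0) else rejecting) c'"
    show "reaches M ((2 ^ K - Suc i) * (length w * pass_time (length w)) + 1) c' (if ?A then accepting else rejecting)"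
    proof (cases ?H)
      case True
      then have "at_begin (queue w (Suc i) 0) c'" using c' by simp
      from Suc.hyps(1)[OF i(2,3) this] show ?thesis using True unfolding all by simp
    next
      case False
      have "rejecting c'" using c' False by (simp only: if_False)
      moreover have "\<not> ?A" using False all by blast
      ultimately show ?thesis by (intro reaches_here) (simp only: if_False)
    qed
  qed
qed

section \<open>The counting phase\<close>

abbreviation total :: "('l \<Rightarrow> int) \<Rightarrow> 'l list \<Rightarrow> int" where
  "total d w \<equiv> (\<Sum>l\<leftarrow>w. d l)"

lemma step_Start:
  "step M (config Start a b blank_tape blank_tape) = config (Count 0 0) a b (marked_tape, 0) (marked_tape, 0)"
proof -
  have "step M (config Start a b blank_tape blank_tape) =
      config (Count 0 0) (act (scan a, Stay) a) (act (scan b, Stay) b) (act (Work 0, Stay) blank_tape) (act (Work 0, Stay) blank_tape)"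
    by (rule step_config) (simp_all add: control_states_iff D_pos alphabet_def)
  then show ?thesis unfolding act_scan_Stay by (simp add: blank_tape_def marked_tape_def)
qed

text \<open>As \<open>D\<close> bounds the weight of a letter, a remainder plus a weight lies in
  [-D, 2 D). A counter head therefore moves by at most one cell per letter.\<close>

lemma div_D_range:
  assumes "l \<in> L" "0 \<le> r" "r < D"
  shows "(r + d1 l) div D \<in> {-1, 0, 1}" "(r + d2 l) div D \<in> {-1, 0, 1}"
proof -
  have claim: "z div D \<in> {-1, 0, 1}" if z: "- D \<le> z" "z < 2 * D" for z
  proof -
    have "(- 1) * D \<le> z" using z by simp
    then have "- 1 \<le> z div D" using D_pos by (metis pos_imp_zdiv_pos_iff zdiv_mono1 nonzero_mult_div_cancel_right less_irrefl)
    moreover have "z div D < 2"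
    proof (rule ccontr)
      assume "\<not> ?thesis"
      then have "2 * D \<le> (z div D) * D" using D_pos by (intro mult_right_mono) auto
      moreover have "0 \<le> z mod D" using D_pos by simp
      ultimately show False using z(2) div_mult_mod_eq[of z D] by linarith
    qed
    ultimately show ?thesis by auto
  qed
  show "(r + d1 l) div D \<in> {-1, 0, 1}" "(r + d2 l) div D \<in> {-1, 0, 1}"
    by (rule claim; use weights_le_D[OF assms(1)] assms(2,3) in linarith)+
qed

text \<open>A partial sum s is stored as \<open>s div D\<close> in a head position and
  \<open>s mod D\<close> in the control. Since \<open>div\<close> rounds down, the carry rule also
  holds for negative sums.\<close>

lemma step_Count:
  assumes "j < length xs" "xs ! j \<in> entries"
  shows "step M (config (Count (s1 mod D) (s2 mod D)) (queue_tape p xs, p + int j) b (tx, s1 div D) (ty, s2 div D)) =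
    config (Count ((s1 + d1 (fst (xs ! j))) mod D) ((s2 + d2 (fst (xs ! j))) mod D)) (queue_tape p xs, p + int (Suc j)) b
      (tx, (s1 + d1 (fst (xs ! j))) div D) (ty, (s2 + d2 (fst (xs ! j))) div D)"
proof -
  define l where "l = fst (xs ! j)"
  have l: "l \<in> L" using assms(2) by (auto simp: entries_def l_def)
  have read: "scan (queue_tape p xs, p + int j) = entry_symbol (xs ! j)"
    using queue_tape_nth[OF assms(1)] by simp
  have r: "0 \<le> s mod D" "s mod D < D" for s using D_pos by auto
  have pos: "p + int (Suc j) = p + int j + 1" by simp
  have carry: "(s + z) div D = s div D + (s mod D + z) div D" for s z
  proof -
    have "s + z = (s mod D + z) + (s div D) * D" by (simp add: algebra_simps)
    then have "(s + z) div D = ((s mod D + z) + (s div D) * D) div D" by (rule arg_cong)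
    also have "\<dots> = s div D + (s mod D + z) div D" using D_pos by (intro div_mult_self1) simp
    finally show ?thesis .
  qed
  have "step M (config (Count (s1 mod D) (s2 mod D)) (queue_tape p xs, p + int j) b (tx, s1 div D) (ty, s2 div D)) =
    config (Count ((s1 mod D + d1 l) mod D) ((s2 mod D + d2 l) mod D))
      (act (scan (queue_tape p xs, p + int j), MoveR) (queue_tape p xs, p + int j)) (act (scan b, Stay) b)
      (act (scan (tx, s1 div D), direction ((s1 mod D + d1 l) div D)) (tx, s1 div D))
      (act (scan (ty, s2 div D), direction ((s2 mod D + d2 l) div D)) (ty, s2 div D))"
  proof (rule step_config)
    show "transition (Count (s1 mod D) (s2 mod D)) (scan (queue_tape p xs, p + int j)) (scan b) (scan (tx, s1 div D)) (scan (ty, s2 div D)) =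
      (Count ((s1 mod D + d1 l) mod D) ((s2 mod D + d2 l) mod D),
       [(scan (queue_tape p xs, p + int j), MoveR), (scan b, Stay),
        (scan (tx, s1 div D), direction ((s1 mod D + d1 l) div D)), (scan (ty, s2 div D), direction ((s2 mod D + d2 l) div D))])"
      unfolding read by (simp add: entry_symbol_not_Blank entry_entry_symbol[OF assms(2)] Let_def l_def)
  qed (use D_pos in \<open>simp_all add: control_states_iff\<close>)
  then show ?thesis
    unfolding act_scan_Stay l_def[symmetric] pos
    by (simp add: move_head_direction[OF div_D_range(1)[OF l r]] move_head_direction[OF div_D_range(2)[OF l r]]
        carry[symmetric] mod_add_left_eq)
qed

lemma count_letters:
  assumes "set (pre @ ys) \<subseteq> entries"
  shows "reaches M (length ys)
    (config (Count (total d1 (map fst pre) mod D) (total d2 (map fst pre) mod D)) (queue_tape p (pre @ ys), p + int (length pre)) b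
      (tx, total d1 (map fst pre) div D) (ty, total d2 (map fst pre) div D))
    (\<lambda>c'. c' = config (Count (total d1 (map fst (pre @ ys)) mod D) (total d2 (map fst (pre @ ys)) mod D))
      (queue_tape p (pre @ ys), p + int (length (pre @ ys))) b
      (tx, total d1 (map fst (pre @ ys)) div D) (ty, total d2 (map fst (pre @ ys)) div D))"
  using assms
proof (induction ys arbitrary: pre)
  case Nil
  then show ?case by (intro reaches_here) simp
next
  case (Cons e ys)
  have e: "(pre @ e # ys) ! length pre \<in> entries" "length pre < length (pre @ e # ys)" using Cons.prems by auto
  show ?case
    using Cons.IH[of "pre @ [e]"] Cons.prems unfolding length_Cons
    by (intro reaches_step) (simp add: step_Count[OF e(2,1)])
qed

lemma count_end:
  fixes s1 s2 :: int
  shows "s1 = 0 \<and> s2 = 0 \<Longrightarrow>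
      step M (config (Count (s1 mod D) (s2 mod D)) (queue_tape p xs, p + int (length xs)) b (marked_tape, s1 div D) (marked_tape, s2 div D)) =
      config Rewind (queue_tape p xs, p + int (length xs) - 1) b (marked_tape, 0) (marked_tape, 0)"
    and "\<not> (s1 = 0 \<and> s2 = 0) \<Longrightarrow>
      rejecting (step M (config (Count (s1 mod D) (s2 mod D)) (queue_tape p xs, p + int (length xs)) b (marked_tape, s1 div D) (marked_tape, s2 div D)))"
proof -
  have read: "scan (queue_tape p xs, p + int (length xs)) = Blank" using queue_tape_right by simp
  \<comment> \<open>The mark is in cell 0, so it is scanned iff the quotient is 0; together with
    remainder 0 this means s = 0.\<close>
  have zero: "s mod D = 0 \<and> marked_tape (s div D) \<noteq> (Blank :: 'l symbol) \<longleftrightarrow> s = 0" for s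
  proof -
    have "marked_tape z \<noteq> (Blank :: 'l symbol) \<longleftrightarrow> z = 0" for z by (simp add: marked_tape_def)
    then show ?thesis by (metis add_0 div_mult_mod_eq mult_zero_left div_0 mod_0)
  qed
  have C: "Count (s1 mod D) (s2 mod D) \<in> control_states" using D_pos by (simp add: control_states_iff)
  {
    assume s: "s1 = 0 \<and> s2 = 0"
    then have "step M (config (Count (s1 mod D) (s2 mod D)) (queue_tape p xs, p + int (length xs)) b (marked_tape, s1 div D) (marked_tape, s2 div D)) =
      config Rewind (act (scan (queue_tape p xs, p + int (length xs)), MoveL) (queue_tape p xs, p + int (length xs)))
        (act (scan b, Stay) b) (act (scan (marked_tape, s1 div D), Stay) (marked_tape, s1 div D)) (act (scan (marked_tape, s2 div D), Stay) (marked_tape, s2 div D))"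
      using C read by (intro step_config) (auto simp: control_states_iff marked_tape_def)
    then show "step M (config (Count (s1 mod D) (s2 mod D)) (queue_tape p xs, p + int (length xs)) b (marked_tape, s1 div D) (marked_tape, s2 div D)) =
      config Rewind (queue_tape p xs, p + int (length xs) - 1) b (marked_tape, 0) (marked_tape, 0)"
      unfolding act_scan_Stay using s by simp
  next
    assume "\<not> (s1 = 0 \<and> s2 = 0)"
    then have "\<not> (s1 mod D = 0 \<and> s2 mod D = 0 \<and> marked_tape (s1 div D) \<noteq> (Blank :: 'l symbol) \<and> marked_tape (s2 div D) \<noteq> (Blank :: 'l symbol))"
      using zero[of s1] zero[of s2] by metis
    then have "step M (config (Count (s1 mod D) (s2 mod D)) (queue_tape p xs, p + int (length xs)) b (marked_tape, s1 div D) (marked_tape, s2 div D)) =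
      config Rej (act (scan (queue_tape p xs, p + int (length xs)), Stay) (queue_tape p xs, p + int (length xs)))
        (act (scan b, Stay) b) (act (scan (marked_tape, s1 div D), Stay) (marked_tape, s1 div D)) (act (scan (marked_tape, s2 div D), Stay) (marked_tape, s2 div D))"
      using C read by (intro step_config) (auto simp: control_states_iff)
    then show "rejecting (step M (config (Count (s1 mod D) (s2 mod D)) (queue_tape p xs, p + int (length xs)) b (marked_tape, s1 div D) (marked_tape, s2 div D)))"
      using rejecting_config by simp
  }
qed

lemma initial_config_M:
  "initial_config M w = config Start (queue_tape 0 (queue w 0 0), 0) (\<lambda>_. Blank, 0) blank_tape blank_tape"
  by (simp add: initial_config_def config_def M_def encoded_machine_def queue_def input_tape_eq
      blank_tape_def numeral_3_eq_3)

text \<open>The two extra steps are the first one, which marks the counters, and the last one, taken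
  on the blank after the input.\<close>

lemma count_phase:
  assumes "set w \<subseteq> L"
  shows "reaches M (length w + 2) (initial_config M w)
    (if total d1 w = 0 \<and> total d2 w = 0
     then (\<lambda>c. c = config Rewind (queue_tape 0 (queue w 0 0), int (length w) - 1) (\<lambda>_. Blank, 0) (marked_tape, 0) (marked_tape, 0))
     else rejecting)" (is "reaches M _ _ ?P")
proof -
  let ?xs = "queue w 0 0"
  have xs: "set ([] @ ?xs) \<subseteq> entries" "length ?xs = length w" "map fst ?xs = w"
    using assms by (auto simp: queue_def entries_def comp_def)
  have "reaches M (length w + 1) (step M (initial_config M w)) ?P"
  proof (rule reaches_trans)
    show "reaches M (length w) (step M (initial_config M w))
      (\<lambda>c'. c' = config (Count (total d1 w mod D) (total d2 w mod D)) (queue_tape 0 ?xs, 0 + int (length ?xs)) (\<lambda>_. Blank, 0)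
        (marked_tape, total d1 w div D) (marked_tape, total d2 w div D))"
      using count_letters[OF xs(1), of 0 "(\<lambda>_. Blank, 0)" marked_tape marked_tape] xs(2,3)
      by (simp add: initial_config_M step_Start)
  next
    fix c' assume c': "c' = config (Count (total d1 w mod D) (total d2 w mod D)) (queue_tape 0 ?xs, 0 + int (length ?xs)) (\<lambda>_. Blank, 0)
        (marked_tape, total d1 w div D) (marked_tape, total d2 w div D)"
    have "?P (step M c')"
      using count_end(1)[of "total d1 w" "total d2 w" 0 ?xs "(\<lambda>_. Blank, 0)"]
        count_end(2)[of "total d1 w" "total d2 w" 0 ?xs "(\<lambda>_. Blank, 0)"] xs(2)
      unfolding c' by auto
    then show "reaches M 1 c' ?P" unfolding One_nat_def by (intro reaches_step reaches_here)
  qed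
  then show ?thesis unfolding numeral_2_eq_2 by (simp add: reaches_step)
qed

lemma reject_nonzero_weight:
  assumes "set w \<subseteq> L" "\<not> (total d1 w = 0 \<and> total d2 w = 0)"
  shows "reaches M (length w + 2) (initial_config M w) rejecting"
  using count_phase[OF assms(1)] assms(2) by simp

lemma decide_zero_weight:
  assumes w: "set w \<subseteq> L" "total d1 w = 0 \<and> total d2 w = 0"
  shows "reaches M (2 * length w + 4 + 2 ^ K * (length w * pass_time (length w))) (initial_config M w)
    (if \<forall>m k. m < 2 ^ K \<and> k < length w \<longrightarrow> rotation_fixes w m k then accepting else rejecting)" (is "reaches M _ _ ?P")
proof -
  let ?xs = "queue w 0 0"
  have len: "length ?xs = length w" by (simp add: queue_def)
  have "reaches M ((length w + 2) + (Suc (length w) + ((2 ^ K - 0) * (length w * pass_time (length w)) + 1))) (initial_config M w) ?P"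
  proof (rule reaches_trans[OF count_phase[OF w(1)]])
    fix c assume "(if total d1 w = 0 \<and> total d2 w = 0
     then (\<lambda>c. c = config Rewind (queue_tape 0 (queue w 0 0), int (length w) - 1) (\<lambda>_. Blank, 0) (marked_tape, 0) (marked_tape, 0))
     else rejecting) c"
    then have c: "c = config Rewind (queue_tape 0 ?xs, 0 + int (length w) - 1) (\<lambda>_. Blank, 0) (marked_tape, 0) (marked_tape, 0)"
      using w(2) by simp
    show "reaches M (Suc (length w) + ((2 ^ K - 0) * (length w * pass_time (length w)) + 1)) c ?P"
    proof (rule reaches_trans)
      show "reaches M (Suc (length w)) c (at_begin ?xs)"
        unfolding c by (rule reaches_mono[OF rewind]) (simp_all add: len at_beginI)
      show "reaches M ((2 ^ K - 0) * (length w * pass_time (length w)) + 1) c' ?P" if "at_begin ?xs c'" for c'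
        using all_rounds[OF w(1) le0 that] by simp
    qed
  qed
  then show ?thesis by (rule reaches_mono) auto
qed

end

section \<open>Average running time\<close>

lemma letter_tables:
  assumes fin: "finite L" and cl: "\<And>l. l \<in> L \<Longrightarrow> f l \<in> thompson_maps"
  obtains K B :: nat and tab :: "'l \<Rightarrow> nat \<Rightarrow> nat \<times> nat"
  where "K \<le> B" "\<And>l. l \<in> L \<Longrightarrow> grid_affine K (f l)"
    "\<And>l m. l \<in> L \<Longrightarrow> m < 2 ^ K \<Longrightarrow> fst (tab l m) < 2 ^ snd (tab l m) \<and> snd (tab l m) \<le> B"
    "\<And>l m y. l \<in> L \<Longrightarrow> m < 2 ^ K \<Longrightarrow> 0 \<le> y \<Longrightarrow> y \<le> 1 \<Longrightarrow>
      f l ((real m + y) / 2 ^ K) = (real (fst (tab l m)) + y) / 2 ^ snd (tab l m)"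
proof -
  have "\<forall>l\<in>L. \<exists>K0. \<forall>K\<ge>K0. grid_affine K (f l)"
    using thompson_grid_affine cl by blast
  then obtain K0 where K0: "\<And>l K. l \<in> L \<Longrightarrow> K0 l \<le> K \<Longrightarrow> grid_affine K (f l)"
    by (metis bchoice)
  \<comment> \<open>A sum of naturals bounds each summand, so this level serves all letters at once;
    \<open>B\<close> is formed in the same manner below.\<close>
  define K where "K = (\<Sum>l\<in>L. K0 l)"
  have grid: "grid_affine K (f l)" if "l \<in> L" for l
    using K0[OF that] member_le_sum[of l L K0] fin that unfolding K_def by simp
  have "\<forall>p\<in>L \<times> {..<2 ^ K}. \<exists>t. fst t < (2 :: nat) ^ snd t \<and>
      (\<forall>y\<in>{0..1}. f (fst p) ((real (snd p) + y) / 2 ^ K) = (real (fst t) + y) / 2 ^ snd t)"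
  proof
    fix p assume "p \<in> L \<times> {..<(2 :: nat) ^ K}"
    then have "fst p \<in> L" "snd p < 2 ^ K" by auto
    then obtain m' l' where "m' < (2 :: nat) ^ l'"
      "\<forall>y\<in>{0..1}. f (fst p) ((real (snd p) + y) / 2 ^ K) = (real m' + y) / 2 ^ l'"
      using grid unfolding grid_affine_def by blast
    then show "\<exists>t. fst t < (2 :: nat) ^ snd t \<and>
      (\<forall>y\<in>{0..1}. f (fst p) ((real (snd p) + y) / 2 ^ K) = (real (fst t) + y) / 2 ^ snd t)"
      by (intro exI[of _ "(m', l')"]) simp
  qed
  then obtain t where t: "\<forall>p\<in>L \<times> {..<2 ^ K}. fst (t p) < (2 :: nat) ^ snd (t p) \<and>
      (\<forall>y\<in>{0..1}. f (fst p) ((real (snd p) + y) / 2 ^ K) = (real (fst (t p)) + y) / 2 ^ snd (t p))"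
    by (metis bchoice)
  define B where "B = K + (\<Sum>p\<in>L \<times> {..<2 ^ K}. snd (t p))"
  show thesis
  proof (rule that[of K B "\<lambda>l m. t (l, m)"])
    show "K \<le> B" by (simp add: B_def)
    show "grid_affine K (f l)" if "l \<in> L" for l using grid[OF that] .
    show "fst (t (l, m)) < 2 ^ snd (t (l, m)) \<and> snd (t (l, m)) \<le> B" if "l \<in> L" "m < 2 ^ K" for l m
    proof -
      have lm: "(l, m) \<in> L \<times> {..<2 ^ K}" using that by simp
      have "snd (t (l, m)) \<le> (\<Sum>p\<in>L \<times> {..<2 ^ K}. snd (t p))"
        by (rule member_le_sum[OF lm]) (use fin in auto)
      then show ?thesis using bspec[OF t lm] by (simp add: B_def)
    qed
    show "f l ((real m + y) / 2 ^ K) = (real (fst (t (l, m))) + y) / 2 ^ snd (t (l, m))"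
      if "l \<in> L" "m < 2 ^ K" "0 \<le> y" "y \<le> 1" for l m y
    proof -
      have "(l, m) \<in> L \<times> {..<2 ^ K}" using that by simp
      from bspec[OF t this] show ?thesis using that by simp
    qed
  qed
qed

text \<open>Every word is charged n + 2 steps. The words of zero weight, a fraction of at most card
  X / (n + 1), are charged C (n + 1)^2 more, which averages to a multiple of n + 1.\<close>

lemma average_bigo_linear:
  fixes \<alpha> \<beta> :: "'a \<Rightarrow> int"
  assumes X: "finite X" "x \<in> X" "y \<in> X" and indep: "\<alpha> x * \<beta> y \<noteq> \<beta> x * \<alpha> y"
    and fast: "\<And>w. w \<in> lists (letters X) \<Longrightarrow> \<not> (weight \<alpha> w = 0 \<and> weight \<beta> w = 0) \<Longrightarrow>
      running_time M w \<le> length w + 2"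
    and slow: "\<And>w. w \<in> lists (letters X) \<Longrightarrow> weight \<alpha> w = 0 \<and> weight \<beta> w = 0 \<Longrightarrow>
      running_time M w \<le> C * (length w + 1)\<^sup>2"
  shows "average_running_time X M \<in> O(\<lambda>n. real n)"
proof -
  have bound: "average_running_time X M n \<le> (real n + 2) + real C * real (card X) * (real n + 1)" for n
  proof -
    define W where "W = words_of_length X n"
    define Z where "Z = {w \<in> W. weight \<alpha> w = 0 \<and> weight \<beta> w = 0}"
    have fin: "finite W" unfolding W_def by (rule finite_words_of_length[OF X(1)])
    have "real (running_time M w) \<le> (real n + 2) + (if w \<in> Z then real C * (real n + 1)\<^sup>2 else 0)"
      if "w \<in> W" for w
    proof -
      have w: "w \<in> lists (letters X)" "length w = n" using that by (auto simp: W_def words_of_length_def)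
      show ?thesis
      proof (cases "w \<in> Z")
        case True
        then have "real (running_time M w) \<le> real (C * (n + 1)\<^sup>2)"
          using slow[OF w(1)] w(2) unfolding Z_def of_nat_le_iff by simp
        then have "real (running_time M w) \<le> real C * (real n + 1)\<^sup>2" by (simp add: add.commute)
        then show ?thesis using True by simp
      next
        case False
        then have "real (running_time M w) \<le> real (n + 2)"
          using fast[OF w(1)] w(2) that unfolding Z_def of_nat_le_iff by simp
        then show ?thesis using False by simp
      qed
    qed
    then have "(\<Sum>w\<in>W. real (running_time M w)) \<le>
        (\<Sum>w\<in>W. (real n + 2) + (if w \<in> Z then real C * (real n + 1)\<^sup>2 else 0))"
      by (rule sum_mono)
    also have "\<dots> = real (card W) * (real n + 2) + real (card Z) * (real C * (real n + 1)\<^sup>2)"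
    proof -
      have "W \<inter> Z = Z" by (auto simp: Z_def)
      then show ?thesis using fin by (simp add: sum.distrib sum.If_cases)
    qed
    also have "\<dots> \<le> real (card W) * (real n + 2) +
        (real (card X) / (real n + 1) * real (card W)) * (real C * (real n + 1)\<^sup>2)"
      using card_zero_weight_words[where x = x and y = y and \<alpha> = \<alpha> and \<beta> = \<beta> and n = n, OF X indep]
      unfolding Z_def W_def by (intro add_left_mono mult_right_mono) auto
    also have "\<dots> = ((real n + 2) + real C * real (card X) * (real n + 1)) * real (card W)"
    proof -
      have "c / m * W * (d * m\<^sup>2) = d * c * m * W" if "m \<noteq> 0" for c d m W :: real
        using that by (simp add: power2_eq_square)
      from this[of "real n + 1"] show ?thesis by (simp add: algebra_simps)
    qed
    finally have "(\<Sum>w\<in>W. real (running_time M w)) \<le>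
        ((real n + 2) + real C * real (card X) * (real n + 1)) * real (card W)" .
    moreover have "card X > 0" using X by (auto simp: card_gt_0_iff)
    then have "real (card W) > 0" using card_words_of_length[OF X(1), of n] by (simp add: W_def)
    ultimately show ?thesis
      unfolding average_running_time_def W_def[symmetric] by (simp add: pos_divide_le_eq)
  qed
  \<comment> \<open>For n at least 1 the constants are absorbed by n + 2 <= 3 n and n + 1 <= 2
    n.\<close>
  have norm_bound: "norm (average_running_time X M n) \<le> (3 + 2 * (real C * real (card X))) * norm (real n)" if "n \<ge> 1" for n
  proof -
    have "average_running_time X M n \<ge> 0"
      unfolding average_running_time_def by (intro divide_nonneg_nonneg sum_nonneg) auto
    moreover have "(real n + 2) + real C * real (card X) * (real n + 1) \<le>
        3 * real n + real C * real (card X) * (2 * real n)"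
      using that by (intro add_mono mult_left_mono) auto
    ultimately show ?thesis using bound[of n] by (simp add: algebra_simps)
  qed
  show ?thesis
    by (rule bigoI[OF eventually_at_top_linorderI[OF norm_bound]])
qed

theorem proposition4:
  fixes X :: "(real \<Rightarrow> real) set"
  assumes "finite X"
    and "X \<subseteq> carrier thompson_F"
    and "generate thompson_F X = carrier thompson_F"
  shows "word_problem_average_case_linear thompson_F X"
proof -
  let ?v = "letter_value thompson_F"
  define L where "L = letters X"
  have finL: "finite L" unfolding L_def using finite_letters[OF assms(1)] .
  obtain x y where xy: "x \<in> X" "y \<in> X" "slope0 x * slope1 y \<noteq> slope1 x * slope0 y"
    using generators_with_independent_slopes[OF assms(2,3)] .
  have closed: "inv_letter l \<in> thompson_maps" if "l \<in> L" for l
    using inv_letter_closed[OF assms(2)] that unfolding L_def .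
  obtain K B tab where tab: "K \<le> B" "\<And>l. l \<in> L \<Longrightarrow> grid_affine K (inv_letter l)"
    "\<And>l m. l \<in> L \<Longrightarrow> m < 2 ^ K \<Longrightarrow> fst (tab l m) < (2 :: nat) ^ snd (tab l m) \<and> snd (tab l m) \<le> B"
    "\<And>l m y. l \<in> L \<Longrightarrow> m < 2 ^ K \<Longrightarrow> 0 \<le> y \<Longrightarrow> y \<le> 1 \<Longrightarrow>
      inv_letter l ((real m + y) / 2 ^ K) = (real (fst (tab l m)) + y) / 2 ^ snd (tab l m)"
    using letter_tables[of L inv_letter, OF finL closed] by metis
  define D where "D = 1 + (\<Sum>l\<in>L. \<bar>slope0 (?v l)\<bar> + \<bar>slope1 (?v l)\<bar>)"
  have D: "\<bar>slope0 (?v l)\<bar> \<le> D \<and> \<bar>slope1 (?v l)\<bar> \<le> D" if "l \<in> L" for l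
  proof -
    have "\<bar>slope0 (?v l)\<bar> + \<bar>slope1 (?v l)\<bar> \<le> (\<Sum>l\<in>L. \<bar>slope0 (?v l)\<bar> + \<bar>slope1 (?v l)\<bar>)"
      by (rule member_le_sum[OF that]) (use finL in auto)
    then show ?thesis using abs_ge_zero[of "slope0 (?v l)"] abs_ge_zero[of "slope1 (?v l)"] unfolding D_def by linarith
  qed
  have D_pos: "D > 0" unfolding D_def by (intro add_pos_nonneg sum_nonneg) auto
  interpret rotation_machine L K B D "\<lambda>l. slope0 (?v l)" "\<lambda>l. slope1 (?v l)" tab inv_letter
    by unfold_locales (use finL D_pos D tab in auto)
  have weights: "total (\<lambda>l. slope0 (?v l)) w = weight slope0 w" "total (\<lambda>l. slope1 (?v l)) w = weight slope1 w"
    if w: "w \<in> lists (letters X)" for w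
  proof -
    have "slope0 (?v l) = signed slope0 l \<and> slope1 (?v l) = signed slope1 l" if "l \<in> set w" for l
    proof -
      have "fst l \<in> X" using w that by (auto simp: letters_def)
      then show ?thesis using slopes_letter_value[OF assms(2), of "fst l" "snd l"] by (simp add: signed_def)
    qed
    then show "total (\<lambda>l. slope0 (?v l)) w = weight slope0 w" "total (\<lambda>l. slope1 (?v l)) w = weight slope1 w"
      by (auto intro!: arg_cong[of _ _ sum_list])
  qed
  have halts: "halted M c" if "accepting c \<or> rejecting c" for c
    using that by (auto simp: halted_def)
  \<comment> \<open>The slopes are homomorphisms to the integers, so a nonzero weight proves the
    word nontrivial and the early rejection is correct.\<close>
  have nonzero: "halts_on M w \<and> \<not> accepts M w \<and> word_value thompson_F w \<noteq> \<one>\<^bsub>thompson_F\<^esub> \<and>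
      running_time M w \<le> length w + 2"
    if w: "w \<in> lists (letters X)" and nz: "\<not> (weight slope0 w = 0 \<and> weight slope1 w = 0)" for w
  proof -
    have r: "reaches M (length w + 2) (initial_config M w) rejecting"
      using reject_nonzero_weight[of w] w nz weights[OF w] by (auto simp: L_def)
    then have "reaches M (length w + 2) (initial_config M w) (halted M)"
      by (rule reaches_mono) (use halts in auto)
    moreover have "word_value thompson_F w \<noteq> \<one>\<^bsub>thompson_F\<^esub>"
      using slopes_word_value[OF assms(2) w] slopes_one nz weights[OF w] by auto
    ultimately show ?thesis
      using reaches_halted reaches_reject[OF r accept_neq_reject] by blast
  qed
  \<comment> \<open>There are 2^K n passes of at most (2 B + 2)(n + 1) steps each; the 4 pays for
    counting, rewinding and the accepting step, 2 n + 4 in all.\<close>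
  define C where "C = 4 + 2 ^ K * (2 * B + 2)"
  have zero: "halts_on M w \<and> (accepts M w \<longleftrightarrow> word_value thompson_F w = \<one>\<^bsub>thompson_F\<^esub>) \<and>
      running_time M w \<le> C * (length w + 1)\<^sup>2"
    if w: "w \<in> lists (letters X)" and z: "weight slope0 w = 0 \<and> weight slope1 w = 0" for w
  proof -
    let ?n = "length w"
    let ?R = "\<forall>m k. m < 2 ^ K \<and> k < length w \<longrightarrow> rotation_fixes w m k"
    have one: "word_value thompson_F w = \<one>\<^bsub>thompson_F\<^esub> \<longleftrightarrow> ?R"
      using word_value_one_iff_rotations_fix_grid[OF assms(2) w, of K] tab(2) unfolding L_def by blast
    have time: "2 * ?n + 4 + 2 ^ K * (?n * pass_time ?n) \<le> C * (?n + 1)\<^sup>2"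
    proof -
      have "?n * pass_time ?n \<le> (2 * B + 2) * (?n + 1)\<^sup>2"
        by (simp add: pass_time_def power2_eq_square algebra_simps)
      then have "2 ^ K * (?n * pass_time ?n) \<le> 2 ^ K * ((2 * B + 2) * (?n + 1)\<^sup>2)" by (rule mult_le_mono2)
      moreover have "2 * ?n + 4 \<le> 4 * (?n + 1)\<^sup>2" by (simp add: power2_eq_square algebra_simps)
      ultimately show ?thesis unfolding C_def add_mult_distrib mult.assoc by linarith
    qed
    have wL: "set w \<subseteq> L" using w by (auto simp: L_def)
    have "total (\<lambda>l. slope0 (?v l)) w = 0 \<and> total (\<lambda>l. slope1 (?v l)) w = 0"
      using weights[OF w] z by simp
    from decide_zero_weight[OF wL this]
    have "reaches M (2 * ?n + 4 + 2 ^ K * (?n * pass_time ?n)) (initial_config M w) (if ?R then accepting else rejecting)" .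
    then have r: "reaches M (C * (?n + 1)\<^sup>2) (initial_config M w) (if ?R then accepting else rejecting)"
      by (rule reaches_mono[OF _ time])
    then have "reaches M (C * (?n + 1)\<^sup>2) (initial_config M w) (halted M)"
      by (rule reaches_mono[OF _ order_refl]) (use halts in \<open>auto split: if_splits\<close>)
    moreover have "accepts M w \<longleftrightarrow> ?R"
    proof (cases ?R)
      case True
      then show ?thesis using reaches_accept[OF r[unfolded if_P[OF True]]] by blast
    next
      case False
      then show ?thesis using reaches_reject[OF r[unfolded if_not_P[OF False]] accept_neq_reject] by blast
    qed
    ultimately show ?thesis using reaches_halted one by blast
  qed
  have "halts_on M w \<and> (accepts M w \<longleftrightarrow> word_value thompson_F w = \<one>\<^bsub>thompson_F\<^esub>)"
    if "w \<in> lists (letters X)" for w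
    using zero[OF that] nonzero[OF that] by blast
  then have "solves_word_problem thompson_F X M"
    unfolding solves_word_problem_def using multitape_TM_M unfolding L_def by blast
  moreover have "average_running_time X M \<in> O(\<lambda>n. real n)"
    by (rule average_bigo_linear[where \<alpha> = slope0 and \<beta> = slope1 and x = x and y = y and C = C, OF assms(1) xy]) (use zero nonzero in blast)+
  ultimately show ?thesis unfolding word_problem_average_case_linear_def by blast
qed

end
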